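(* Let $\mathcal{G}$ be a finite-dimensional (real or complex) self-dual Lie algebra with a fixed invariant scalar product $\langle\ ,\ \rangle$, let $G$ be a connected Lie group with Lie algebra $\mathcal{G}$, and let $r\in\mathcal{G}\wedge\mathcal{G}$ be a constant antisymmetric solution of the modified classical Yang-Baxter equation $[r_{12},r_{13}]+\text{cycl. perm.}=-\frac14 f$. Let $\check G\subset G$ be a nonempty open submanifold stable under conjugation by every $q\in G$, and let $R:\check G\to\mathcal{G}\wedge\mathcal{G}$ be a (smooth in the real case, holomorphic in the complex case) map that is $G$-equivariant: $$R(q\Omega q^{-1})=(q\otimes q)\,R(\Omega)\,(q^{-1}\otimes q^{-1})\qquad\forall q\in G,\ \Omega\in\check G .$$ On $\check P:=\check G\times G\times\check G=\{(\Omega^L,g,\Omega^R)\}$ consider the bracket $\{\ ,\ \}$ on (smooth or holomorphic) functions determined by $$\{g_1,g_2\}=(r+R(\Omega^L))g_1g_2-g_1g_2(r+R(\Omega^R)),$$ $$\{\Omega^L_1,\Omega^L_2\}=r\Omega^L_1\Omega^L_2+\Omega^L_1\Omega^L_2r-\Omega^L_1r^-\Omega^L_2-\Omega^L_2r^+\Omega^L_1,\qquad \{\Omega^L_1,g_2\}=(r^+\Omega^L_1-\Omega^L_1r^-)g_2,$$ $$\{\Omega^R_1,\Omega^R_2\}=-\left(r\Omega^R_1\Omega^R_2+\Omega^R_1\Omega^R_2r-\Omega^R_1r^-\Omega^R_2-\Omega^R_2r^+\Omega^R_1\right),\qquad \{\Omega^R_1,g_2\}=g_2(r^+\Omega^R_1-\Omega^R_1r^-),$$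 $$\{\Omega^R_1,\Omega^L_2\}=0 .$$ Then $\{\ ,\ \}$ is a Poisson bracket on $\check P$ if and only if there is a constant $G$-invariant element $\mathcal{I}\in\mathcal{G}\wedge\mathcal{G}\wedge\mathcal{G}$ such that $$[R_{12},R_{13}]+\tfrac12\,T^a_3\,\mathcal{D}^+_aR_{12}+\text{cycl. perm.}=\mathcal{I}\qquad\text{on }\check G .$$
   Context: A self-dual Lie algebra is one that admits an invariant nondegenerate symmetric bilinear form (called an invariant scalar product). Let $\{T_a\}$, $\{T^a\}$ be dual bases of $\mathcal{G}$: $\langle T_a,T^b\rangle=\delta_a^b$, $[T_a,T_b]=f_{ab}^cT_c$. Summation over repeated indices is understood. Put $f=f_{ab}^c\,T^a\otimes T^b\otimes T_c$, $C=T_a\otimes T^a$, $r^\pm=r\pm\frac12C$. Subscripts $1,2,3$ denote tensor factors. "cycl. perm." means that the terms obtained by cyclically permuting the labels $1\to2\to3\to1$ are added; e.g. $[R_{12},R_{13}]+\text{cycl. perm.}=[R_{12},R_{13}]+[R_{23},R_{21}]+[R_{31},R_{32}]$, and $T^a_3\mathcal{D}^+_aR_{12}+\text{cycl. perm.}=T^a_3\mathcal{D}^+_aR_{12}+T^a_1\mathcal{D}^+_aR_{23}+T^a_2\mathcal{D}^+_aR_{31}$. For a function $\varphi$ on (an open subset of) $G$ and $X\in\mathcal{G}$ set $(\lambda_X\varphi)(g)=\frac{d}{dt}|_{t=0}\varphi(e^{tX}g)$ and $(\rho_X\varphi)(g)=\frac{d}{dt}|_{t=0}\varphi(ge^{tX})$;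 write $\lambda_a=\lambda_{T_a}$, $\rho_a=\rho_{T_a}$, and $\mathcal{D}^+_a=\rho_a+\lambda_a$. Also $(q\otimes q)R(q^{-1}\otimes q^{-1})$ means $(\mathrm{Ad}_q\otimes\mathrm{Ad}_q)R$. The bracket is given in the standard tensorial notation, $\{A_1,B_2\}_{ik,jl}=\{A_{ij},B_{kl}\}$ for the matrix entries in an arbitrary matrix representation of $G$, and is extended to all functions as an antisymmetric biderivation. Intrinsically, writing $s=s^{ab}T_a\otimes T_b$ for $s\in\mathcal{G}\otimes\mathcal{G}$, it is the biderivation such that: - for functions $\varphi,\psi$ of $g$: $\{\varphi,\psi\}=(r+R(\Omega^L))^{ab}\lambda_a\varphi\,\lambda_b\psi-(r+R(\Omega^R))^{ab}\rho_a\varphi\,\rho_b\psi$; - for $\varphi,\psi$ functions of $\Omega^L$: $\{\varphi,\psi\}=r^{ab}\lambda_a\varphi\lambda_b\psi+r^{ab}\rho_a\varphi\rho_b\psi-(r^-)^{ab}\rho_a\varphi\lambda_b\psi-(r^+)^{ab}\lambda_a\varphi\rho_b\psi$, and for $\varphi,\psi$ functions of $\Omega^R$ the negative of the same expression; - for $\varphi$ a function of $\Omega^L$ and $\psi$ a function of $g$: $\{\varphi,\psi\}=(r^+)^{ab}\lambda_a\varphi\lambda_b\psi-(r^-)^{ab}\rho_a\varphi\lambda_b\psi$; - for $\varphi$ a function of $\Omega^R$ and $\psi$ a function of $g$: $\{\varphi,\psi\}=(r^+)^{ab}\lambda_a\varphi\rho_b\psi-(r^-)^{ab}\rho_a\varphi\rho_b\psi$;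 - functions of $\Omega^R$ and functions of $\Omega^L$ have zero bracket. "Poisson bracket" means that this antisymmetric biderivation satisfies the Jacobi identity. *)

theory Defs
  imports "HOL-Analysis.Analysis" "HOL-Algebra.Group"
begin

text \<open>
  The ground field is a type of class real_normed_field and euclidean_space, i.e. a
  finite-dimensional commutative real division algebra. By the theorem of
  Frobenius this means the real or the complex numbers, so that each notion below covers
  both the real smooth and the complex holomorphic setting; for complex scalars, being
  infinitely often differentiable over the ground field is the same as being holomorphic.
\<close>

subsection \<open>Smooth functions and manifolds\<close>

text \<open>The derivative is required to be linear over the ground field; \<open>D i\<close> is the \<open>i\<close>-th
  partial derivative. Both predicates are meant for open \<open>S\<close>.\<close>

primrec Ck_on ::
  "nat \<Rightarrow> ('k::{real_normed_field,euclidean_space} ^ 'd::finite) set \<Rightarrow> ('k ^ 'd \<Rightarrow> 'k) \<Rightarrow> bool"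
where
  "Ck_on 0 S f \<longleftrightarrow> continuous_on S f"
| "Ck_on (Suc k) S f \<longleftrightarrow>
     (\<exists>D. (\<forall>x\<in>S. (f has_derivative (\<lambda>h. \<Sum>i\<in>UNIV. D i x * h $ i)) (at x)) \<and>
          (\<forall>i. Ck_on k S (D i)))"

definition smooth_on ::
  "('k::{real_normed_field,euclidean_space} ^ 'd::finite) set \<Rightarrow> ('k ^ 'd \<Rightarrow> 'k) \<Rightarrow> bool"
where
  "smooth_on S f \<longleftrightarrow> (\<forall>k. Ck_on k S f)"

type_synonym ('p, 'k, 'd) atlas = "('p set \<times> ('p \<Rightarrow> 'k ^ 'd)) set"

definition smooth_map ::
  "'p topology \<Rightarrow> ('p, 'k::{real_normed_field,euclidean_space}, 'd::finite) atlas \<Rightarrow>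
   'q topology \<Rightarrow> ('q, 'k, 'e::finite) atlas \<Rightarrow> ('p \<Rightarrow> 'q) \<Rightarrow> bool"
where
  "smooth_map T A S B f \<longleftrightarrow> continuous_map T S f \<and>
     (\<forall>(U, \<phi>)\<in>A. \<forall>(V, \<psi>)\<in>B. \<forall>i.
        smooth_on (\<phi> ` {p\<in>U. f p \<in> V}) (\<lambda>x. \<psi> (f (inv_into U \<phi> x)) $ i))"

definition smooth_function ::
  "('p, 'k::{real_normed_field,euclidean_space}, 'd::finite) atlas \<Rightarrow> 'p set \<Rightarrow> ('p \<Rightarrow> 'k) \<Rightarrow> bool"
where
  "smooth_function A W f \<longleftrightarrow>
     (\<forall>(U, \<phi>)\<in>A. smooth_on (\<phi> ` (U \<inter> W)) (\<lambda>x. f (inv_into U \<phi> x)))"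

definition manifold ::
  "'p topology \<Rightarrow> ('p, 'k::{real_normed_field,euclidean_space}, 'd::finite) atlas \<Rightarrow> bool"
where
  "manifold T A \<longleftrightarrow>
     Hausdorff_space T \<and> second_countable T \<and> (\<Union>(U, \<phi>)\<in>A. U) = topspace T \<and>
     (\<forall>(U, \<phi>)\<in>A. openin T U \<and> open (\<phi> ` U) \<and>
        homeomorphic_map (subtopology T U) (top_of_set (\<phi> ` U)) \<phi>) \<and>
     (\<forall>(U, \<phi>)\<in>A. \<forall>(V, \<psi>)\<in>A. \<forall>i.
        smooth_on (\<phi> ` (U \<inter> V)) (\<lambda>x. \<psi> (inv_into U \<phi> x) $ i))"

definition prod_atlas ::
  "('p, 'k, 'd::finite) atlas \<Rightarrow> ('q, 'k, 'e::finite) atlas \<Rightarrow> ('p \<times> 'q, 'k, 'd + 'e) atlas"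
where
  "prod_atlas A B =
     {(U \<times> V, \<lambda>(p, q). \<chi> i. case i of Inl a \<Rightarrow> \<phi> p $ a | Inr b \<Rightarrow> \<psi> q $ b)
       | U \<phi> V \<psi>. (U, \<phi>) \<in> A \<and> (V, \<psi>) \<in> B}"

subsection \<open>Lie groups and their Lie algebras\<close>

text \<open>
  The underlying vector space of the Lie algebra is \<open>'k ^ 'n\<close>, i.e. a basis is fixed, and
  \<open>(T\<^sub>a)\<close> is the standard basis; the bracket is arbitrary. The
  Lie algebra is tied to the group by the exponential map, see \<open>lie_group\<close> below.
\<close>

record ('g, 'k, 'n) lie_group_data = "'g monoid" +
  topol :: "'g topology"
  charts :: "('g, 'k, 'n) atlas"
  Exp :: "'k ^ 'n \<Rightarrow> 'g"
  lie_br :: "'k ^ 'n \<Rightarrow> 'k ^ 'n \<Rightarrow> 'k ^ 'n"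

text \<open>Derivatives along right-invariant (\<open>\<lambda>\<^sub>X\<close>) and left-invariant (\<open>\<rho>\<^sub>X\<close>) vector fields.\<close>

definition lam ::
  "('g, 'k::{real_normed_field,euclidean_space}, 'n::finite) lie_group_data \<Rightarrow>
   'k ^ 'n \<Rightarrow> ('g \<Rightarrow> 'k) \<Rightarrow> 'g \<Rightarrow> 'k"
where
  "lam G X \<phi> g = deriv (\<lambda>t. \<phi> (Exp G (t *s X) \<otimes>\<^bsub>G\<^esub> g)) 0"

definition rho ::
  "('g, 'k::{real_normed_field,euclidean_space}, 'n::finite) lie_group_data \<Rightarrow>
   'k ^ 'n \<Rightarrow> ('g \<Rightarrow> 'k) \<Rightarrow> 'g \<Rightarrow> 'k"
where
  "rho G X \<phi> g = deriv (\<lambda>t. \<phi> (g \<otimes>\<^bsub>G\<^esub> Exp G (t *s X))) 0"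

definition lie_algebra :: "('k::field ^ 'n::finite \<Rightarrow> 'k ^ 'n \<Rightarrow> 'k ^ 'n) \<Rightarrow> bool" where
  "lie_algebra br \<longleftrightarrow>
     (\<forall>X Y Z c. br (X + c *s Y) Z = br X Z + c *s br Y Z) \<and>
     (\<forall>X Y Z c. br Z (X + c *s Y) = br Z X + c *s br Z Y) \<and>
     (\<forall>X. br X X = 0) \<and>
     (\<forall>X Y Z. br X (br Y Z) + br Y (br Z X) + br Z (br X Y) = 0)"

definition invariant_scalar_product ::
  "('k::field ^ 'n::finite \<Rightarrow> 'k ^ 'n \<Rightarrow> 'k ^ 'n) \<Rightarrow> ('k ^ 'n \<Rightarrow> 'k ^ 'n \<Rightarrow> 'k) \<Rightarrow> bool"
where
  "invariant_scalar_product br B \<longleftrightarrow>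
     (\<forall>X Y Z c. B (X + c *s Y) Z = B X Z + c * B Y Z) \<and>
     (\<forall>X Y. B X Y = B Y X) \<and>
     (\<forall>X. (\<forall>Y. B X Y = 0) \<longrightarrow> X = 0) \<and>
     (\<forall>X Y Z. B (br X Y) Z = B X (br Y Z))"

text \<open>
  The last three conditions say that \<open>Exp\<close> is the exponential map of \<open>G\<close> with respect to an
  identification of \<open>'k ^ 'n\<close> with the tangent space at \<open>\<one>\<close> (sending \<open>X\<close> to the velocity of
  \<open>t \<mapsto> Exp (t X)\<close> at \<open>t = 0\<close>), under which \<open>lie_br\<close> is the commutator of left-invariant
  vector fields.
\<close>

definition lie_group ::
  "('g, 'k::{real_normed_field,euclidean_space}, 'n::finite) lie_group_data \<Rightarrow> bool"
where
  "lie_group G \<longleftrightarrow>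
     group G \<and> topspace (topol G) = carrier G \<and> manifold (topol G) (charts G) \<and>
     smooth_map (prod_topology (topol G) (topol G)) (prod_atlas (charts G) (charts G))
       (topol G) (charts G) (\<lambda>(x, y). x \<otimes>\<^bsub>G\<^esub> y) \<and>
     smooth_map (topol G) (charts G) (topol G) (charts G) (\<lambda>x. inv\<^bsub>G\<^esub> x) \<and>
     lie_algebra (lie_br G) \<and>
     (smooth_map euclidean {(UNIV, \<lambda>X. X)} (topol G) (charts G) (Exp G) \<and>
      (\<forall>X s t. Exp G ((s + t) *s X) = Exp G (s *s X) \<otimes>\<^bsub>G\<^esub> Exp G (t *s X))) \<and>
     (\<forall>(U, \<phi>)\<in>charts G. \<one>\<^bsub>G\<^esub> \<in> U \<longrightarrow> bij (\<lambda>X. \<chi> i. rho G X (\<lambda>g. \<phi> g $ i) \<one>\<^bsub>G\<^esub>)) \<and>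
     (\<forall>W f X Y. openin (topol G) W \<and> smooth_function (charts G) W f \<longrightarrow>
        (\<forall>g\<in>W. rho G X (rho G Y f) g - rho G Y (rho G X f) g = rho G (lie_br G X Y) f g))"

text \<open>\<open>Ad\<^sub>q\<close> is the differential at \<open>\<one>\<close> of conjugation by \<open>q\<close>.\<close>

definition Ad ::
  "('g, 'k::{real_normed_field,euclidean_space}, 'n::finite) lie_group_data \<Rightarrow>
   'g \<Rightarrow> 'k ^ 'n \<Rightarrow> 'k ^ 'n"
where
  "Ad G q X = (THE Y. \<forall>W f. openin (topol G) W \<and> \<one>\<^bsub>G\<^esub> \<in> W \<and> smooth_function (charts G) W f \<longrightarrow>
     deriv (\<lambda>t. f (Exp G (t *s Y))) 0 =
     deriv (\<lambda>t. f (q \<otimes>\<^bsub>G\<^esub> Exp G (t *s X) \<otimes>\<^bsub>G\<^esub> inv\<^bsub>G\<^esub> q)) 0)"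

subsection \<open>Tensors over the Lie algebra\<close>

text \<open>Elements of the tensor square and cube are given by their components with respect to
  \<open>T\<^sub>a \<otimes> T\<^sub>b\<close> and \<open>T\<^sub>a \<otimes> T\<^sub>b \<otimes> T\<^sub>c\<close>.\<close>

type_synonym ('k, 'n) tensor2 = "'n \<Rightarrow> 'n \<Rightarrow> 'k"
type_synonym ('k, 'n) tensor3 = "'n \<Rightarrow> 'n \<Rightarrow> 'n \<Rightarrow> 'k"

definition antisym2 :: "('k::field, 'n) tensor2 \<Rightarrow> bool" where
  "antisym2 s \<longleftrightarrow> (\<forall>a b. s b a = - s a b)"

definition antisym3 :: "('k::field, 'n) tensor3 \<Rightarrow> bool" where
  "antisym3 s \<longleftrightarrow> (\<forall>a b c. s b a c = - s a b c \<and> s a c b = - s a b c)"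

abbreviation basis_vec :: "'n::finite \<Rightarrow> 'k::field ^ 'n" where
  "basis_vec a \<equiv> axis a 1"

definition dual_basis :: "('k::field ^ 'n::finite \<Rightarrow> 'k ^ 'n \<Rightarrow> 'k) \<Rightarrow> 'n \<Rightarrow> 'k ^ 'n" where
  "dual_basis B b = (THE X. \<forall>a. B (basis_vec a) X = (if a = b then 1 else 0))"

text \<open>\<open>C = T\<^sub>a \<otimes> T\<^sup>a\<close> and \<open>f = f\<^sub>a\<^sub>b\<^sup>c T\<^sup>a \<otimes> T\<^sup>b \<otimes> T\<^sub>c\<close>.\<close>

definition casimir :: "('k::field ^ 'n::finite \<Rightarrow> 'k ^ 'n \<Rightarrow> 'k) \<Rightarrow> ('k, 'n) tensor2" where
  "casimir B a b = dual_basis B a $ b"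

definition struct_const ::
  "('k::field ^ 'n::finite \<Rightarrow> 'k ^ 'n \<Rightarrow> 'k ^ 'n) \<Rightarrow> 'n \<Rightarrow> 'n \<Rightarrow> 'n \<Rightarrow> 'k"
where
  "struct_const br a b c = br (basis_vec a) (basis_vec b) $ c"

definition f_tensor ::
  "('k::field ^ 'n::finite \<Rightarrow> 'k ^ 'n \<Rightarrow> 'k ^ 'n) \<Rightarrow> ('k ^ 'n \<Rightarrow> 'k ^ 'n \<Rightarrow> 'k) \<Rightarrow> ('k, 'n) tensor3"
where
  "f_tensor br B i j k =
     (\<Sum>a\<in>UNIV. \<Sum>b\<in>UNIV. struct_const br a b k * dual_basis B a $ i * dual_basis B b $ j)"

text \<open>The three summands are the tensors obtained from \<open>s\<close> by the identity, by
  the relabelling \<open>1 \<mapsto> 2 \<mapsto> 3 \<mapsto> 1\<close> of the tensor factors, and by its square.\<close>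

definition cycl :: "('k::field, 'n) tensor3 \<Rightarrow> ('k, 'n) tensor3" where
  "cycl s i j k = s i j k + s j k i + s k i j"

text \<open>\<open>[s\<^sub>1\<^sub>2, s\<^sub>1\<^sub>3] = s\<^sup>a\<^sup>b s\<^sup>c\<^sup>d [T\<^sub>a, T\<^sub>c] \<otimes> T\<^sub>b \<otimes> T\<^sub>d\<close>\<close>

definition comm_12_13 ::
  "('k::field ^ 'n::finite \<Rightarrow> 'k ^ 'n \<Rightarrow> 'k ^ 'n) \<Rightarrow> ('k, 'n) tensor2 \<Rightarrow> ('k, 'n) tensor3"
where
  "comm_12_13 br s i j k = (\<Sum>a\<in>UNIV. \<Sum>c\<in>UNIV. s a j * s c k * struct_const br a c i)"

definition Ad_matrix ::
  "('g, 'k::{real_normed_field,euclidean_space}, 'n::finite) lie_group_data \<Rightarrow> 'g \<Rightarrow> 'n \<Rightarrow> 'n \<Rightarrow> 'k"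
where
  "Ad_matrix G q i a = Ad G q (basis_vec a) $ i"

definition Ad2 ::
  "('g, 'k::{real_normed_field,euclidean_space}, 'n::finite) lie_group_data \<Rightarrow>
   'g \<Rightarrow> ('k, 'n) tensor2 \<Rightarrow> ('k, 'n) tensor2"
where
  "Ad2 G q s i j = (\<Sum>a\<in>UNIV. \<Sum>b\<in>UNIV. Ad_matrix G q i a * Ad_matrix G q j b * s a b)"

definition Ad3 ::
  "('g, 'k::{real_normed_field,euclidean_space}, 'n::finite) lie_group_data \<Rightarrow>
   'g \<Rightarrow> ('k, 'n) tensor3 \<Rightarrow> ('k, 'n) tensor3"
where
  "Ad3 G q s i j k = (\<Sum>a\<in>UNIV. \<Sum>b\<in>UNIV. \<Sum>c\<in>UNIV.
     Ad_matrix G q i a * Ad_matrix G q j b * Ad_matrix G q k c * s a b c)"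

text \<open>\<open>[R\<^sub>1\<^sub>2, R\<^sub>1\<^sub>3] + 1/2 T\<^sup>a\<^sub>3 \<D>\<^sup>+\<^sub>a R\<^sub>1\<^sub>2 + cycl. perm.\<close>\<close>

definition dynamical_YB ::
  "('g, 'k::{real_normed_field,euclidean_space}, 'n::finite) lie_group_data \<Rightarrow>
   ('k ^ 'n \<Rightarrow> 'k ^ 'n \<Rightarrow> 'k) \<Rightarrow> ('g \<Rightarrow> ('k, 'n) tensor2) \<Rightarrow> 'g \<Rightarrow> ('k, 'n) tensor3"
where
  "dynamical_YB G B R \<Omega> = cycl (\<lambda>i j k. comm_12_13 (lie_br G) (R \<Omega>) i j k +
     1 / 2 * (\<Sum>a\<in>UNIV. dual_basis B a $ k *
       (rho G (basis_vec a) (\<lambda>x. R x i j) \<Omega> + lam G (basis_vec a) (\<lambda>x. R x i j) \<Omega>)))"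

subsection \<open>Poisson brackets\<close>

text \<open>
  A Poisson bracket on a manifold is a bracket of functions defined on arbitrary open subsets
  \<open>W\<close>, as is necessary in the holomorphic case, where there may be few global functions.
  Functions on \<open>W\<close> are represented by total functions; the second condition says that their
  values outside \<open>W\<close> are irrelevant.
\<close>

definition poisson_bracket_on ::
  "'p topology \<Rightarrow> ('p, 'k::{real_normed_field,euclidean_space}, 'd::finite) atlas \<Rightarrow>
   (('p \<Rightarrow> 'k) \<Rightarrow> ('p \<Rightarrow> 'k) \<Rightarrow> 'p \<Rightarrow> 'k) \<Rightarrow> bool"
where
  "poisson_bracket_on T A br \<longleftrightarrow> (\<forall>W. openin T W \<longrightarrow>
     (\<forall>f h. smooth_function A W f \<longrightarrow> smooth_function A W h \<longrightarrow>
        smooth_function A W (br f h) \<and>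
        (\<forall>f'. (\<forall>p\<in>W. f' p = f p) \<longrightarrow> (\<forall>p\<in>W. br f' h p = br f h p)) \<and>
        (\<forall>p\<in>W. br f h p = - br h f p) \<and>
        (\<forall>k. smooth_function A W k \<longrightarrow> (\<forall>p\<in>W.
           (\<forall>c. br (\<lambda>x. f x + c * h x) k p = br f k p + c * br h k p) \<and>
           br (\<lambda>x. f x * h x) k p = f p * br h k p + h p * br f k p \<and>
           br f (br h k) p + br h (br k f) p + br k (br f h) p = 0))))"

text \<open>\<open>contract s u v = s\<^sup>a\<^sup>b u\<^sub>a v\<^sub>b\<close>\<close>

definition contract :: "('k::field, 'n::finite) tensor2 \<Rightarrow> ('n \<Rightarrow> 'k) \<Rightarrow> ('n \<Rightarrow> 'k) \<Rightarrow> 'k" where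
  "contract s u v = (\<Sum>a\<in>UNIV. \<Sum>b\<in>UNIV. s a b * u a * v b)"

definition r_plus ::
  "('k::field ^ 'n::finite \<Rightarrow> 'k ^ 'n \<Rightarrow> 'k) \<Rightarrow> ('k, 'n) tensor2 \<Rightarrow> ('k, 'n) tensor2"
where
  "r_plus B r a b = r a b + casimir B a b / 2"

definition r_minus ::
  "('k::field ^ 'n::finite \<Rightarrow> 'k ^ 'n \<Rightarrow> 'k) \<Rightarrow> ('k, 'n) tensor2 \<Rightarrow> ('k, 'n) tensor2"
where
  "r_minus B r a b = r a b - casimir B a b / 2"

text \<open>
  The bracket of two arbitrary functions of \<open>(\<Omega>\<^sup>L, g, \<Omega>\<^sup>R)\<close>: the derivatives \<open>lL, rL\<close> act on the
  first, \<open>lg, rg\<close> on the second and \<open>lR, rR\<close> on the third argument. It is a derivation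
  in each argument and is determined by its values on functions of a single one of the three
  variables; these values are recorded in the lemmas below.
\<close>

definition exchange_bracket ::
  "('g, 'k::{real_normed_field,euclidean_space}, 'n::finite) lie_group_data \<Rightarrow>
   ('k ^ 'n \<Rightarrow> 'k ^ 'n \<Rightarrow> 'k) \<Rightarrow> ('k, 'n) tensor2 \<Rightarrow> ('g \<Rightarrow> ('k, 'n) tensor2) \<Rightarrow>
   ('g \<times> 'g \<times> 'g \<Rightarrow> 'k) \<Rightarrow> ('g \<times> 'g \<times> 'g \<Rightarrow> 'k) \<Rightarrow> 'g \<times> 'g \<times> 'g \<Rightarrow> 'k"
where
  "exchange_bracket G B r R F H = (\<lambda>(\<Omega>L, g, \<Omega>R).
     let lL = (\<lambda>F a. lam G (basis_vec a) (\<lambda>x. F (x, g, \<Omega>R)) \<Omega>L);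
         rL = (\<lambda>F a. rho G (basis_vec a) (\<lambda>x. F (x, g, \<Omega>R)) \<Omega>L);
         lg = (\<lambda>F a. lam G (basis_vec a) (\<lambda>x. F (\<Omega>L, x, \<Omega>R)) g);
         rg = (\<lambda>F a. rho G (basis_vec a) (\<lambda>x. F (\<Omega>L, x, \<Omega>R)) g);
         lR = (\<lambda>F a. lam G (basis_vec a) (\<lambda>x. F (\<Omega>L, g, x)) \<Omega>R);
         rR = (\<lambda>F a. rho G (basis_vec a) (\<lambda>x. F (\<Omega>L, g, x)) \<Omega>R);
         rp = r_plus B r;
         rm = r_minus B r;
         gg = (\<lambda>F H. contract (\<lambda>a b. r a b + R \<Omega>L a b) (lg F) (lg H)
                   - contract (\<lambda>a b. r a b + R \<Omega>R a b) (rg F) (rg H));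
         LL = (\<lambda>F H. contract r (lL F) (lL H) + contract r (rL F) (rL H)
                   - contract rm (rL F) (lL H) - contract rp (lL F) (rL H));
         RR = (\<lambda>F H. - (contract r (lR F) (lR H) + contract r (rR F) (rR H)
                   - contract rm (rR F) (lR H) - contract rp (lR F) (rR H)));
         Lg = (\<lambda>F H. contract rp (lL F) (lg H) - contract rm (rL F) (lg H));
         Rg = (\<lambda>F H. contract rp (lR F) (rg H) - contract rm (rR F) (rg H))
     in gg F H + LL F H + RR F H + (Lg F H - Lg H F) + (Rg F H - Rg H F))"

lemma lam_const [simp]: "lam G X (\<lambda>x. c) g = 0"
  by (simp add: lam_def)

lemma rho_const [simp]: "rho G X (\<lambda>x. c) g = 0"
  by (simp add: rho_def)

lemma contract_zero [simp]: "contract s (\<lambda>a. 0) v = 0" "contract s u (\<lambda>a. 0) = 0"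
  by (simp_all add: contract_def)

lemma exchange_bracket_g_g:
  "exchange_bracket G B r R (\<lambda>(\<Omega>L, g, \<Omega>R). \<phi> g) (\<lambda>(\<Omega>L, g, \<Omega>R). \<psi> g) (\<Omega>L, g, \<Omega>R) =
     contract (\<lambda>a b. r a b + R \<Omega>L a b)
       (\<lambda>a. lam G (basis_vec a) \<phi> g) (\<lambda>a. lam G (basis_vec a) \<psi> g) -
     contract (\<lambda>a b. r a b + R \<Omega>R a b)
       (\<lambda>a. rho G (basis_vec a) \<phi> g) (\<lambda>a. rho G (basis_vec a) \<psi> g)"
  by (simp add: exchange_bracket_def Let_def)

lemma exchange_bracket_L_L:
  "exchange_bracket G B r R (\<lambda>(\<Omega>L, g, \<Omega>R). \<phi> \<Omega>L) (\<lambda>(\<Omega>L, g, \<Omega>R). \<psi> \<Omega>L) (\<Omega>L, g, \<Omega>R) =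
     contract r (\<lambda>a. lam G (basis_vec a) \<phi> \<Omega>L) (\<lambda>a. lam G (basis_vec a) \<psi> \<Omega>L) +
     contract r (\<lambda>a. rho G (basis_vec a) \<phi> \<Omega>L) (\<lambda>a. rho G (basis_vec a) \<psi> \<Omega>L) -
     contract (r_minus B r) (\<lambda>a. rho G (basis_vec a) \<phi> \<Omega>L) (\<lambda>a. lam G (basis_vec a) \<psi> \<Omega>L) -
     contract (r_plus B r) (\<lambda>a. lam G (basis_vec a) \<phi> \<Omega>L) (\<lambda>a. rho G (basis_vec a) \<psi> \<Omega>L)"
  by (simp add: exchange_bracket_def Let_def)

lemma exchange_bracket_R_R:
  "exchange_bracket G B r R (\<lambda>(\<Omega>L, g, \<Omega>R). \<phi> \<Omega>R) (\<lambda>(\<Omega>L, g, \<Omega>R). \<psi> \<Omega>R) (\<Omega>L, g, \<Omega>R) =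
     - (contract r (\<lambda>a. lam G (basis_vec a) \<phi> \<Omega>R) (\<lambda>a. lam G (basis_vec a) \<psi> \<Omega>R) +
     contract r (\<lambda>a. rho G (basis_vec a) \<phi> \<Omega>R) (\<lambda>a. rho G (basis_vec a) \<psi> \<Omega>R) -
     contract (r_minus B r) (\<lambda>a. rho G (basis_vec a) \<phi> \<Omega>R) (\<lambda>a. lam G (basis_vec a) \<psi> \<Omega>R) -
     contract (r_plus B r) (\<lambda>a. lam G (basis_vec a) \<phi> \<Omega>R) (\<lambda>a. rho G (basis_vec a) \<psi> \<Omega>R))"
  by (simp add: exchange_bracket_def Let_def)

lemma exchange_bracket_L_g:
  "exchange_bracket G B r R (\<lambda>(\<Omega>L, g, \<Omega>R). \<phi> \<Omega>L) (\<lambda>(\<Omega>L, g, \<Omega>R). \<psi> g) (\<Omega>L, g, \<Omega>R) =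
     contract (r_plus B r) (\<lambda>a. lam G (basis_vec a) \<phi> \<Omega>L) (\<lambda>a. lam G (basis_vec a) \<psi> g) -
     contract (r_minus B r) (\<lambda>a. rho G (basis_vec a) \<phi> \<Omega>L) (\<lambda>a. lam G (basis_vec a) \<psi> g)"
  by (simp add: exchange_bracket_def Let_def)

lemma exchange_bracket_R_g:
  "exchange_bracket G B r R (\<lambda>(\<Omega>L, g, \<Omega>R). \<phi> \<Omega>R) (\<lambda>(\<Omega>L, g, \<Omega>R). \<psi> g) (\<Omega>L, g, \<Omega>R) =
     contract (r_plus B r) (\<lambda>a. lam G (basis_vec a) \<phi> \<Omega>R) (\<lambda>a. rho G (basis_vec a) \<psi> g) -
     contract (r_minus B r) (\<lambda>a. rho G (basis_vec a) \<phi> \<Omega>R) (\<lambda>a. rho G (basis_vec a) \<psi> g)"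
  by (simp add: exchange_bracket_def Let_def)

lemma exchange_bracket_R_L:
  "exchange_bracket G B r R (\<lambda>(\<Omega>L, g, \<Omega>R). \<phi> \<Omega>R) (\<lambda>(\<Omega>L, g, \<Omega>R). \<psi> \<Omega>L) (\<Omega>L, g, \<Omega>R) = 0"
  by (simp add: exchange_bracket_def Let_def)

end

theory Submission
  imports Defs
begin

text \<open>
  Identify covectors with elements of the Lie algebra by means of the scalar product, put
  \<open>t(X,Y,Z) = \<langle>[X,Y],Z\<rangle>\<close>, and let \<open>\<ell>\<close> be \<open>\<lambda>\<close> acting on \<open>g\<close>. The part of the bracket that
  involves \<open>\<Omega>\<^sup>L\<close> has the Poisson tensor
  \<open>r M \<otimes> M + 1/2 C P \<and> (N/2 + \<ell>) + R(\<Omega>\<^sup>L) \<ell> \<otimes> \<ell>\<close> with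
  \<open>N = \<lambda> - \<rho>\<close>, \<open>P = \<lambda> + \<rho>\<close> (on \<open>\<Omega>\<^sup>L\<close>) and \<open>M = N + \<ell>\<close>, where \<open>M\<close> generates the conjugation
  symmetry. By the modified Yang-Baxter equation for \<open>r\<close>, the equivariance of \<open>R\<close> and the
  identity \<open>C \<lambda> \<otimes> \<lambda> = C \<rho> \<otimes> \<rho>\<close>, its Jacobiator is the dynamical Yang-Baxter tensor at \<open>\<Omega>\<^sup>L\<close>
  minus \<open>f/4\<close>, up to sign contracted with \<open>\<ell>\<close>. The part involving \<open>\<Omega>\<^sup>R\<close> is minus the same
  expression with \<open>\<ell>\<close> replaced by \<open>-\<rho>\<close> on \<open>g\<close>, and the two parts commute. Since \<open>\<lambda>\<close> and \<open>\<rho>\<close>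
  on \<open>g\<close> differ by \<open>Ad\<close>, the Jacobi identity says that the tensor at \<open>\<Omega>\<^sup>R\<close> is the transform by
  \<open>g\<close> of the tensor at \<open>\<Omega>\<^sup>L\<close>, for all \<open>g\<close>, \<open>\<Omega>\<^sup>L\<close> and \<open>\<Omega>\<^sup>R\<close> independently.
\<close>

subsection \<open>Calculus over the ground field\<close>

text \<open>The identity between the two Casimir terms holds because \<open>Ad\<close> preserves the
  scalar product. Invariance is given only infinitesimally; connectedness of the group integrates
  it.

  The six families of fields \<lambda>, \<rho> on the three factors are linearly dependent, but they
  make everything algebraic: their commutators have constant coefficients, and the Poisson tensor is
  constant except in the two blocks that contain \<open>R\<close>. The dependence between \<lambda>
  and \<rho> enters through two facts about the gradients \<open>ul\<close>, \<open>ur\<close> of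
  one function with respect to \<lambda> and \<rho>: differentiation along \<open>ul\<close> by
  \<lambda> and along \<open>ur\<close> by \<rho> agree, and
  \<open>tri ul vl wl = tri ur vr wr\<close>.

  Each half leaves a term \<open>f/4\<close>; the two cancel because the halves carry opposite signs
  and \<open>f\<close> is invariant under \<open>Ad\<close>.

  Necessity rests on brackets being defined for functions on small open sets: near any point of the
  group there are functions with prescribed differential at that point, which isolate the single
  components of the tensor identity.\<close>

definition has_gradient ::
  "('k::{real_normed_field,euclidean_space} ^ 'd::finite \<Rightarrow> 'k) \<Rightarrow> ('d \<Rightarrow> 'k) \<Rightarrow> 'k ^ 'd \<Rightarrow> bool"
where
  "has_gradient f D x \<longleftrightarrow> (f has_derivative (\<lambda>h. \<Sum>i\<in>UNIV. D i * h $ i)) (at x)"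

definition partial ::
  "'d \<Rightarrow> ('k::{real_normed_field,euclidean_space} ^ 'd::finite \<Rightarrow> 'k) \<Rightarrow> 'k ^ 'd \<Rightarrow> 'k"
where
  "partial i f x = frechet_derivative f (at x) (axis i 1)"

lemma sum_axis: "(\<Sum>j\<in>UNIV. D j * axis i c $ j) = D i * (c::'k::comm_ring_1)"
  by (simp add: axis_def if_distrib[of "(*) _"] cong: if_cong)

lemma partial_eqI: "has_gradient f D x \<Longrightarrow> partial i f x = D i"
  by (simp add: partial_def has_gradient_def frechet_derivative_at[symmetric] sum_axis)

lemma has_gradient_cong:
  assumes "open S" "x \<in> S" "\<And>y. y \<in> S \<Longrightarrow> f y = g y"
  shows "has_gradient f D x \<longleftrightarrow> has_gradient g D x"
  unfolding has_gradient_def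
  using has_derivative_transform_within_open[OF _ assms(1,2), of f _ UNIV g]
    has_derivative_transform_within_open[OF _ assms(1,2), of g _ UNIV f] assms(3) by auto

lemma has_gradient_const: "has_gradient (\<lambda>x. c) (\<lambda>i. 0) x"
  by (simp add: has_gradient_def)

lemma has_gradient_component: "has_gradient (\<lambda>x. x $ i) (\<lambda>j. if j = i then 1 else 0) x"
proof -
  have "(\<lambda>h::'a^'b. \<Sum>j\<in>UNIV. (if j = i then 1 else 0) * h $ j) = (\<lambda>h. h $ i)"
    by (simp add: if_distrib[of "\<lambda>x. x * _"] cong: if_cong)
  then show ?thesis
    unfolding has_gradient_def
    using bounded_linear.has_derivative[OF bounded_linear_vec_nth has_derivative_ident, of i] by simp
qed

lemma has_gradient_add:
  "has_gradient f D x \<Longrightarrow> has_gradient g E x \<Longrightarrow>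
     has_gradient (\<lambda>x. f x + g x) (\<lambda>i. D i + E i) x"
  unfolding has_gradient_def
  by (drule (1) has_derivative_add) (simp add: sum.distrib distrib_right)

lemma has_gradient_mult:
  assumes "has_gradient f D x" "has_gradient g E x"
  shows "has_gradient (\<lambda>x. f x * g x) (\<lambda>i. f x * E i + D i * g x) x"
  using has_derivative_mult[OF assms[unfolded has_gradient_def]] unfolding has_gradient_def
  by (simp add: sum.distrib distrib_right sum_distrib_left sum_distrib_right mult.assoc)
    (simp add: mult_ac)

text \<open>The components lie in \<open>'k\<close>, which may have real dimension two, so the
  derivative is assembled from the bounded linear embeddings \<open>axis j\<close> and not from a
  real basis.\<close>

lemma has_derivative_vec:
  fixes G :: "'a::real_normed_vector \<Rightarrow> 'k::{real_normed_field,euclidean_space} ^ 'e::finite"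
  assumes "\<And>j. ((\<lambda>x. G x $ j) has_derivative (\<lambda>h. G' h $ j)) F"
  shows "(G has_derivative G') F"
proof -
  have bl: "bounded_linear (\<lambda>c::'k. axis j c :: 'k ^ 'e)" for j
    by (rule bounded_linear_intro[where K=1])
       (auto simp: axis_def vec_eq_iff norm_vec_def L2_set_def if_distrib[of norm]
         if_distrib[of "\<lambda>x. x^2"] cong: if_cong)
  have *: "(\<Sum>j\<in>UNIV. axis j (v $ j)) = v" for v :: "'k ^ 'e"
    by (auto simp: vec_eq_iff axis_def)
  have "((\<lambda>x. \<Sum>j\<in>UNIV. axis j (G x $ j)) has_derivative (\<lambda>h. \<Sum>j\<in>UNIV. axis j (G' h $ j))) F"
    by (intro has_derivative_sum bounded_linear.has_derivative[OF bl] assms)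
  then show ?thesis by (simp add: *)
qed

lemma has_gradient_compose:
  fixes G :: "'k::{real_normed_field,euclidean_space} ^ 'd::finite \<Rightarrow> 'k ^ 'e::finite"
  assumes "has_gradient f D (G x)" and "\<And>j. has_gradient (\<lambda>x. G x $ j) (E j) x"
  shows "has_gradient (\<lambda>x. f (G x)) (\<lambda>i. \<Sum>j\<in>UNIV. D j * E j i) x"
proof -
  have "(G has_derivative (\<lambda>h. \<chi> j. \<Sum>i\<in>UNIV. E j i * h $ i)) (at x)"
    using assms(2) by (intro has_derivative_vec) (simp add: has_gradient_def)
  from has_derivative_compose[OF this assms(1)[unfolded has_gradient_def]]
  show ?thesis unfolding has_gradient_def
    by (simp add: sum_distrib_left sum_distrib_right mult.assoc)
      (subst sum.swap, simp)
qed

lemma has_gradient_imp_deriv_line: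
  assumes "has_gradient f D (x + t *s v)"
  shows "((\<lambda>t. f (x + t *s v)) has_field_derivative (\<Sum>i\<in>UNIV. D i * v $ i)) (at t)"
proof -
  have "((\<lambda>t. x + t *s v) has_derivative (\<lambda>h. h *s v)) (at t)"
    by (rule has_derivative_vec) (auto intro!: derivative_eq_intros)
  from has_derivative_compose[OF this assms[unfolded has_gradient_def]]
  show ?thesis
    unfolding has_field_derivative_def
    by (rule has_derivative_eq_rhs) (auto simp: fun_eq_iff sum_distrib_right sum_distrib_left mult_ac)
qed

section \<open>Functions of class C^k\<close>

declare Ck_on.simps(2) [simp del]

lemma Ck_on_Suc_intro:
  assumes "\<And>x. x \<in> S \<Longrightarrow> has_gradient f (\<lambda>i. D i x) x" "\<And>i. Ck_on k S (D i)"
  shows "Ck_on (Suc k) S f"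
  using assms by (auto simp: has_gradient_def Ck_on.simps)

lemma Ck_on_cong:
  assumes "open S" "\<And>x. x \<in> S \<Longrightarrow> f x = g x"
  shows "Ck_on k S f \<longleftrightarrow> Ck_on k S g"
proof (cases k)
  case 0 then show ?thesis using assms(2) by (simp cong: continuous_on_cong)
next
  case (Suc m)
  then show ?thesis using has_gradient_cong[OF assms(1) _ assms(2)]
    by (auto simp: Ck_on.simps has_gradient_def[symmetric])
qed

text \<open>Replaces the existentially quantified derivatives by the canonical ones. A witness
  \<open>D\<close> agrees with \<open>partial\<close> on \<open>S\<close> only, which is enough
  because membership in \<open>Ck_on\<close> over an open set depends on the values there.\<close>

lemma Ck_on_Suc_iff:
  assumes "open S"
  shows "Ck_on (Suc k) S f \<longleftrightarrow>
    (\<forall>x\<in>S. has_gradient f (\<lambda>i. partial i f x) x) \<and> (\<forall>i. Ck_on k S (partial i f))"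
proof
  assume "Ck_on (Suc k) S f"
  then obtain D where D: "\<forall>x\<in>S. has_gradient f (\<lambda>i. D i x) x" "\<forall>i. Ck_on k S (D i)"
    by (auto simp: has_gradient_def Ck_on.simps)
  then have "partial i f x = D i x" if "x \<in> S" for i x
    using that partial_eqI by blast
  with D show "(\<forall>x\<in>S. has_gradient f (\<lambda>i. partial i f x) x) \<and> (\<forall>i. Ck_on k S (partial i f))"
    using Ck_on_cong[OF assms, of "partial _ f" "D _"] by auto
qed (auto intro: Ck_on_Suc_intro)

lemma Ck_on_imp_continuous: "open S \<Longrightarrow> Ck_on k S f \<Longrightarrow> continuous_on S f"
  by (cases k) (auto simp: Ck_on_Suc_iff has_gradient_def
      dest: has_derivative_continuous intro: continuous_at_imp_continuous_on)

lemma Ck_on_Suc_imp: "open S \<Longrightarrow> Ck_on (Suc k) S f \<Longrightarrow> Ck_on k S f"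
proof (induction k arbitrary: f)
  case 0 then show ?case using Ck_on_imp_continuous by simp
next
  case (Suc k)
  then show ?case using Ck_on_Suc_iff[OF Suc.prems(1)] by blast
qed

lemma Ck_on_subset: "open S \<Longrightarrow> open T \<Longrightarrow> T \<subseteq> S \<Longrightarrow> Ck_on k S f \<Longrightarrow> Ck_on k T f"
proof (induction k arbitrary: f)
  case 0 then show ?case using continuous_on_subset by auto
next
  case (Suc k)
  then show ?case
    using Ck_on_Suc_iff[OF Suc.prems(1), of k f] Ck_on_Suc_iff[OF Suc.prems(2), of k f] by blast
qed

text \<open>The local derivatives glue because \<open>partial i f\<close> is one function, defined
  without reference to the neighbourhoods \<open>T\<close>.\<close>

lemma Ck_on_local:
  assumes "open S" "\<And>x. x \<in> S \<Longrightarrow> \<exists>T. open T \<and> x \<in> T \<and> T \<subseteq> S \<and> Ck_on k T f"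
  shows "Ck_on k S f"
  using assms(2)
proof (induction k arbitrary: f)
  case 0
  have "isCont f x" if "x \<in> S" for x
    using 0[OF that] by (auto simp: continuous_on_eq_continuous_at)
  then show ?case by (simp add: continuous_at_imp_continuous_on)
next
  case (Suc k)
  have *: "has_gradient f (\<lambda>i. partial i f x) x"
    "\<exists>T. open T \<and> x \<in> T \<and> T \<subseteq> S \<and> Ck_on k T (partial i f)" if xS: "x \<in> S" for x i
  proof -
    obtain T where T: "open T" "x \<in> T" "T \<subseteq> S" "Ck_on (Suc k) T f"
      using Suc.prems[OF xS] by blast
    then have "\<forall>x\<in>T. has_gradient f (\<lambda>i. partial i f x) x" "\<forall>i. Ck_on k T (partial i f)"
      using Ck_on_Suc_iff by blast+
    with T show "has_gradient f (\<lambda>i. partial i f x) x"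
      "\<exists>T. open T \<and> x \<in> T \<and> T \<subseteq> S \<and> Ck_on k T (partial i f)" by blast+
  qed
  have "Ck_on k S (partial i f)" for i
    by (rule Suc.IH, rule *(2))
  then show ?case by (intro Ck_on_Suc_intro[of S f "\<lambda>i. partial i f"] *(1))
qed

lemma Ck_on_const: "Ck_on k S (\<lambda>x. c)"
  by (induction k arbitrary: c) (auto intro: Ck_on_Suc_intro has_gradient_const)

lemma Ck_on_component: "Ck_on k S (\<lambda>x. x $ i)"
proof (cases k)
  case 0 then show ?thesis by (auto intro: continuous_intros)
next
  case (Suc k)
  show ?thesis unfolding Suc
    by (rule Ck_on_Suc_intro[OF has_gradient_component Ck_on_const])
qed

lemma Ck_on_add: "open S \<Longrightarrow> Ck_on k S f \<Longrightarrow> Ck_on k S g \<Longrightarrow> Ck_on k S (\<lambda>x. f x + g x)"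
proof (induction k arbitrary: f g)
  case 0 then show ?case by (auto intro: continuous_intros)
next
  case (Suc k)
  have "\<And>x. x \<in> S \<Longrightarrow> has_gradient f (\<lambda>i. partial i f x) x" "\<And>i. Ck_on k S (partial i f)"
    "\<And>x. x \<in> S \<Longrightarrow> has_gradient g (\<lambda>i. partial i g x) x" "\<And>i. Ck_on k S (partial i g)"
    using Suc.prems(2,3) Ck_on_Suc_iff[OF Suc.prems(1)] by blast+
  then show ?case
    by (intro Ck_on_Suc_intro[where D="\<lambda>i x. partial i f x + partial i g x"]
        has_gradient_add Suc.IH Suc.prems(1))
qed

lemma Ck_on_mult: "open S \<Longrightarrow> Ck_on k S f \<Longrightarrow> Ck_on k S g \<Longrightarrow> Ck_on k S (\<lambda>x. f x * g x)"
proof (induction k arbitrary: f g)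
  case 0 then show ?case by (auto intro: continuous_intros)
next
  case (Suc k)
  have "Ck_on k S f" "Ck_on k S g" using Suc.prems by (blast intro: Ck_on_Suc_imp)+
  moreover have "\<And>x. x \<in> S \<Longrightarrow> has_gradient f (\<lambda>i. partial i f x) x"
    "\<And>i. Ck_on k S (partial i f)"
    "\<And>x. x \<in> S \<Longrightarrow> has_gradient g (\<lambda>i. partial i g x) x" "\<And>i. Ck_on k S (partial i g)"
    using Suc.prems(2,3) Ck_on_Suc_iff[OF Suc.prems(1)] by blast+
  ultimately show ?case
    by (intro Ck_on_Suc_intro[where D="\<lambda>i x. f x * partial i g x + partial i f x * g x"]
        has_gradient_mult Ck_on_add Suc.IH Suc.prems(1))
qed

lemma Ck_on_sum:
  "open S \<Longrightarrow> (\<And>i. i \<in> I \<Longrightarrow> Ck_on k S (f i)) \<Longrightarrow> Ck_on k S (\<lambda>x. \<Sum>i\<in>I. f i x)"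
  by (induction I rule: infinite_finite_induct) (simp_all add: Ck_on_const Ck_on_add)

text \<open>The induction must vary \<open>f\<close>, since the chain rule calls for the claim at
  the partial derivatives of \<open>f\<close>; the inner map is kept and only its order
  drops.\<close>

lemma Ck_on_compose:
  fixes G :: "'k::{real_normed_field,euclidean_space} ^ 'd::finite \<Rightarrow> 'k ^ 'e::finite"
  assumes "open S" "open T" "\<And>x. x \<in> S \<Longrightarrow> G x \<in> T"
    and "\<And>j. Ck_on k S (\<lambda>x. G x $ j)" "Ck_on k T f"
  shows "Ck_on k S (\<lambda>x. f (G x))"
  using assms(4,5)
proof (induction k arbitrary: f)
  case 0
  have "continuous_on S G"
    using 0 continuous_on_vec_lambda[of S "\<lambda>i x. G x $ i"] by simp
  moreover have "continuous_on T f" using 0(2) by simp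
  ultimately have "continuous_on S (\<lambda>x. f (G x))"
    using assms(3) by (intro continuous_on_compose2[of T f S G]) auto
  then show ?case by simp
next
  case (Suc k)
  have G: "Ck_on k S (\<lambda>x. G x $ j)" for j
    by (rule Ck_on_Suc_imp[OF assms(1) Suc.prems(1)])
  have DG: "\<And>x j. x \<in> S \<Longrightarrow> has_gradient (\<lambda>x. G x $ j) (\<lambda>i. partial i (\<lambda>x. G x $ j) x) x"
    and CG: "\<And>i j. Ck_on k S (partial i (\<lambda>x. G x $ j))"
    using Suc.prems(1)[unfolded Ck_on_Suc_iff[OF assms(1)]] by blast+
  have Df: "\<And>x. x \<in> T \<Longrightarrow> has_gradient f (\<lambda>i. partial i f x) x"
    and Cf: "\<And>i. Ck_on k T (partial i f)"
    using Suc.prems(2)[unfolded Ck_on_Suc_iff[OF assms(2)]] by blast+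
  show ?case
  proof (rule Ck_on_Suc_intro)
    fix x assume "x \<in> S"
    then show "has_gradient (\<lambda>x. f (G x))
        (\<lambda>i. \<Sum>j\<in>UNIV. partial j f (G x) * partial i (\<lambda>x. G x $ j) x) x"
      by (intro has_gradient_compose[OF Df[OF assms(3)] DG])
  next
    show "Ck_on k S (\<lambda>x. \<Sum>j\<in>UNIV. partial j f (G x) * partial i (\<lambda>x. G x $ j) x)" for i
      by (intro Ck_on_sum Ck_on_mult Suc.IH[OF G Cf] CG assms(1))
  qed
qed

section \<open>Infinitely differentiable functions\<close>

lemma smooth_on_cong:
  assumes "open S" "\<And>x. x \<in> S \<Longrightarrow> f x = g x"
  shows "smooth_on S f \<longleftrightarrow> smooth_on S g"
  unfolding smooth_on_def using Ck_on_cong[OF assms] by simp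

lemma smooth_on_imp_continuous: "open S \<Longrightarrow> smooth_on S f \<Longrightarrow> continuous_on S f"
  unfolding smooth_on_def by (rule Ck_on_imp_continuous[of S 0]) simp_all

lemma smooth_on_subset:
  assumes "open S" "open T" "T \<subseteq> S" "smooth_on S f"
  shows "smooth_on T f"
  using Ck_on_subset[OF assms(1-3)] assms(4) by (simp add: smooth_on_def)

lemma smooth_on_local:
  assumes "open S" "\<And>x. x \<in> S \<Longrightarrow> \<exists>T. open T \<and> x \<in> T \<and> T \<subseteq> S \<and> smooth_on T f"
  shows "smooth_on S f"
  unfolding smooth_on_def
proof (intro allI Ck_on_local[OF assms(1)])
  show "\<exists>T. open T \<and> x \<in> T \<and> T \<subseteq> S \<and> Ck_on k T f" if "x \<in> S" for k x
    using assms(2)[OF that] unfolding smooth_on_def by blast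
qed

lemma smooth_on_const: "smooth_on S (\<lambda>x. c)"
  and smooth_on_component: "smooth_on S (\<lambda>x. x $ i)"
  unfolding smooth_on_def by (simp_all add: Ck_on_const Ck_on_component)

lemma smooth_on_add: "open S \<Longrightarrow> smooth_on S f \<Longrightarrow> smooth_on S g \<Longrightarrow> smooth_on S (\<lambda>x. f x + g x)"
  and smooth_on_mult: "open S \<Longrightarrow> smooth_on S f \<Longrightarrow> smooth_on S g \<Longrightarrow> smooth_on S (\<lambda>x. f x * g x)"
  unfolding smooth_on_def by (simp_all add: Ck_on_add Ck_on_mult)

lemma smooth_on_sum:
  "open S \<Longrightarrow> (\<And>i. i \<in> I \<Longrightarrow> smooth_on S (f i)) \<Longrightarrow> smooth_on S (\<lambda>x. \<Sum>i\<in>I. f i x)"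
  unfolding smooth_on_def by (simp add: Ck_on_sum)

lemma smooth_on_compose:
  fixes G :: "'k::{real_normed_field,euclidean_space} ^ 'd::finite \<Rightarrow> 'k ^ 'e::finite"
  assumes "open S" "open T" "\<And>x. x \<in> S \<Longrightarrow> G x \<in> T"
    and "\<And>j. smooth_on S (\<lambda>x. G x $ j)" "smooth_on T f"
  shows "smooth_on S (\<lambda>x. f (G x))"
  unfolding smooth_on_def
  by (rule allI, rule Ck_on_compose[OF assms(1-3)])
    (use assms(4,5) in \<open>simp_all add: smooth_on_def\<close>)

lemma smooth_on_partial: "open S \<Longrightarrow> smooth_on S f \<Longrightarrow> smooth_on S (partial i f)"
  unfolding smooth_on_def
proof
  fix k assume S: "open S" and f: "\<forall>k. Ck_on k S f"
  show "Ck_on k S (partial i f)"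
    using f[rule_format, of "Suc k"] unfolding Ck_on_Suc_iff[OF S] by simp
qed

lemma smooth_on_has_gradient:
  assumes "open S" "smooth_on S f" "x \<in> S"
  shows "has_gradient f (\<lambda>i. partial i f x) x"
proof -
  have "Ck_on (Suc 0) S f" using assms(2) unfolding smooth_on_def by blast
  then show ?thesis using assms(3) unfolding Ck_on_Suc_iff[OF assms(1)] by blast
qed

lemma smooth_on_imp_deriv_line:
  assumes "open S" "smooth_on S f" "x + t *s v \<in> S"
  shows "((\<lambda>t. f (x + t *s v)) has_field_derivative
    (\<Sum>i\<in>UNIV. partial i f (x + t *s v) * v $ i)) (at t)"
  by (rule has_gradient_imp_deriv_line[OF smooth_on_has_gradient[OF assms]])

subsection \<open>Smooth maps between manifolds\<close>

lemma smooth_on_transform: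
  assumes "smooth_on S f" "open S" "\<And>x. x \<in> S \<Longrightarrow> f x = g x"
  shows "smooth_on S g"
  using smooth_on_cong[of S f g, OF assms(2,3)] assms(1) by simp

text \<open>The homeomorphism condition on charts is split into injectivity, openness and
  continuity, all phrased with open sets of the whole space. In this form the conditions can be
  checked one by one for product charts.\<close>

definition smooth_atlas ::
  "'p topology \<Rightarrow> ('p, 'k::{real_normed_field,euclidean_space}, 'd::finite) atlas \<Rightarrow> bool"
where
  "smooth_atlas T A \<longleftrightarrow>
     (\<Union>(U, \<phi>)\<in>A. U) = topspace T \<and>
     (\<forall>(U, \<phi>)\<in>A. openin T U \<and> inj_on \<phi> U \<and> (\<forall>W. openin T W \<and> W \<subseteq> U \<longrightarrow> open (\<phi> ` W)) \<and>
        (\<forall>S. open S \<longrightarrow> openin T {p\<in>U. \<phi> p \<in> S})) \<and>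
     (\<forall>(U, \<phi>)\<in>A. \<forall>(V, \<psi>)\<in>A. \<forall>i.
        smooth_on (\<phi> ` (U \<inter> V)) (\<lambda>x. \<psi> (inv_into U \<phi> x) $ i))"

lemma manifold_imp_smooth_atlas:
  assumes "manifold T A" shows "smooth_atlas T A"
proof -
  have "openin T U \<and> inj_on \<phi> U \<and> (\<forall>W. openin T W \<and> W \<subseteq> U \<longrightarrow> open (\<phi> ` W)) \<and>
        (\<forall>S. open S \<longrightarrow> openin T {p\<in>U. \<phi> p \<in> S})" if c: "(U, \<phi>) \<in> A" for U \<phi>
  proof -
    have U: "openin T U" and Q0: "open (\<phi> ` U)"
      and h: "homeomorphic_map (subtopology T U) (top_of_set (\<phi> ` U)) \<phi>"
      using assms c by (auto simp: manifold_def)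
    have UT: "topspace (subtopology T U) = U"
      using openin_subset[OF U] by auto
    have "open (\<phi> ` W)" if "openin T W" "W \<subseteq> U" for W
    proof -
      have "openin (subtopology T U) W"
        using that by (auto simp: openin_subtopology)
      then have "openin (top_of_set (\<phi> ` U)) (\<phi> ` W)"
        using homeomorphic_imp_open_map[OF h] by (simp add: open_map_def)
      then show ?thesis using Q0 openin_open_trans by blast
    qed
    moreover have "openin T {p\<in>U. \<phi> p \<in> S}" if "open S" for S
    proof -
      have "continuous_map (subtopology T U) (top_of_set (\<phi> ` U)) \<phi>"
        using h homeomorphic_imp_continuous_map by blast
      then have "continuous_map (subtopology T U) euclidean \<phi>"
        using continuous_map_in_subtopology by blast
      then have "openin (subtopology T U) {x \<in> topspace (subtopology T U). \<phi> x \<in> S}"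
        using that by (auto simp: continuous_map_def)
      then show ?thesis using U UT openin_trans_full by fastforce
    qed
    moreover have "inj_on \<phi> U"
      using homeomorphic_imp_injective_map[OF h] UT by simp
    ultimately show ?thesis using U by blast
  qed
  then show ?thesis using assms unfolding manifold_def smooth_atlas_def by blast
qed

lemma smooth_atlas_chart:
  assumes "smooth_atlas T A" "(U, \<phi>) \<in> A"
  shows "openin T U" "inj_on \<phi> U" "U \<subseteq> topspace T"
    "\<And>W. openin T W \<Longrightarrow> W \<subseteq> U \<Longrightarrow> open (\<phi> ` W)"
    "\<And>W. openin T W \<Longrightarrow> open (\<phi> ` (U \<inter> W))"
    "\<And>S. open S \<Longrightarrow> openin T {p\<in>U. \<phi> p \<in> S}"
proof -
  show U: "openin T U" "inj_on \<phi> U" "\<And>W. openin T W \<Longrightarrow> W \<subseteq> U \<Longrightarrow> open (\<phi> ` W)"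
    "\<And>S. open S \<Longrightarrow> openin T {p\<in>U. \<phi> p \<in> S}"
    using assms by (auto simp: smooth_atlas_def)
  then show "U \<subseteq> topspace T" "\<And>W. openin T W \<Longrightarrow> open (\<phi> ` (U \<inter> W))"
    by (auto simp: openin_subset)
qed

lemma smooth_atlas_cover:
  assumes "smooth_atlas T A" "p \<in> topspace T"
  obtains U \<phi> where "(U, \<phi>) \<in> A" "p \<in> U"
proof -
  have "p \<in> (\<Union>(U, \<phi>)\<in>A. U)" using assms by (simp add: smooth_atlas_def)
  then show thesis using that by auto
qed

lemma smooth_atlas_transition:
  assumes "smooth_atlas T A" "(U, \<phi>) \<in> A" "(V, \<psi>) \<in> A"
  shows "smooth_on (\<phi> ` (U \<inter> V)) (\<lambda>x. \<psi> (inv_into U \<phi> x) $ i)"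
proof -
  have "\<forall>(U, \<phi>)\<in>A. \<forall>(V, \<psi>)\<in>A. \<forall>i.
      smooth_on (\<phi> ` (U \<inter> V)) (\<lambda>x. \<psi> (inv_into U \<phi> x) $ i)"
    using assms(1) by (simp add: smooth_atlas_def)
  from bspec[OF this assms(2)] show ?thesis using assms(3) by auto
qed

lemma smooth_atlas_euclidean:
  "smooth_atlas euclidean {(UNIV, \<lambda>X. X :: 'k::{real_normed_field,euclidean_space} ^ 'd::finite)}"
proof -
  have "inv_into UNIV (\<lambda>X::'k^'d. X) x = x" for x by (simp add: inv_f_eq)
  then show ?thesis by (auto simp: smooth_atlas_def smooth_on_component)
qed

text \<open>Smoothness is local even within one chart domain, so maps whose values leave a target
  chart can be treated on smaller neighbourhoods.\<close>

lemma smooth_functionI: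
  assumes "smooth_atlas T A" "openin T W"
    and "\<And>U \<phi> p. (U, \<phi>) \<in> A \<Longrightarrow> p \<in> U \<Longrightarrow> p \<in> W \<Longrightarrow>
      \<exists>N. openin T N \<and> p \<in> N \<and> N \<subseteq> U \<inter> W \<and> smooth_on (\<phi> ` N) (\<lambda>x. f (inv_into U \<phi> x))"
  shows "smooth_function A W f"
proof -
  have "smooth_on (\<phi> ` (U \<inter> W)) (\<lambda>x. f (inv_into U \<phi> x))" if c: "(U, \<phi>) \<in> A" for U \<phi>
  proof (rule smooth_on_local)
    show "open (\<phi> ` (U \<inter> W))" using smooth_atlas_chart(5)[OF assms(1) c assms(2)] .
    fix x assume "x \<in> \<phi> ` (U \<inter> W)"
    then obtain p where p: "p \<in> U" "p \<in> W" "x = \<phi> p" by auto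
    obtain N where "openin T N" "p \<in> N" "N \<subseteq> U \<inter> W" "smooth_on (\<phi> ` N) (\<lambda>x. f (inv_into U \<phi> x))"
      using assms(3)[OF c p(1,2)] by blast
    then show "\<exists>T. open T \<and> x \<in> T \<and> T \<subseteq> \<phi> ` (U \<inter> W) \<and> smooth_on T (\<lambda>x. f (inv_into U \<phi> x))"
      using p smooth_atlas_chart(4)[OF assms(1) c, of N] by (intro exI[of _ "\<phi> ` N"]) auto
  qed
  then show ?thesis by (auto simp: smooth_function_def)
qed

lemma smooth_functionD:
  "smooth_function A W f \<Longrightarrow> (U, \<phi>) \<in> A \<Longrightarrow> smooth_on (\<phi> ` (U \<inter> W)) (\<lambda>x. f (inv_into U \<phi> x))"
  by (auto simp: smooth_function_def)

lemma smooth_function_cong: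
  assumes "smooth_atlas T A" "openin T W" "\<And>p. p \<in> W \<Longrightarrow> f p = h p"
  shows "smooth_function A W f \<longleftrightarrow> smooth_function A W h"
proof -
  have "smooth_on (\<phi> ` (U \<inter> W)) (\<lambda>x. f (inv_into U \<phi> x)) \<longleftrightarrow>
    smooth_on (\<phi> ` (U \<inter> W)) (\<lambda>x. h (inv_into U \<phi> x))" if c: "(U, \<phi>) \<in> A" for U \<phi>
  proof (rule smooth_on_cong)
    show "open (\<phi> ` (U \<inter> W))" using smooth_atlas_chart(5)[OF assms(1) c assms(2)] .
    show "f (inv_into U \<phi> x) = h (inv_into U \<phi> x)" if "x \<in> \<phi> ` (U \<inter> W)" for x
      using that smooth_atlas_chart(2)[OF assms(1) c] assms(3) by (auto simp: inv_into_f_f)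
  qed
  then show ?thesis unfolding smooth_function_def by blast
qed

lemma smooth_function_subset:
  assumes "smooth_atlas T A" "openin T W" "openin T W'" "W' \<subseteq> W" "smooth_function A W f"
  shows "smooth_function A W' f"
proof -
  have "smooth_on (\<phi> ` (U \<inter> W')) (\<lambda>x. f (inv_into U \<phi> x))" if c: "(U, \<phi>) \<in> A" for U \<phi>
    by (rule smooth_on_subset[of "\<phi> ` (U \<inter> W)"])
      (use smooth_atlas_chart(5)[OF assms(1) c] assms(2-4) smooth_functionD[OF assms(5) c] in auto)
  then show ?thesis by (auto simp: smooth_function_def)
qed

lemma smooth_function_const: "smooth_function A W (\<lambda>p. c)"
  by (auto simp: smooth_function_def smooth_on_const)

lemma smooth_function_add:
  assumes "smooth_atlas T A" "openin T W" "smooth_function A W f" "smooth_function A W h"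
  shows "smooth_function A W (\<lambda>p. f p + h p)"
  using assms(3,4) smooth_atlas_chart(5)[OF assms(1) _ assms(2)]
  by (auto simp: smooth_function_def intro!: smooth_on_add)

lemma smooth_function_mult:
  assumes "smooth_atlas T A" "openin T W" "smooth_function A W f" "smooth_function A W h"
  shows "smooth_function A W (\<lambda>p. f p * h p)"
  using assms(3,4) smooth_atlas_chart(5)[OF assms(1) _ assms(2)]
  by (auto simp: smooth_function_def intro!: smooth_on_mult)

lemma smooth_function_sum:
  assumes "smooth_atlas T A" "openin T W" "\<And>i. i \<in> I \<Longrightarrow> smooth_function A W (f i)"
  shows "smooth_function A W (\<lambda>p. \<Sum>i\<in>I. f i p)"
  using assms(3)
  by (induction I rule: infinite_finite_induct)
    (simp_all add: smooth_function_const smooth_function_add[OF assms(1,2)])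

lemma smooth_function_chart:
  "smooth_atlas T A \<Longrightarrow> (V, \<psi>) \<in> A \<Longrightarrow> smooth_function A V (\<lambda>p. \<psi> p $ i)"
  unfolding smooth_function_def using smooth_atlas_transition by blast

lemma smooth_map_iff:
  fixes A :: "('p, 'k::{real_normed_field,euclidean_space}, 'd::finite) atlas"
    and B :: "('q, 'k, 'e::finite) atlas"
  assumes "smooth_atlas T A"
  shows "smooth_map T A S B F \<longleftrightarrow> continuous_map T S F \<and>
    (\<forall>(V, \<psi>)\<in>B. \<forall>i. smooth_function A {p\<in>topspace T. F p \<in> V} (\<lambda>p. \<psi> (F p) $ i))"
proof -
  define L where "L u v i \<longleftrightarrow> smooth_on (snd u ` {p\<in>fst u. F p \<in> fst v})
      (\<lambda>x. snd v (F (inv_into (fst u) (snd u) x)) $ i)"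
    for u :: "'p set \<times> ('p \<Rightarrow> 'k ^ 'd)" and v :: "'q set \<times> ('q \<Rightarrow> 'k ^ 'e)" and i
  have "smooth_on (snd u ` (fst u \<inter> {p\<in>topspace T. F p \<in> fst v}))
      (\<lambda>x. snd v (F (inv_into (fst u) (snd u) x)) $ i) \<longleftrightarrow> L u v i" if "u \<in> A" for u v i
  proof -
    have "fst u \<subseteq> topspace T"
      using smooth_atlas_chart(3)[OF assms, of "fst u" "snd u"] that by simp
    then have "fst u \<inter> {p\<in>topspace T. F p \<in> fst v} = {p\<in>fst u. F p \<in> fst v}" by auto
    then show ?thesis by (simp add: L_def)
  qed
  then show ?thesis
    unfolding smooth_map_def smooth_function_def case_prod_beta L_def[symmetric] by blast
qed

lemma smooth_map_continuous: "smooth_map T A S B F \<Longrightarrow> continuous_map T S F"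
  by (simp add: smooth_map_def)

lemma openin_smooth_map_preimage:
  "smooth_map T A S B F \<Longrightarrow> openin S W \<Longrightarrow> openin T {p\<in>topspace T. F p \<in> W}"
  by (simp add: smooth_map_def continuous_map_def)

text \<open>All compositions of maps between manifolds are reduced here to
  \<open>smooth_on_compose\<close>: \<open>G\<close> is a coordinate expression of \<open>F\<close>,
  and the inverse charts cancel on \<open>N\<close>.\<close>

lemma smooth_on_chart_compose:
  fixes A :: "('p, 'k::{real_normed_field,euclidean_space}, 'd::finite) atlas"
    and B :: "('q, 'k, 'e::finite) atlas"
  assumes A: "smooth_atlas T A" "(U, \<phi>) \<in> A" and N: "openin T N" "N \<subseteq> U"
    and B: "smooth_atlas S B" "(V, \<psi>) \<in> B" and W: "openin S W" "W \<subseteq> V"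
    and f: "smooth_on (\<psi> ` W) (\<lambda>y. f (inv_into V \<psi> y))"
    and G: "\<And>j. smooth_on (\<phi> ` N) (\<lambda>x. G x $ j)"
    and F: "\<And>p. p \<in> N \<Longrightarrow> F p \<in> W" "\<And>p. p \<in> N \<Longrightarrow> G (\<phi> p) = \<psi> (F p)"
  shows "smooth_on (\<phi> ` N) (\<lambda>x. f (F (inv_into U \<phi> x)))"
proof -
  have o: "open (\<phi> ` N)" "open (\<psi> ` W)"
    using smooth_atlas_chart(4) A N B W by blast+
  have "smooth_on (\<phi> ` N) (\<lambda>x. f (inv_into V \<psi> (G x)))"
    by (rule smooth_on_compose[OF o _ G f]) (use F in auto)
  moreover have "f (inv_into V \<psi> (G x)) = f (F (inv_into U \<phi> x))" if x: "x \<in> \<phi> ` N" for x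
  proof -
    obtain p where p: "p \<in> N" "x = \<phi> p" using x by auto
    then have "inv_into U \<phi> x = p" using N smooth_atlas_chart(2)[OF A] by auto
    moreover have "inv_into V \<psi> (\<psi> (F p)) = F p"
      using F(1)[OF p(1)] W smooth_atlas_chart(2)[OF B] by auto
    ultimately show ?thesis using F(2)[OF p(1)] p by simp
  qed
  ultimately show ?thesis by (rule smooth_on_transform[OF _ o(1)])
qed

lemma smooth_function_compose:
  fixes A :: "('p, 'k::{real_normed_field,euclidean_space}, 'd::finite) atlas"
    and B :: "('q, 'k, 'e::finite) atlas"
  assumes A: "smooth_atlas T A" and B: "smooth_atlas S B" and F: "smooth_map T A S B F"
    and W: "openin S W" and f: "smooth_function B W f"
    and W': "openin T W'" "\<And>p. p \<in> W' \<Longrightarrow> F p \<in> W"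
  shows "smooth_function A W' (\<lambda>p. f (F p))"
proof (rule smooth_functionI[OF A W'(1)])
  fix U \<phi> p assume c: "(U, \<phi>) \<in> A" and p: "p \<in> U" "p \<in> W'"
  then have "F p \<in> topspace S" using W' openin_subset[OF W] by auto
  then obtain V \<psi> where V: "(V, \<psi>) \<in> B" "F p \<in> V" by (rule smooth_atlas_cover[OF B])
  define N where "N = U \<inter> W' \<inter> {p\<in>topspace T. F p \<in> V}"
  have VO: "openin S V" using smooth_atlas_chart(1)[OF B V(1)] .
  have N: "openin T N"
    unfolding N_def
    by (intro openin_Int W'(1) openin_smooth_map_preimage[OF F VO] smooth_atlas_chart(1)[OF A c])
  have "smooth_on (\<phi> ` N) (\<lambda>x. f (F (inv_into U \<phi> x)))"
  proof (rule smooth_on_chart_compose[OF A c N _ B V(1), where W="V \<inter> W"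
        and G="\<lambda>x. \<psi> (F (inv_into U \<phi> x))"])
    show "openin S (V \<inter> W)" using VO W by blast
    show "smooth_on (\<psi> ` (V \<inter> W)) (\<lambda>y. f (inv_into V \<psi> y))" using smooth_functionD[OF f V(1)] .
    have "smooth_function A {p\<in>topspace T. F p \<in> V} (\<lambda>p. \<psi> (F p) $ j)" for j
      using F V(1) unfolding smooth_map_iff[OF A] by blast
    from smooth_functionD[OF this c]
    show "smooth_on (\<phi> ` N) (\<lambda>x. \<psi> (F (inv_into U \<phi> x)) $ j)" for j
      by (rule smooth_on_subset[rotated 3])
        (use N openin_smooth_map_preimage[OF F VO] smooth_atlas_chart(4,5)[OF A c] in
          \<open>auto simp: N_def\<close>)
  qed (use p W'(2) smooth_atlas_chart(2)[OF A c] in \<open>auto simp: N_def\<close>)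
  moreover have "p \<in> N" using p V(2) openin_subset[OF W'(1)] by (auto simp: N_def)
  ultimately show "\<exists>N. openin T N \<and> p \<in> N \<and> N \<subseteq> U \<inter> W' \<and>
      smooth_on (\<phi> ` N) (\<lambda>x. f (F (inv_into U \<phi> x)))"
    using N by (intro exI[of _ N]) (auto simp: N_def)
qed

lemma smooth_map_compose:
  fixes A :: "('p, 'k::{real_normed_field,euclidean_space}, 'd::finite) atlas"
    and B :: "('q, 'k, 'e::finite) atlas" and C :: "('s, 'k, 'c::finite) atlas"
  assumes A: "smooth_atlas T A" and B: "smooth_atlas S B" and C: "smooth_atlas Z C"
    and F: "smooth_map T A S B F" and H: "smooth_map S B Z C H"
  shows "smooth_map T A Z C (\<lambda>p. H (F p))"
  unfolding smooth_map_iff[OF A]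
proof (intro conjI ballI)
  have c: "continuous_map T S F" "continuous_map S Z H"
    using F H by (auto simp: smooth_map_def)
  show HF: "continuous_map T Z (\<lambda>p. H (F p))"
    using continuous_map_compose[OF c] by (simp add: comp_def)
  fix V\<psi> assume "V\<psi> \<in> C"
  moreover obtain V \<psi> where V\<psi>: "V\<psi> = (V, \<psi>)" by fastforce
  ultimately have V: "(V, \<psi>) \<in> C" by simp
  have VO: "openin Z V" using smooth_atlas_chart(1)[OF C V] .
  have s: "smooth_function B {p\<in>topspace S. H p \<in> V} (\<lambda>p. \<psi> (H p) $ i)" for i
    using H V unfolding smooth_map_iff[OF B] by blast
  have "smooth_function A {p\<in>topspace T. H (F p) \<in> V} (\<lambda>p. \<psi> (H (F p)) $ i)" for i
  proof (rule smooth_function_compose[OF A B F _ s])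
    show "openin S {p\<in>topspace S. H p \<in> V}" using c VO by (simp add: continuous_map_def)
    show "openin T {p\<in>topspace T. H (F p) \<in> V}" using HF VO by (simp add: continuous_map_def)
    show "F p \<in> {p\<in>topspace S. H p \<in> V}" if "p \<in> {p\<in>topspace T. H (F p) \<in> V}" for p
      using that c(1) by (auto simp: continuous_map_def)
  qed
  then show "case V\<psi> of (V, \<psi>) \<Rightarrow>
      \<forall>i. smooth_function A {p\<in>topspace T. H (F p) \<in> V} (\<lambda>p. \<psi> (H (F p)) $ i)"
    by (simp add: V\<psi>)
qed

lemma smooth_map_ident: assumes "smooth_atlas T A" shows "smooth_map T A T A (\<lambda>p. p)"
  unfolding smooth_map_iff[OF assms]
  using smooth_function_chart[OF assms] smooth_atlas_chart(3)[OF assms]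
  by (auto simp: Int_absorb1 Collect_conj_eq)

lemma smooth_map_const:
  assumes "smooth_atlas T A" "c \<in> topspace S" shows "smooth_map T A S B (\<lambda>p. c)"
  unfolding smooth_map_iff[OF assms(1)] using assms(2) by (auto simp: smooth_function_const)

subsection \<open>Products\<close>

definition prod_chart ::
  "('p \<Rightarrow> 'k ^ 'd::finite) \<Rightarrow> ('q \<Rightarrow> 'k ^ 'e::finite) \<Rightarrow> 'p \<times> 'q \<Rightarrow> 'k ^ ('d + 'e)"
where
  "prod_chart \<phi> \<psi> = (\<lambda>(p, q). \<chi> i. case i of Inl a \<Rightarrow> \<phi> p $ a | Inr b \<Rightarrow> \<psi> q $ b)"

lemma prod_chart_nth [simp]:
  "prod_chart \<phi> \<psi> z $ Inl a = \<phi> (fst z) $ a" "prod_chart \<phi> \<psi> z $ Inr b = \<psi> (snd z) $ b"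
  by (simp_all add: prod_chart_def case_prod_beta)

lemma prod_chart_eq_iff:
  "prod_chart \<phi> \<psi> z = prod_chart \<phi> \<psi> w \<longleftrightarrow> \<phi> (fst z) = \<phi> (fst w) \<and> \<psi> (snd z) = \<psi> (snd w)"
proof -
  have "prod_chart \<phi> \<psi> z = prod_chart \<phi> \<psi> w \<longleftrightarrow>
    (\<forall>i. prod_chart \<phi> \<psi> z $ i = prod_chart \<phi> \<psi> w $ i)" by (rule vec_eq_iff)
  then show ?thesis by (simp add: vec_eq_iff split_sum_all)
qed

lemma prod_atlas_eq:
  "prod_atlas A B = {(U \<times> V, prod_chart \<phi> \<psi>) | U \<phi> V \<psi>. (U, \<phi>) \<in> A \<and> (V, \<psi>) \<in> B}"
  by (simp add: prod_atlas_def prod_chart_def)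

lemma prod_atlasE:
  assumes "(W, \<kappa>) \<in> prod_atlas A B"
  obtains U \<phi> V \<psi> where "W = U \<times> V" "\<kappa> = prod_chart \<phi> \<psi>" "(U, \<phi>) \<in> A" "(V, \<psi>) \<in> B"
  using assms by (auto simp: prod_atlas_eq)

lemma prod_atlasI: "(U, \<phi>) \<in> A \<Longrightarrow> (V, \<psi>) \<in> B \<Longrightarrow> (U \<times> V, prod_chart \<phi> \<psi>) \<in> prod_atlas A B"
  by (auto simp: prod_atlas_eq)

lemma open_vec_comp_preimage:
  fixes S :: "('k::topological_space ^ 'd::finite) set"
  assumes "open S" shows "open {x :: 'k ^ 'e::finite. (\<chi> a. x $ h a) \<in> S}"
proof -
  have "continuous_on UNIV (\<lambda>x :: 'k ^ 'e. \<chi> a. x $ h a)" by (intro continuous_intros)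
  from open_vimage[OF assms this] show ?thesis by (simp add: vimage_def)
qed

lemma open_vec_box:
  fixes Z :: "'d::finite \<Rightarrow> 'k::topological_space set"
  assumes "\<And>i. open (Z i)" shows "open {y :: 'k ^ 'd. \<forall>i. y $ i \<in> Z i}"
  unfolding open_vec_def using assms by (auto intro!: exI[of _ Z])

lemma inj_on_prod_chart:
  "inj_on \<phi> U \<Longrightarrow> inj_on \<psi> V \<Longrightarrow> inj_on (prod_chart \<phi> \<psi>) (U \<times> V)"
  by (auto simp: inj_on_def prod_chart_eq_iff)

lemma smooth_on_reindex: "smooth_on S (\<lambda>x. (\<chi> a. x $ h a) $ j)"
  by (simp add: smooth_on_component)

text \<open>In a product chart each projection becomes the selection of a block of coordinates,
  which is smooth, so the claim is a composition in coordinate space.\<close>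

lemma smooth_on_prod_chart_compose:
  fixes A :: "('p, 'k::{real_normed_field,euclidean_space}, 'd::finite) atlas"
    and B :: "('q, 'k, 'e::finite) atlas"
  assumes A: "smooth_atlas T A" "(U, \<phi>) \<in> A" and B: "smooth_atlas S B" "(V, \<psi>) \<in> B"
    and o: "open (prod_chart \<phi> \<psi> ` (N \<times> M))" and N: "openin T N" "N \<subseteq> U"
    and M: "openin S M" "M \<subseteq> V"
  shows "smooth_on (\<phi> ` N) (\<lambda>x. f (inv_into U \<phi> x)) \<Longrightarrow>
      smooth_on (prod_chart \<phi> \<psi> ` (N \<times> M)) (\<lambda>x. f (fst (inv_into (U \<times> V) (prod_chart \<phi> \<psi>) x)))"
    and "smooth_on (\<psi> ` M) (\<lambda>x. g (inv_into V \<psi> x)) \<Longrightarrow>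
      smooth_on (prod_chart \<phi> \<psi> ` (N \<times> M)) (\<lambda>x. g (snd (inv_into (U \<times> V) (prod_chart \<phi> \<psi>) x)))"
proof -
  have inj: "inj_on \<phi> U" "inj_on \<psi> V"
    using smooth_atlas_chart(2) A B by blast+
  have pc: "inj_on (prod_chart \<phi> \<psi>) (U \<times> V)" by (rule inj_on_prod_chart[OF inj])
  have oN: "open (\<phi> ` N)" "open (\<psi> ` M)"
    using smooth_atlas_chart(4) A B N M by blast+
  {
    assume f: "smooth_on (\<phi> ` N) (\<lambda>x. f (inv_into U \<phi> x))"
    have "smooth_on (prod_chart \<phi> \<psi> ` (N \<times> M)) (\<lambda>x. f (inv_into U \<phi> (\<chi> a. x $ Inl a)))"
      by (rule smooth_on_compose[OF o oN(1) _ smooth_on_reindex f]) auto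
    moreover have "f (inv_into U \<phi> (\<chi> a. x $ Inl a)) =
        f (fst (inv_into (U \<times> V) (prod_chart \<phi> \<psi>) x))" if "x \<in> prod_chart \<phi> \<psi> ` (N \<times> M)" for x
    proof -
      obtain p q where x: "x = prod_chart \<phi> \<psi> (p, q)" "p \<in> N" "q \<in> M"
        using \<open>x \<in> prod_chart \<phi> \<psi> ` (N \<times> M)\<close> by auto
      then have "inv_into (U \<times> V) (prod_chart \<phi> \<psi>) x = (p, q)"
        using N M pc by (auto intro!: inv_into_f_f)
      moreover have "inv_into U \<phi> (\<chi> a. x $ Inl a) = p"
        using x N inj by (auto intro!: inv_into_f_f)
      ultimately show ?thesis by simp
    qed
    ultimately show "smooth_on (prod_chart \<phi> \<psi> ` (N \<times> M))
        (\<lambda>x. f (fst (inv_into (U \<times> V) (prod_chart \<phi> \<psi>) x)))"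
      by (rule smooth_on_transform[OF _ o])
  next
    assume g: "smooth_on (\<psi> ` M) (\<lambda>x. g (inv_into V \<psi> x))"
    have "smooth_on (prod_chart \<phi> \<psi> ` (N \<times> M)) (\<lambda>x. g (inv_into V \<psi> (\<chi> a. x $ Inr a)))"
      by (rule smooth_on_compose[OF o oN(2) _ smooth_on_reindex g]) auto
    moreover have "g (inv_into V \<psi> (\<chi> a. x $ Inr a)) =
        g (snd (inv_into (U \<times> V) (prod_chart \<phi> \<psi>) x))" if "x \<in> prod_chart \<phi> \<psi> ` (N \<times> M)" for x
    proof -
      obtain p q where x: "x = prod_chart \<phi> \<psi> (p, q)" "p \<in> N" "q \<in> M"
        using \<open>x \<in> prod_chart \<phi> \<psi> ` (N \<times> M)\<close> by auto
      then have "inv_into (U \<times> V) (prod_chart \<phi> \<psi>) x = (p, q)"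
        using N M pc by (auto intro!: inv_into_f_f)
      moreover have "inv_into V \<psi> (\<chi> a. x $ Inr a) = q"
        using x M inj by (auto intro!: inv_into_f_f)
      ultimately show ?thesis by simp
    qed
    ultimately show "smooth_on (prod_chart \<phi> \<psi> ` (N \<times> M))
        (\<lambda>x. g (snd (inv_into (U \<times> V) (prod_chart \<phi> \<psi>) x)))"
      by (rule smooth_on_transform[OF _ o])
  }
qed

lemma smooth_atlas_prod:
  fixes A :: "('p, 'k::{real_normed_field,euclidean_space}, 'd::finite) atlas"
    and B :: "('q, 'k, 'e::finite) atlas"
  assumes A: "smooth_atlas T A" and B: "smooth_atlas S B"
  shows "smooth_atlas (prod_topology T S) (prod_atlas A B)"
proof -
  have open_image: "open (prod_chart \<phi> \<psi> ` W)"
    if W: "openin (prod_topology T S) W" "W \<subseteq> U \<times> V" and c: "(U, \<phi>) \<in> A" "(V, \<psi>) \<in> B"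
    for W U V \<phi> \<psi>
  proof (subst open_subopen, rule ballI)
    fix x assume "x \<in> prod_chart \<phi> \<psi> ` W"
    then obtain p q where pq: "(p, q) \<in> W" "x = prod_chart \<phi> \<psi> (p, q)" by auto
    then obtain P Q where PQ: "openin T P" "openin S Q" "p \<in> P" "q \<in> Q" "P \<times> Q \<subseteq> W"
      using W(1)[unfolded openin_prod_topology_alt, rule_format, OF pq(1)] by blast
    have PU: "P \<subseteq> U" "Q \<subseteq> V" using PQ W(2) by blast+
    \<comment> \<open>The vectors whose two coordinate blocks lie in the chart images of the box
      \<open>P \<times> Q\<close>. This set is open, and it consists of chart values because a
      vector is determined by its blocks.\<close>
    define Y where "Y = {x :: 'k ^ ('d + 'e). (\<chi> a. x $ Inl a) \<in> \<phi> ` P} \<inter>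
      {x. (\<chi> a. x $ Inr a) \<in> \<psi> ` Q}"
    have "open Y" unfolding Y_def
      by (intro open_Int open_vec_comp_preimage smooth_atlas_chart(4)[OF A c(1) PQ(1) PU(1)]
          smooth_atlas_chart(4)[OF B c(2) PQ(2) PU(2)])
    moreover have "x \<in> Y" using pq PQ by (auto simp: Y_def)
    moreover have "Y \<subseteq> prod_chart \<phi> \<psi> ` W"
    proof
      fix y assume "y \<in> Y"
      then obtain p' q' where "p' \<in> P" "(\<chi> a. y $ Inl a) = \<phi> p'" "q' \<in> Q" "(\<chi> a. y $ Inr a) = \<psi> q'"
        by (auto simp: Y_def)
      moreover from this have "y = prod_chart \<phi> \<psi> (p', q')"
        by (auto simp: vec_eq_iff split_sum_all)
      ultimately show "y \<in> prod_chart \<phi> \<psi> ` W" using PQ(5) by blast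
    qed
    ultimately show "\<exists>T. open T \<and> x \<in> T \<and> T \<subseteq> prod_chart \<phi> \<psi> ` W" by blast
  qed
  have preimage: "openin (prod_topology T S) {z \<in> U \<times> V. prod_chart \<phi> \<psi> z \<in> Q0}"
    if Q0: "open Q0" and c: "(U, \<phi>) \<in> A" "(V, \<psi>) \<in> B" for Q0 U V \<phi> \<psi>
    unfolding openin_prod_topology_alt
  proof (intro allI impI)
    fix p q assume "(p, q) \<in> {z \<in> U \<times> V. prod_chart \<phi> \<psi> z \<in> Q0}"
    then have pq: "p \<in> U" "q \<in> V" "prod_chart \<phi> \<psi> (p, q) \<in> Q0" by auto
    obtain Z where Z: "\<And>i. open (Z i)" "\<And>i. prod_chart \<phi> \<psi> (p, q) $ i \<in> Z i"
      "\<And>y. (\<forall>i. y $ i \<in> Z i) \<Longrightarrow> y \<in> Q0"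
      using Q0[unfolded open_vec_def, rule_format, OF pq(3)] by blast
    have o: "open {y :: 'k ^ 'd. \<forall>a. y $ a \<in> Z (Inl a)}" "open {y :: 'k ^ 'e. \<forall>a. y $ a \<in> Z (Inr a)}"
      using open_vec_box[of "\<lambda>a. Z (Inl a)"] open_vec_box[of "\<lambda>a. Z (Inr a)"] Z(1) by auto
    show "\<exists>P Q. openin T P \<and> openin S Q \<and> p \<in> P \<and> q \<in> Q \<and> P \<times> Q \<subseteq> {z \<in> U \<times> V. prod_chart \<phi> \<psi> z \<in> Q0}"
    proof (intro exI conjI)
      show "openin T {p\<in>U. \<phi> p \<in> {y. \<forall>a. y $ a \<in> Z (Inl a)}}"
        "openin S {q\<in>V. \<psi> q \<in> {y. \<forall>a. y $ a \<in> Z (Inr a)}}"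
        by (rule smooth_atlas_chart(6)[OF A c(1) o(1)], rule smooth_atlas_chart(6)[OF B c(2) o(2)])
      show "p \<in> {p\<in>U. \<phi> p \<in> {y. \<forall>a. y $ a \<in> Z (Inl a)}}"
        using pq(1) Z(2)[of "Inl _"] by simp
      show "q \<in> {q\<in>V. \<psi> q \<in> {y. \<forall>a. y $ a \<in> Z (Inr a)}}"
        using pq(2) Z(2)[of "Inr _"] by simp
      show "{p\<in>U. \<phi> p \<in> {y. \<forall>a. y $ a \<in> Z (Inl a)}} \<times> {q\<in>V. \<psi> q \<in> {y. \<forall>a. y $ a \<in> Z (Inr a)}}
          \<subseteq> {z \<in> U \<times> V. prod_chart \<phi> \<psi> z \<in> Q0}"
      proof clarsimp
        fix a b assume "\<forall>i. \<phi> a $ i \<in> Z (Inl i)" "\<forall>i. \<psi> b $ i \<in> Z (Inr i)"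
        then show "prod_chart \<phi> \<psi> (a, b) \<in> Q0"
          by (intro Z(3)) (simp add: split_sum_all)
      qed
    qed
  qed
  have chart: "openin (prod_topology T S) W \<and> inj_on \<kappa> W \<and>
      (\<forall>N. openin (prod_topology T S) N \<and> N \<subseteq> W \<longrightarrow> open (\<kappa> ` N)) \<and>
      (\<forall>Q0. open Q0 \<longrightarrow> openin (prod_topology T S) {p\<in>W. \<kappa> p \<in> Q0})"
    if "(W, \<kappa>) \<in> prod_atlas A B" for W \<kappa>
  proof -
    obtain U \<phi> V \<psi> where c: "W = U \<times> V" "\<kappa> = prod_chart \<phi> \<psi>" "(U, \<phi>) \<in> A" "(V, \<psi>) \<in> B"
      using \<open>(W, \<kappa>) \<in> prod_atlas A B\<close> by (rule prod_atlasE)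
    have "openin (prod_topology T S) (U \<times> V)"
      using smooth_atlas_chart(1)[OF A c(3)] smooth_atlas_chart(1)[OF B c(4)]
      by (simp add: openin_prod_Times_iff)
    moreover have "inj_on (prod_chart \<phi> \<psi>) (U \<times> V)"
      by (intro inj_on_prod_chart smooth_atlas_chart(2)[OF A c(3)] smooth_atlas_chart(2)[OF B c(4)])
    moreover have "\<forall>N. openin (prod_topology T S) N \<and> N \<subseteq> U \<times> V \<longrightarrow> open (prod_chart \<phi> \<psi> ` N)"
      using open_image[OF _ _ c(3,4)] by simp
    moreover have "\<forall>Q0. open Q0 \<longrightarrow> openin (prod_topology T S) {p\<in>U \<times> V. prod_chart \<phi> \<psi> p \<in> Q0}"
      using preimage[OF _ c(3,4)] by simp
    ultimately show ?thesis unfolding c(1,2) by (intro conjI)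
  qed
  have transition: "smooth_on (\<kappa> ` (W \<inter> W')) (\<lambda>x. \<kappa>' (inv_into W \<kappa> x) $ i)"
    if WW: "(W, \<kappa>) \<in> prod_atlas A B" "(W', \<kappa>') \<in> prod_atlas A B" for W \<kappa> W' \<kappa>' i
  proof -
    obtain U \<phi> V \<psi> where c: "W = U \<times> V" "\<kappa> = prod_chart \<phi> \<psi>" "(U, \<phi>) \<in> A" "(V, \<psi>) \<in> B"
      using WW(1) by (rule prod_atlasE)
    obtain U' \<phi>' V' \<psi>' where c': "W' = U' \<times> V'" "\<kappa>' = prod_chart \<phi>' \<psi>'" "(U', \<phi>') \<in> A" "(V', \<psi>') \<in> B"
      using WW(2) by (rule prod_atlasE)
    have W: "W \<inter> W' = (U \<inter> U') \<times> (V \<inter> V')" by (auto simp: c c')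
    have o: "openin T (U \<inter> U')" "openin S (V \<inter> V')"
      using smooth_atlas_chart(1)[OF A] smooth_atlas_chart(1)[OF B] c c' by blast+
    then have "openin (prod_topology T S) ((U \<inter> U') \<times> (V \<inter> V'))"
      by (simp add: openin_prod_Times_iff)
    from open_image[OF this _ c(3,4)] have o': "open (prod_chart \<phi> \<psi> ` ((U \<inter> U') \<times> (V \<inter> V')))"
      by blast
    show ?thesis
    proof (cases i)
      case (Inl a)
      then show ?thesis unfolding W unfolding c c' 
        using smooth_on_prod_chart_compose(1)[OF A c(3) B c(4) o' o(1) _ o(2) _
            smooth_atlas_transition[OF A c(3) c'(3)], of a] by simp
    next
      case (Inr b)
      then show ?thesis unfolding W unfolding c c'
        using smooth_on_prod_chart_compose(2)[OF A c(3) B c(4) o' o(1) _ o(2) _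
            smooth_atlas_transition[OF B c(4) c'(4)], of b] by simp
    qed
  qed
  have "(\<Union>(U, \<phi>)\<in>prod_atlas A B. U) = (\<Union>(U, \<phi>)\<in>A. U) \<times> (\<Union>(U, \<phi>)\<in>B. U)"
  proof (intro equalityI subsetI)
    fix z assume "z \<in> (\<Union>(U, \<phi>)\<in>prod_atlas A B. U)"
    then obtain W \<kappa> where W: "(W, \<kappa>) \<in> prod_atlas A B" "z \<in> W" by auto
    from W(1) show "z \<in> (\<Union>(U, \<phi>)\<in>A. U) \<times> (\<Union>(U, \<phi>)\<in>B. U)"
      by (rule prod_atlasE) (use W(2) in auto)
  next
    fix z assume "z \<in> (\<Union>(U, \<phi>)\<in>A. U) \<times> (\<Union>(U, \<phi>)\<in>B. U)"
    then obtain U \<phi> V \<psi> where "(U, \<phi>) \<in> A" "fst z \<in> U" "(V, \<psi>) \<in> B" "snd z \<in> V" by auto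
    then show "z \<in> (\<Union>(U, \<phi>)\<in>prod_atlas A B. U)"
      by (intro UN_I[OF prod_atlasI]) (auto simp: mem_Times_iff)
  qed
  also have "\<dots> = topspace (prod_topology T S)"
    using A B by (simp add: smooth_atlas_def)
  finally have cover: "(\<Union>(U, \<phi>)\<in>prod_atlas A B. U) = topspace (prod_topology T S)" .
  show ?thesis
    unfolding smooth_atlas_def
  proof (intro conjI cover ballI; clarify)
    fix W \<kappa> assume *: "(W, \<kappa>) \<in> prod_atlas A B"
    show "openin (prod_topology T S) W \<and> inj_on \<kappa> W \<and>
      (\<forall>N. openin (prod_topology T S) N \<and> N \<subseteq> W \<longrightarrow> open (\<kappa> ` N)) \<and>
      (\<forall>Q0. open Q0 \<longrightarrow> openin (prod_topology T S) {p\<in>W. \<kappa> p \<in> Q0})" by (rule chart[OF *])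
  next
    fix W \<kappa> W' \<kappa>' i assume *: "(W, \<kappa>) \<in> prod_atlas A B" "(W', \<kappa>') \<in> prod_atlas A B"
    show "smooth_on (\<kappa> ` (W \<inter> W')) (\<lambda>x. \<kappa>' (inv_into W \<kappa> x) $ i)" by (rule transition[OF *])
  qed
qed

lemma smooth_map_fst:
  fixes A :: "('p, 'k::{real_normed_field,euclidean_space}, 'd::finite) atlas"
    and B :: "('q, 'k, 'e::finite) atlas"
  assumes A: "smooth_atlas T A" and B: "smooth_atlas S B"
  shows "smooth_map (prod_topology T S) (prod_atlas A B) T A fst"
proof -
  have "smooth_on (\<kappa> ` {p\<in>W. fst p \<in> N}) (\<lambda>x. \<nu> (fst (inv_into W \<kappa> x)) $ i)"
    if W: "(W, \<kappa>) \<in> prod_atlas A B" and N: "(N, \<nu>) \<in> A" for W \<kappa> N \<nu> i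
  proof -
    obtain U \<phi> V \<psi> where c: "W = U \<times> V" "\<kappa> = prod_chart \<phi> \<psi>" "(U, \<phi>) \<in> A" "(V, \<psi>) \<in> B"
      using W by (rule prod_atlasE)
    have o: "openin T (U \<inter> N)" "openin S V"
      using smooth_atlas_chart(1)[OF A] smooth_atlas_chart(1)[OF B] c N by blast+
    then have "openin (prod_topology T S) ((U \<inter> N) \<times> V)"
      by (simp add: openin_prod_Times_iff)
    then have o': "open (prod_chart \<phi> \<psi> ` ((U \<inter> N) \<times> V))"
      by (rule smooth_atlas_chart(4)[OF smooth_atlas_prod[OF A B] W[unfolded c]]) auto
    have "{p\<in>W. fst p \<in> N} = (U \<inter> N) \<times> V" by (auto simp: c)
    then show ?thesis
      using smooth_on_prod_chart_compose(1)[OF A c(3) B c(4) o' o(1) _ o(2) _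
            smooth_atlas_transition[OF A c(3) N], of i] by (simp add: c)
  qed
  then show ?thesis unfolding smooth_map_def using continuous_map_fst by blast
qed

lemma smooth_map_snd:
  fixes A :: "('p, 'k::{real_normed_field,euclidean_space}, 'd::finite) atlas"
    and B :: "('q, 'k, 'e::finite) atlas"
  assumes A: "smooth_atlas T A" and B: "smooth_atlas S B"
  shows "smooth_map (prod_topology T S) (prod_atlas A B) S B snd"
proof -
  have "smooth_on (\<kappa> ` {p\<in>W. snd p \<in> N}) (\<lambda>x. \<nu> (snd (inv_into W \<kappa> x)) $ i)"
    if W: "(W, \<kappa>) \<in> prod_atlas A B" and N: "(N, \<nu>) \<in> B" for W \<kappa> N \<nu> i
  proof -
    obtain U \<phi> V \<psi> where c: "W = U \<times> V" "\<kappa> = prod_chart \<phi> \<psi>" "(U, \<phi>) \<in> A" "(V, \<psi>) \<in> B"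
      using W by (rule prod_atlasE)
    have o: "openin T U" "openin S (V \<inter> N)"
      using smooth_atlas_chart(1)[OF A] smooth_atlas_chart(1)[OF B] c N by blast+
    then have "openin (prod_topology T S) (U \<times> (V \<inter> N))"
      by (simp add: openin_prod_Times_iff)
    then have o': "open (prod_chart \<phi> \<psi> ` (U \<times> (V \<inter> N)))"
      by (rule smooth_atlas_chart(4)[OF smooth_atlas_prod[OF A B] W[unfolded c]]) auto
    have "{p\<in>W. snd p \<in> N} = U \<times> (V \<inter> N)" by (auto simp: c)
    then show ?thesis
      using smooth_on_prod_chart_compose(2)[OF A c(3) B c(4) o' o(1) _ o(2) _
            smooth_atlas_transition[OF B c(4) N], of i] by (simp add: c)
  qed
  then show ?thesis unfolding smooth_map_def using continuous_map_snd by blast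
qed

lemma smooth_map_Pair:
  fixes A :: "('p, 'k::{real_normed_field,euclidean_space}, 'd::finite) atlas"
    and B :: "('q, 'k, 'e::finite) atlas" and C :: "('s, 'k, 'c::finite) atlas"
  assumes A: "smooth_atlas T A" and B: "smooth_atlas S B" and C: "smooth_atlas Z C"
    and F: "smooth_map T A S B F" and H: "smooth_map T A Z C H"
  shows "smooth_map T A (prod_topology S Z) (prod_atlas B C) (\<lambda>p. (F p, H p))"
proof -
  have "smooth_on (\<phi> ` {p\<in>U. (F p, H p) \<in> W}) (\<lambda>x. \<kappa> (F (inv_into U \<phi> x), H (inv_into U \<phi> x)) $ i)"
    if U: "(U, \<phi>) \<in> A" and W: "(W, \<kappa>) \<in> prod_atlas B C" for U \<phi> W \<kappa> i
  proof -
    obtain V \<psi> V' \<psi>' where c: "W = V \<times> V'" "\<kappa> = prod_chart \<psi> \<psi>'" "(V, \<psi>) \<in> B" "(V', \<psi>') \<in> C"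
      using W by (rule prod_atlasE)
    have eq: "{p\<in>U. F p \<in> V} = U \<inter> {p\<in>topspace T. F p \<in> V}"
        "{p\<in>U. H p \<in> V'} = U \<inter> {p\<in>topspace T. H p \<in> V'}"
        "{p\<in>U. (F p, H p) \<in> W} = U \<inter> ({p\<in>topspace T. F p \<in> V} \<inter> {p\<in>topspace T. H p \<in> V'})"
      using smooth_atlas_chart(3)[OF A U] by (auto simp: c)
    have o: "openin T {p\<in>topspace T. F p \<in> V}" "openin T {p\<in>topspace T. H p \<in> V'}"
      using openin_smooth_map_preimage[OF F smooth_atlas_chart(1)[OF B c(3)]]
       openin_smooth_map_preimage[OF H smooth_atlas_chart(1)[OF C c(4)]] by blast+
    have o': "open (\<phi> ` {p\<in>U. F p \<in> V})" "open (\<phi> ` {p\<in>U. H p \<in> V'})"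
      "open (\<phi> ` {p\<in>U. (F p, H p) \<in> W})"
      unfolding eq by (intro smooth_atlas_chart(5)[OF A U] o openin_Int)+
    have s: "smooth_on (\<phi> ` {p\<in>U. F p \<in> V}) (\<lambda>x. \<psi> (F (inv_into U \<phi> x)) $ a)"
      "smooth_on (\<phi> ` {p\<in>U. H p \<in> V'}) (\<lambda>x. \<psi>' (H (inv_into U \<phi> x)) $ b)" for a b
      using F H U c(3,4) unfolding smooth_map_def by blast+
    show ?thesis
    proof (cases i)
      case (Inl a)
      show ?thesis
        using smooth_on_subset[OF o'(1,3) _ s(1)[of a]] by (force simp: c Inl)
    next
      case (Inr b)
      show ?thesis
        using smooth_on_subset[OF o'(2,3) _ s(2)[of b]] by (force simp: c Inr)
    qed
  qed
  moreover have "continuous_map T (prod_topology S Z) (\<lambda>p. (F p, H p))"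
    using F H by (simp add: smooth_map_def continuous_map_pairedI)
  ultimately show ?thesis unfolding smooth_map_def by blast
qed

subsection \<open>Symmetry of second derivatives\<close>

text \<open>The mean value inequality is applied twice, in \<open>t\<close> to
  \<open>Fs s' t - t * c\<close> and then in \<open>s\<close> to the first difference in
  \<open>t\<close>. Working with inequalities makes the argument valid over the complex numbers
  too.\<close>

lemma mixed_difference_bound:
  fixes F :: "'k::real_normed_field \<Rightarrow> 'k \<Rightarrow> 'k"
  assumes Fs: "\<And>s t. norm s < d \<Longrightarrow> norm t < d \<Longrightarrow> ((\<lambda>s. F s t) has_field_derivative Fs s t) (at s)"
    and Fst: "\<And>s t. norm s < d \<Longrightarrow> norm t < d \<Longrightarrow> ((\<lambda>t. Fs s t) has_field_derivative Fst s t) (at t)"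
    and e: "\<And>s t. norm s < d \<Longrightarrow> norm t < d \<Longrightarrow> norm (Fst s t - c) \<le> e"
    and st: "norm s < d" "norm t < d"
  shows "norm (F s t - F s 0 - F 0 t + F 0 0 - s * t * c) \<le> e * norm s * norm t"
proof -
  have d: "0 < d" using st(1) norm_ge_zero[of s] by linarith
  have inner: "norm (Fs s' t - Fs s' 0 - t * c) \<le> e * norm t" if "norm s' < d" for s'
  proof -
    have "norm ((Fs s' t - t * c) - (Fs s' 0 - 0 * c)) \<le> e * norm (t - 0)"
    proof (rule field_differentiable_bound[of "ball 0 d" _ "\<lambda>z. Fst s' z - c"])
      fix z assume "z \<in> ball (0::'k) d"
      then have z: "norm z < d" by simp
      have "((\<lambda>t. t * c) has_field_derivative c) (at z)" by (auto intro!: derivative_eq_intros)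
      from DERIV_diff[OF Fst[OF that z] this]
      show "((\<lambda>t. Fs s' t - t * c) has_field_derivative Fst s' z - c) (at z within ball 0 d)"
        by (rule has_field_derivative_at_within)
      show "norm (Fst s' z - c) \<le> e" by (rule e[OF that z])
    qed (use st(2) d in simp_all)
    then show ?thesis by (simp add: algebra_simps)
  qed
  have "norm ((F s t - F s 0 - s * (t * c)) - (F 0 t - F 0 0 - 0 * (t * c))) \<le> e * norm t * norm (s - 0)"
  proof (rule field_differentiable_bound[of "ball 0 d" _ "\<lambda>z. Fs z t - Fs z 0 - t * c"])
    fix z assume "z \<in> ball (0::'k) d"
    then have z: "norm z < d" by simp
    have d0: "norm (0::'k) < d" using d by simp
    have "((\<lambda>s. s * (t * c)) has_field_derivative t * c) (at z)"
      by (auto intro!: derivative_eq_intros)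
    from DERIV_diff[OF DERIV_diff[OF Fs[OF z st(2)] Fs[OF z d0]] this]
    show "((\<lambda>s. F s t - F s 0 - s * (t * c)) has_field_derivative (Fs z t - Fs z 0 - t * c))
        (at z within ball 0 d)"
      by (rule has_field_derivative_at_within)
    show "norm (Fs z t - Fs z 0 - t * c) \<le> e * norm t" by (rule inner[OF z])
  qed (use st(1) d in simp_all)
  then show ?thesis by (simp add: algebra_simps)
qed

text \<open>The second difference of \<open>F\<close> at \<open>s = t\<close> is symmetric in the
  two variables, so it is close to \<open>s * s\<close> times either mixed derivative.\<close>

lemma mixed_derivatives_eq:
  fixes F :: "'k::real_normed_field \<Rightarrow> 'k \<Rightarrow> 'k"
  assumes d: "0 < d"
    and Fs: "\<And>s t. norm s < d \<Longrightarrow> norm t < d \<Longrightarrow> ((\<lambda>s. F s t) has_field_derivative Fs s t) (at s)"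
    and Ft: "\<And>s t. norm s < d \<Longrightarrow> norm t < d \<Longrightarrow> ((\<lambda>t. F s t) has_field_derivative Ft s t) (at t)"
    and Fst: "\<And>s t. norm s < d \<Longrightarrow> norm t < d \<Longrightarrow> ((\<lambda>t. Fs s t) has_field_derivative Fst s t) (at t)"
    and Fts: "\<And>s t. norm s < d \<Longrightarrow> norm t < d \<Longrightarrow> ((\<lambda>s. Ft s t) has_field_derivative Fts s t) (at s)"
    and c1: "\<And>e. 0 < e \<Longrightarrow> \<exists>d>0. \<forall>s t. norm s < d \<longrightarrow> norm t < d \<longrightarrow> norm (Fst s t - Fst 0 0) \<le> e"
    and c2: "\<And>e. 0 < e \<Longrightarrow> \<exists>d>0. \<forall>s t. norm s < d \<longrightarrow> norm t < d \<longrightarrow> norm (Fts s t - Fts 0 0) \<le> e"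
  shows "Fst 0 0 = Fts 0 0"
proof (rule ccontr)
  assume ne: "Fst 0 0 \<noteq> Fts 0 0"
  \<comment> \<open>The two estimates together bound the distance of the mixed derivatives by
    \<open>2 * e\<close>, which is only half of it.\<close>
  define e where "e = norm (Fst 0 0 - Fts 0 0) / 4"
  have e: "e > 0" using ne by (simp add: e_def)
  obtain d1 where d1: "d1 > 0" "\<And>s t. norm s < d1 \<Longrightarrow> norm t < d1 \<Longrightarrow> norm (Fst s t - Fst 0 0) \<le> e"
    using c1[OF e] by blast
  obtain d2 where d2: "d2 > 0" "\<And>s t. norm s < d2 \<Longrightarrow> norm t < d2 \<Longrightarrow> norm (Fts s t - Fts 0 0) \<le> e"
    using c2[OF e] by blast
  define d' where "d' = min d (min d1 d2)"
  \<comment> \<open>A nonzero element of the ground field that lies in all three balls.\<close>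
  define s :: 'k where "s = of_real (d' / 2)"
  have s: "norm s < d'" "norm s > 0" using d d1(1) d2(1) by (auto simp: s_def d'_def)
  define D where "D = F s s - F s 0 - F 0 s + F 0 0"
  have 1: "norm (D - s * s * Fst 0 0) \<le> e * norm s * norm s"
    unfolding D_def
    by (rule mixed_difference_bound[of d' F Fs Fst]) (use Fs Fst d1 s in \<open>auto simp: d'_def\<close>)
  have "norm (F s s - F 0 s - F s 0 + F 0 0 - s * s * Fts 0 0) \<le> e * norm s * norm s"
    by (rule mixed_difference_bound[of d' "\<lambda>s t. F t s" "\<lambda>s t. Ft t s" "\<lambda>s t. Fts t s"])
      (use Ft Fts d2 s in \<open>auto simp: d'_def\<close>)
  then have 2: "norm (D - s * s * Fts 0 0) \<le> e * norm s * norm s"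
    by (simp add: D_def algebra_simps)
  have "norm (s * s) * norm (Fst 0 0 - Fts 0 0) = norm ((D - s * s * Fts 0 0) - (D - s * s * Fst 0 0))"
    by (simp add: norm_mult[symmetric] algebra_simps)
  also have "\<dots> \<le> norm (D - s * s * Fts 0 0) + norm (D - s * s * Fst 0 0)" by (rule norm_triangle_ineq4)
  also have "\<dots> \<le> norm (s * s) * (2 * e)" using 1 2 by (simp add: norm_mult algebra_simps)
  finally have "norm (Fst 0 0 - Fts 0 0) \<le> 2 * e" using s(2) by (simp add: norm_mult)
  then show False using e by (simp add: e_def)
qed

lemma smooth_on_line_deriv:
  assumes "open S" "smooth_on S f"
  shows "smooth_on S (\<lambda>x. \<Sum>i\<in>UNIV. partial i f x * v $ i)"
  by (intro smooth_on_sum smooth_on_mult smooth_on_partial smooth_on_const assms)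

text \<open>On the plane through \<open>x\<close> spanned by \<open>v\<close> and \<open>w\<close>,
  the iterated directional derivatives are again smooth, hence continuous at the origin of the
  plane, as \<open>mixed_derivatives_eq\<close> requires.\<close>

lemma deriv_deriv_commute:
  fixes f :: "'k::{real_normed_field,euclidean_space} ^ 'd::finite \<Rightarrow> 'k"
  assumes S: "open S" "smooth_on S f" "x \<in> S"
  shows "deriv (\<lambda>s. deriv (\<lambda>t. f (x + s *s v + t *s w)) 0) 0 =
    deriv (\<lambda>t. deriv (\<lambda>s. f (x + s *s v + t *s w)) 0) 0"
proof -
  define D where "D u h x = (\<Sum>i\<in>UNIV. partial i h x * u $ i)" for u :: "'k^'d" and h x
  have sD: "smooth_on S (D u h)" if "smooth_on S h" for u h
    unfolding D_def by (rule smooth_on_line_deriv[OF S(1) that])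
  define Y where "Y s t = x + s *s v + t *s w" for s t
  have line1: "((\<lambda>s. h (Y s t)) has_field_derivative D v h (Y s t)) (at s)"
    if "smooth_on S h" "Y s t \<in> S" for h s t
    using smooth_on_imp_deriv_line[OF S(1) that(1), of "x + t *s w" s v] that(2)
    by (simp add: Y_def D_def add_ac)
  have line2: "((\<lambda>t. h (Y s t)) has_field_derivative D w h (Y s t)) (at t)"
    if "smooth_on S h" "Y s t \<in> S" for h s t
    using smooth_on_imp_deriv_line[OF S(1) that(1), of "x + s *s v" t w] that(2)
    by (simp add: Y_def D_def add_ac)
  have "continuous_on UNIV (\<lambda>p :: 'k \<times> 'k. \<chi> i. x $ i + fst p * v $ i + snd p * w $ i)"
    by (intro continuous_intros)
  also have "(\<lambda>p :: 'k \<times> 'k. \<chi> i. x $ i + fst p * v $ i + snd p * w $ i) = (\<lambda>p. Y (fst p) (snd p))"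
    by (simp add: fun_eq_iff vec_eq_iff Y_def)
  finally have cY: "isCont (\<lambda>p. Y (fst p) (snd p)) (0, 0)"
    by (simp add: continuous_on_eq_continuous_at)
  have Y0: "Y 0 0 = x" by (simp add: Y_def)
  have near: "\<exists>d>0. \<forall>s t. norm s < d \<longrightarrow> norm t < d \<longrightarrow> P (Y s t)"
    if P: "eventually P (nhds x)" for P
  proof -
    have "filterlim (\<lambda>p. Y (fst p) (snd p)) (nhds x) (nhds (0, 0))"
      using cY Y0 tendsto_at_iff_tendsto_nhds[of "\<lambda>p. Y (fst p) (snd p)" "(0, 0)"]
      by (simp add: isCont_def)
    then have "eventually (\<lambda>p. P (Y (fst p) (snd p))) (nhds (0, 0))"
      by (rule eventually_compose_filterlim[OF P])
    then obtain d where d: "d > 0" "\<And>p. dist p (0, 0) < d \<Longrightarrow> P (Y (fst p) (snd p))"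
      unfolding eventually_nhds_metric by blast
    have "P (Y s t)" if "norm s < d / 2" "norm t < d / 2" for s t
      using d(2)[of "(s, t)"] norm_Pair_le[of s t] that by (simp add: dist_norm)
    with d(1) show ?thesis by (intro exI[of _ "d / 2"]) auto
  qed
  have "eventually (\<lambda>y. y \<in> S) (nhds x)" using S by (auto simp: eventually_nhds)
  from near[OF this] obtain d where d: "d > 0" "\<And>s t. norm s < d \<Longrightarrow> norm t < d \<Longrightarrow> Y s t \<in> S"
    by blast
  have cont: "\<exists>d>0. \<forall>s t. norm s < d \<longrightarrow> norm t < d \<longrightarrow> norm (h (Y s t) - h (Y 0 0)) \<le> e"
    if h: "smooth_on S h" and e: "0 < e" for h e
  proof -
    have "isCont h x"
      using smooth_on_imp_continuous[OF S(1) h] S(1,3) by (simp add: continuous_on_eq_continuous_at)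
    then have lim: "filterlim h (nhds (h x)) (nhds x)"
      by (simp add: isCont_def tendsto_at_iff_tendsto_nhds[of h x])
    have "eventually (\<lambda>y. norm (y - h x) \<le> e) (nhds (h x))"
      unfolding eventually_nhds_metric using e by (auto simp: dist_norm intro!: exI[of _ e])
    from near[OF eventually_compose_filterlim[OF this lim]] show ?thesis by (simp add: Y0)
  qed
  have d0: "norm (0::'k) < d" using d(1) by simp
  have l1: "deriv (\<lambda>s. h (Y s t)) s = D v h (Y s t)"
    and l2: "deriv (\<lambda>t. h (Y s t)) t = D w h (Y s t)"
    if "smooth_on S h" "norm s < d" "norm t < d" for h s t
    using line1[OF that(1) d(2)[OF that(2,3)]] line2[OF that(1) d(2)[OF that(2,3)]]
    by (simp_all add: DERIV_imp_deriv)
  have ev: "eventually (\<lambda>s::'k. norm s < d) (nhds 0)"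
    using d(1) unfolding eventually_nhds_metric by (auto simp: dist_norm)
  have sv: "smooth_on S (D v f)" and sw: "smooth_on S (D w f)" by (rule sD[OF S(2)])+
  have "deriv (\<lambda>s. deriv (\<lambda>t. f (Y s t)) 0) 0 = deriv (\<lambda>s. D w f (Y s 0)) 0"
    by (rule deriv_cong_ev[OF eventually_mono[OF ev] refl]) (rule l2[OF S(2) _ d0])
  also have "\<dots> = D v (D w f) (Y 0 0)" by (rule l1[OF sw d0 d0])
  also have "\<dots> = D w (D v f) (Y 0 0)"
    by (rule mixed_derivatives_eq[OF d(1), symmetric, where F="\<lambda>s t. f (Y s t)"
        and Fs="\<lambda>s t. D v f (Y s t)" and Ft="\<lambda>s t. D w f (Y s t)"
        and Fst="\<lambda>s t. D w (D v f) (Y s t)" and Fts="\<lambda>s t. D v (D w f) (Y s t)",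
        OF line1[OF S(2) d(2)] line2[OF S(2) d(2)] line2[OF sv d(2)] line1[OF sw d(2)]
          cont[OF sD[OF sv]] cont[OF sD[OF sw]]])
  also have "\<dots> = deriv (\<lambda>t. D v f (Y 0 t)) 0" by (rule l2[OF sv d0 d0, symmetric])
  also have "\<dots> = deriv (\<lambda>t. deriv (\<lambda>s. f (Y s t)) 0) 0"
    by (rule deriv_cong_ev[OF eventually_mono[OF ev] refl]) (rule l1[OF S(2) d0, symmetric])
  finally show ?thesis by (simp add: Y_def)
qed

lemma sum_UNIV_Plus:
  "(\<Sum>i\<in>(UNIV :: ('a::finite + 'b::finite) set). h i) = (\<Sum>a\<in>UNIV. h (Inl a)) + (\<Sum>b\<in>UNIV. h (Inr b))"
  by (subst UNIV_Plus_UNIV[symmetric], subst sum.Plus) simp_all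

text \<open>
  Derivatives along one-parameter families are taken as derivatives in the parameter \<open>Y\<close> of
  \<open>f (\<Phi> (Y, p))\<close> at \<open>Y = 0\<close>: linearity in the direction and smoothness in \<open>p\<close> then come
  from the smoothness of \<open>\<Phi>\<close> in both arguments.
\<close>

locale parametrised_map =
  fixes T :: "'p topology" and A :: "('p, 'k::{real_normed_field,euclidean_space}, 'd::finite) atlas"
    and S :: "'q topology" and B :: "('q, 'k, 'e::finite) atlas"
    and \<Phi> :: "('k ^ 'n::finite) \<times> 'p \<Rightarrow> 'q"
  assumes atlas: "smooth_atlas T A" "smooth_atlas S B"
    and smooth: "smooth_map (prod_topology euclidean T) (prod_atlas {(UNIV, \<lambda>X. X)} A) S B \<Phi>"
begin

definition dirderiv :: "'k ^ 'n \<Rightarrow> ('q \<Rightarrow> 'k) \<Rightarrow> 'p \<Rightarrow> 'k" where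
  "dirderiv X f p = deriv (\<lambda>t. f (\<Phi> (t *s X, p))) 0"

text \<open>\<open>K\<close> is \<open>f (\<Phi> (Y, p))\<close> read in the product chart of
  parameter and point. The curve in \<open>t\<close> becomes an affine line in the parameter block,
  and the derivative along it is a combination of partial derivatives of the single smooth function
  \<open>K\<close>.\<close>

lemma line_derivative:
  assumes W: "openin S W" and f: "smooth_function B W f" and c: "(U, \<phi>) \<in> A"
  shows "\<exists>K Q. open Q \<and> smooth_on Q K \<and>
    (\<forall>y p. p \<in> U \<longrightarrow> \<Phi> (y, p) \<in> W \<longrightarrow> prod_chart (\<lambda>X. X) \<phi> (y, p) \<in> Q) \<and>
    (\<forall>X t p. p \<in> U \<longrightarrow> \<Phi> (t *s X, p) \<in> W \<longrightarrow>
      ((\<lambda>t. f (\<Phi> (t *s X, p))) has_field_derivative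
        (\<Sum>a\<in>UNIV. partial (Inl a) K (prod_chart (\<lambda>X. X) \<phi> (t *s X, p)) * X $ a)) (at t))"
proof -
  let ?E = "{(UNIV, \<lambda>X. X)} :: ('k ^ 'n, 'k, 'n) atlas"
  let ?\<kappa> = "prod_chart (\<lambda>X :: 'k ^ 'n. X) \<phi>"
  define V where "V = {z \<in> topspace (prod_topology euclidean T). \<Phi> z \<in> W}"
  define Q where "Q = ?\<kappa> ` ((UNIV \<times> U) \<inter> V)"
  define K where "K = (\<lambda>x. f (\<Phi> (inv_into (UNIV \<times> U) ?\<kappa> x)))"
  have at: "smooth_atlas (prod_topology euclidean T) (prod_atlas ?E A)"
    by (intro smooth_atlas_prod smooth_atlas_euclidean atlas)
  have c': "(UNIV \<times> U, ?\<kappa>) \<in> prod_atlas ?E A" by (rule prod_atlasI) (use c in auto)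
  have V: "openin (prod_topology euclidean T) V"
    unfolding V_def by (rule openin_smooth_map_preimage[OF smooth W])
  have "smooth_function (prod_atlas ?E A) V (\<lambda>z. f (\<Phi> z))"
    by (rule smooth_function_compose[OF at atlas(2) smooth W f V]) (simp add: V_def)
  then have sK: "smooth_on Q K"
    unfolding Q_def K_def by (rule smooth_functionD[OF _ c'])
  have oQ: "open Q" unfolding Q_def by (rule smooth_atlas_chart(5)[OF at c' V])
  have inj: "inj_on ?\<kappa> (UNIV \<times> U)" by (rule smooth_atlas_chart(2)[OF at c'])
  have UT: "U \<subseteq> topspace T" by (rule smooth_atlas_chart(3)[OF atlas(1) c])
  have inQ: "?\<kappa> (y, p) \<in> Q" if "p \<in> U" "\<Phi> (y, p) \<in> W" for y p
    using that UT by (auto simp: Q_def V_def)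
  have "((\<lambda>t. f (\<Phi> (t *s X, p))) has_field_derivative
        (\<Sum>a\<in>UNIV. partial (Inl a) K (?\<kappa> (t *s X, p)) * X $ a)) (at t)"
    if p: "p \<in> U" "\<Phi> (t *s X, p) \<in> W" for X t p
  proof -
    \<comment> \<open>The direction \<open>X\<close> in the parameter block, with no component along
      the manifold.\<close>
    define v :: "'k ^ ('n + 'd)" where "v = (\<chi> i. case i of Inl a \<Rightarrow> X $ a | Inr b \<Rightarrow> 0)"
    have v: "?\<kappa> (t *s X, p) = ?\<kappa> (0, p) + t *s v" for t
      by (simp add: vec_eq_iff split_sum_all v_def)
    have K: "K (?\<kappa> (t *s X, p)) = f (\<Phi> (t *s X, p))" for t
      using p(1) inj by (simp add: K_def)
    have "((\<lambda>t. K (?\<kappa> (0, p) + t *s v)) has_field_derivative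
        (\<Sum>i\<in>UNIV. partial i K (?\<kappa> (0, p) + t *s v) * v $ i)) (at t)"
      by (rule smooth_on_imp_deriv_line[OF oQ sK]) (simp only: v[symmetric] inQ[OF p])
    then have "((\<lambda>t. f (\<Phi> (t *s X, p))) has_field_derivative
        (\<Sum>i\<in>UNIV. partial i K (?\<kappa> (t *s X, p)) * v $ i)) (at t)"
      by (simp only: v[symmetric] K)
    moreover have "(\<Sum>i\<in>UNIV. partial i K x * v $ i) = (\<Sum>a\<in>UNIV. partial (Inl a) K x * X $ a)" for x
      by (simp add: sum_UNIV_Plus v_def)
    ultimately show ?thesis by simp
  qed
  with oQ sK inQ show ?thesis by (intro exI conjI allI impI)
qed

lemma eventually_param:
  assumes W: "openin S W" and p: "p \<in> topspace T" "\<Phi> (0, p) \<in> W"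
  shows "eventually (\<lambda>t. \<Phi> (t *s X, p) \<in> W) (nhds 0)"
proof -
  have 1: "continuous_map euclidean (prod_topology euclidean T) (\<lambda>t :: 'k. (t *s X, p))"
  proof (intro continuous_map_pairedI)
    have "continuous_on UNIV (\<lambda>t :: 'k. \<chi> i. t * X $ i)" by (intro continuous_intros)
    then show "continuous_map euclidean euclidean (\<lambda>t :: 'k. t *s X)"
      by (simp add: vector_scalar_mult_def)
    show "continuous_map euclidean T (\<lambda>t :: 'k. p)" using p(1) by simp
  qed
  have 2: "continuous_map euclidean S (\<lambda>t :: 'k. \<Phi> (t *s X, p))"
    using continuous_map_compose[OF 1 smooth_map_continuous[OF smooth]] by (simp add: comp_def)
  have "open {t :: 'k. \<Phi> (t *s X, p) \<in> W}"
    using 2 W by (simp add: continuous_map_def)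
  then show ?thesis using p(2) by (auto simp: eventually_nhds)
qed

lemma has_dirderiv:
  assumes W: "openin S W" and f: "smooth_function B W f"
    and p: "p \<in> topspace T" "\<Phi> (0, p) \<in> W"
  shows "((\<lambda>t. f (\<Phi> (t *s X, p))) has_field_derivative dirderiv X f p) (at 0)"
proof -
  obtain U \<phi> where U: "(U, \<phi>) \<in> A" "p \<in> U" using smooth_atlas_cover[OF atlas(1) p(1)] .
  obtain K where K: "\<forall>X t p. p \<in> U \<longrightarrow> \<Phi> (t *s X, p) \<in> W \<longrightarrow>
      ((\<lambda>t. f (\<Phi> (t *s X, p))) has_field_derivative
        (\<Sum>a\<in>UNIV. partial (Inl a) K (prod_chart (\<lambda>X. X) \<phi> (t *s X, p)) * X $ a)) (at t)"
    using line_derivative[OF W f U(1)] by blast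
  from K[rule_format, OF U(2), of 0 X] show ?thesis using p(2) unfolding dirderiv_def
    by (simp add: DERIV_imp_deriv)
qed

lemma dirderiv_linear:
  assumes W: "openin S W" and f: "smooth_function B W f"
    and p: "p \<in> topspace T" "\<Phi> (0, p) \<in> W"
  shows "dirderiv X f p = (\<Sum>a\<in>UNIV. X $ a * dirderiv (axis a 1) f p)"
proof -
  obtain U \<phi> where U: "(U, \<phi>) \<in> A" "p \<in> U" using smooth_atlas_cover[OF atlas(1) p(1)] .
  obtain K where K: "\<forall>X t p. p \<in> U \<longrightarrow> \<Phi> (t *s X, p) \<in> W \<longrightarrow>
      ((\<lambda>t. f (\<Phi> (t *s X, p))) has_field_derivative
        (\<Sum>a\<in>UNIV. partial (Inl a) K (prod_chart (\<lambda>X. X) \<phi> (t *s X, p)) * X $ a)) (at t)"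
    using line_derivative[OF W f U(1)] by blast
  from K[rule_format, OF U(2), of 0] have *: "dirderiv X f p =
      (\<Sum>a\<in>UNIV. partial (Inl a) K (prod_chart (\<lambda>X. X) \<phi> (0, p)) * X $ a)" for X
    using p(2) unfolding dirderiv_def by (simp add: DERIV_imp_deriv)
  show ?thesis unfolding * sum_axis by (simp add: mult.commute)
qed

lemma smooth_dirderiv:
  assumes W: "openin S W" and f: "smooth_function B W f"
    and W': "openin T W'" "\<And>p. p \<in> W' \<Longrightarrow> \<Phi> (0, p) \<in> W"
  shows "smooth_function A W' (dirderiv X f)"
  unfolding smooth_function_def
proof (intro ballI, clarify)
  fix U \<phi> assume U: "(U, \<phi>) \<in> A"
  obtain K Q where Q: "open Q" "smooth_on Q K"
    "\<forall>y p. p \<in> U \<longrightarrow> \<Phi> (y, p) \<in> W \<longrightarrow> prod_chart (\<lambda>X. X) \<phi> (y, p) \<in> Q"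
    and *: "\<forall>X t p. p \<in> U \<longrightarrow> \<Phi> (t *s X, p) \<in> W \<longrightarrow>
      ((\<lambda>t. f (\<Phi> (t *s X, p))) has_field_derivative
        (\<Sum>a\<in>UNIV. partial (Inl a) K (prod_chart (\<lambda>X. X) \<phi> (t *s X, p)) * X $ a)) (at t)"
    using line_derivative[OF W f U] by blast
  \<comment> \<open>The embedding of the coordinates of \<open>p\<close> at parameter
    \<open>0\<close>. Composing the partial derivatives of \<open>K\<close> with it shows that the
    derivative depends smoothly on \<open>p\<close>.\<close>
  define J :: "'k ^ 'd \<Rightarrow> 'k ^ ('n + 'd)" where "J x = (\<chi> i. case i of Inl a \<Rightarrow> 0 | Inr b \<Rightarrow> x $ b)" for x
  have J: "J (\<phi> p) = prod_chart (\<lambda>X. X) \<phi> (0, p)" for p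
    by (simp add: vec_eq_iff split_sum_all J_def)
  have o: "open (\<phi> ` (U \<inter> W'))" by (rule smooth_atlas_chart(5)[OF atlas(1) U W'(1)])
  have sJ: "smooth_on (\<phi> ` (U \<inter> W')) (\<lambda>x. J x $ j)" for j
    by (cases j) (simp_all add: J_def smooth_on_const smooth_on_component)
  have JQ: "J x \<in> Q" if "x \<in> \<phi> ` (U \<inter> W')" for x
    using that by (auto simp: J intro!: Q(3)[rule_format] W'(2))
  have "smooth_on (\<phi> ` (U \<inter> W')) (\<lambda>x. partial (Inl a) K (J x))" for a
    by (rule smooth_on_compose[OF o Q(1) JQ sJ smooth_on_partial[OF Q(1,2)]])
  then have "smooth_on (\<phi> ` (U \<inter> W')) (\<lambda>x. \<Sum>a\<in>UNIV. partial (Inl a) K (J x) * X $ a)"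
    by (intro smooth_on_sum smooth_on_mult smooth_on_const o)
  then show "smooth_on (\<phi> ` (U \<inter> W')) (\<lambda>x. dirderiv X f (inv_into U \<phi> x))"
  proof (rule smooth_on_transform[OF _ o])
    fix x assume "x \<in> \<phi> ` (U \<inter> W')"
    then obtain p where p: "p \<in> U" "p \<in> W'" "x = \<phi> p" by auto
    have "inv_into U \<phi> x = p" using p smooth_atlas_chart(2)[OF atlas(1) U] by simp
    then show "(\<Sum>a\<in>UNIV. partial (Inl a) K (J x) * X $ a) = dirderiv X f (inv_into U \<phi> x)"
      using *[rule_format, OF p(1), of 0 X] W'(2)[OF p(2)] unfolding dirderiv_def
      by (simp add: DERIV_imp_deriv p(3) J)
  qed
qed

lemma dirderiv_cong:
  assumes W: "openin S W" and p: "p \<in> topspace T" "\<Phi> (0, p) \<in> W"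
    and "\<And>q. q \<in> W \<Longrightarrow> f q = h q"
  shows "dirderiv X f p = dirderiv X h p"
  unfolding dirderiv_def
  by (rule deriv_cong_ev[OF eventually_mono[OF eventually_param[OF W p]] refl]) (rule assms(4))

lemma dirderiv_add:
  assumes "openin S W" "smooth_function B W f" "smooth_function B W h"
    and "p \<in> topspace T" "\<Phi> (0, p) \<in> W"
  shows "dirderiv X (\<lambda>q. f q + h q) p = dirderiv X f p + dirderiv X h p"
  unfolding dirderiv_def[of X "\<lambda>q. f q + h q"]
  by (rule DERIV_imp_deriv) (intro DERIV_add has_dirderiv[OF assms(1)] assms)

lemma dirderiv_mult:
  assumes "openin S W" "smooth_function B W f" "smooth_function B W h"
    and "p \<in> topspace T" "\<Phi> (0, p) \<in> W" "\<Phi> (0, p) = q"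
  shows "dirderiv X (\<lambda>q. f q * h q) p = f q * dirderiv X h p + h q * dirderiv X f p"
  unfolding dirderiv_def[of X "\<lambda>q. f q * h q"]
  by (rule DERIV_imp_deriv)
    (use DERIV_mult[OF has_dirderiv[OF assms(1,2,4,5), of X] has_dirderiv[OF assms(1,3,4,5), of X]]
      assms(6) in \<open>simp add: mult.commute add.commute\<close>)

end

text \<open>The parameter space has a global chart, so both iterated derivatives belong to one
  function on \<open>'k ^ ('n + 'm)\<close>, taken along two vectors that are supported in different
  blocks.\<close>

lemma dirderiv_commute:
  fixes \<Gamma> :: "('k::{real_normed_field,euclidean_space} ^ 'n::finite) \<times> ('k ^ 'm::finite) \<Rightarrow> 'q"
    and B :: "('q, 'k, 'e::finite) atlas"
  assumes B: "smooth_atlas S B"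
    and \<Gamma>: "smooth_map (prod_topology euclidean euclidean)
      (prod_atlas {(UNIV, \<lambda>X. X)} {(UNIV, \<lambda>X. X)}) S B \<Gamma>"
    and W: "openin S W" "smooth_function B W f" "\<Gamma> (0, 0) \<in> W"
  shows "deriv (\<lambda>s. deriv (\<lambda>t. f (\<Gamma> (s *s X, t *s Y))) 0) 0 =
    deriv (\<lambda>t. deriv (\<lambda>s. f (\<Gamma> (s *s X, t *s Y))) 0) 0"
proof -
  let ?E = "{(UNIV, \<lambda>X. X)} :: ('k ^ 'n, 'k, 'n) atlas" and ?E' = "{(UNIV, \<lambda>X. X)} :: ('k ^ 'm, 'k, 'm) atlas"
  let ?\<kappa> = "prod_chart (\<lambda>X :: 'k ^ 'n. X) (\<lambda>X :: 'k ^ 'm. X)"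
  define V where "V = {z. \<Gamma> z \<in> W}"
  define K where "K = (\<lambda>x. f (\<Gamma> (inv_into UNIV ?\<kappa> x)))"
  have at: "smooth_atlas (prod_topology euclidean euclidean) (prod_atlas ?E ?E')"
    by (intro smooth_atlas_prod smooth_atlas_euclidean)
  have c: "(UNIV, ?\<kappa>) \<in> prod_atlas ?E ?E'"
    using prod_atlasI[of UNIV "\<lambda>X. X" ?E UNIV "\<lambda>X. X" ?E'] by simp
  have V: "openin (prod_topology euclidean euclidean) V"
    using openin_smooth_map_preimage[OF \<Gamma> W(1)] by (simp add: V_def)
  have "smooth_function (prod_atlas ?E ?E') V (\<lambda>z. f (\<Gamma> z))"
    by (rule smooth_function_compose[OF at B \<Gamma> W(1,2) V]) (simp add: V_def)
  from smooth_functionD[OF this c] have sK: "smooth_on (?\<kappa> ` V) K"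
    unfolding K_def by simp
  have oV: "open (?\<kappa> ` V)" using smooth_atlas_chart(5)[OF at c V] by simp
  have inj: "inj ?\<kappa>" by (rule smooth_atlas_chart(2)[OF at c])
  have 0: "?\<kappa> (0, 0) \<in> ?\<kappa> ` V" using W(3) by (auto simp: V_def)
  define v :: "'k ^ ('n + 'm)" where "v = (\<chi> i. case i of Inl a \<Rightarrow> X $ a | Inr b \<Rightarrow> 0)"
  define w :: "'k ^ ('n + 'm)" where "w = (\<chi> i. case i of Inl a \<Rightarrow> 0 | Inr b \<Rightarrow> Y $ b)"
  have vw: "?\<kappa> (0, 0) + s *s v + t *s w = ?\<kappa> (s *s X, t *s Y)" for s t
    by (simp add: vec_eq_iff split_sum_all v_def w_def)
  have "K (?\<kappa> z) = f (\<Gamma> z)" for z using inj by (simp add: K_def)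
  then show ?thesis using deriv_deriv_commute[OF oV sK 0, of v w] by (simp add: vw)
qed

subsection \<open>Lie groups\<close>

locale lie =
  fixes G :: "('g, 'k::{real_normed_field,euclidean_space}, 'n::finite) lie_group_data"
  assumes lie_group: "lie_group G"
begin

abbreviation mult (infixl "\<cdot>" 70) where "x \<cdot> y \<equiv> x \<otimes>\<^bsub>G\<^esub> y"
abbreviation minv where "minv x \<equiv> inv\<^bsub>G\<^esub> x"
abbreviation e0 where "e0 \<equiv> \<one>\<^bsub>G\<^esub>"
abbreviation cG where "cG \<equiv> carrier G"
abbreviation tG where "tG \<equiv> topol G"
abbreviation aG where "aG \<equiv> charts G"
abbreviation ex where "ex \<equiv> Exp G"
abbreviation br where "br \<equiv> lie_br G"
abbreviation (input) stdc :: "('k ^ 'n, 'k, 'n) atlas" where "stdc \<equiv> {(UNIV, \<lambda>X. X)}"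

lemma group: "group G" and topspace [simp]: "topspace tG = cG" and man: "manifold tG aG"
  and mult_smooth: "smooth_map (prod_topology tG tG) (prod_atlas aG aG) tG aG (\<lambda>(x, y). x \<cdot> y)"
  and inv_smooth: "smooth_map tG aG tG aG (\<lambda>x. minv x)"
  and lie_algebra: "lie_algebra br"
  and exp_smooth: "smooth_map euclidean stdc tG aG ex"
  and exp_add: "ex ((s + t) *s X) = ex (s *s X) \<cdot> ex (t *s X)"
  and chart_bij: "(U, \<phi>) \<in> aG \<Longrightarrow> e0 \<in> U \<Longrightarrow> bij (\<lambda>X. \<chi> i. rho G X (\<lambda>g. \<phi> g $ i) e0)"
  and rho_commutator: "openin tG W \<Longrightarrow> smooth_function aG W f \<Longrightarrow> g \<in> W \<Longrightarrow>
    rho G X (rho G Y f) g - rho G Y (rho G X f) g = rho G (br X Y) f g"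
  using lie_group unfolding lie_group_def by auto

lemma atlas: "smooth_atlas tG aG"
  using manifold_imp_smooth_atlas man by blast

sublocale group G by (rule group)

lemma exp_closed [simp]: "ex X \<in> cG"
  using smooth_map_continuous[OF exp_smooth] by (auto simp: continuous_map_def)

lemma exp_zero [simp]: "ex 0 = e0"
proof -
  have "ex 0 \<cdot> ex 0 = ex 0" using exp_add[of 0 0 0] by simp
  then show ?thesis by (metis exp_closed l_cancel_one)
qed

lemma exp_uminus: "ex (- X) = minv (ex X)"
proof -
  have "ex ((- 1 + 1) *s X) = ex (- 1 *s X) \<cdot> ex (1 *s X)" by (rule exp_add)
  then have "ex (- X) \<cdot> ex X = e0" by (simp add: vector_sneg_minus1[symmetric])
  then show ?thesis by (intro inv_equality[symmetric]) simp_all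
qed

lemma openin_subset_carrier: "openin tG W \<Longrightarrow> W \<subseteq> cG"
  using openin_subset by fastforce

lemma smooth_mult:
  fixes C :: "('s, 'k, 'c::finite) atlas"
  assumes C: "smooth_atlas Z C" and F: "smooth_map Z C tG aG F" and H: "smooth_map Z C tG aG H"
  shows "smooth_map Z C tG aG (\<lambda>p. F p \<cdot> H p)"
  using smooth_map_compose[OF C smooth_atlas_prod[OF atlas atlas] atlas
      smooth_map_Pair[OF C atlas atlas F H] mult_smooth] by simp

lemma smooth_inv:
  fixes C :: "('s, 'k, 'c::finite) atlas"
  assumes C: "smooth_atlas Z C" and F: "smooth_map Z C tG aG F"
  shows "smooth_map Z C tG aG (\<lambda>p. minv (F p))"
  by (rule smooth_map_compose[OF C atlas atlas F inv_smooth])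

lemma smooth_exp:
  fixes C :: "('s, 'k, 'c::finite) atlas"
  assumes C: "smooth_atlas Z C" and F: "smooth_map Z C euclidean stdc F"
  shows "smooth_map Z C tG aG (\<lambda>p. ex (F p))"
  by (rule smooth_map_compose[OF C smooth_atlas_euclidean atlas F exp_smooth])

lemma smooth_constG:
  fixes C :: "('s, 'k, 'c::finite) atlas"
  assumes "smooth_atlas Z C" "q \<in> cG" shows "smooth_map Z C tG aG (\<lambda>p. q)"
  by (rule smooth_map_const[OF assms(1)]) (simp add: assms(2))

lemma param_atlas: "smooth_atlas (prod_topology euclidean tG) (prod_atlas stdc aG)"
  by (intro smooth_atlas_prod smooth_atlas_euclidean atlas)

lemma param_fst: "smooth_map (prod_topology euclidean tG) (prod_atlas stdc aG) euclidean stdc fst"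
  and param_snd: "smooth_map (prod_topology euclidean tG) (prod_atlas stdc aG) tG aG snd"
  by (rule smooth_map_fst[OF smooth_atlas_euclidean atlas], rule smooth_map_snd[OF smooth_atlas_euclidean atlas])

lemmas param_intros = smooth_mult smooth_inv smooth_exp smooth_constG param_fst param_snd param_atlas

section \<open>Invariant vector fields and conjugation as parametrised families\<close>

lemma right_param: "parametrised_map tG aG tG aG (\<lambda>z. snd z \<cdot> ex (fst z))"
  and left_param: "parametrised_map tG aG tG aG (\<lambda>z. ex (fst z) \<cdot> snd z)"
  by (unfold_locales) (intro atlas param_intros)+

lemma conj_param: "q \<in> cG \<Longrightarrow> parametrised_map tG aG tG aG (\<lambda>z. q \<cdot> ex (fst z) \<cdot> minv q)"
  and conj_inv_param: "parametrised_map tG aG tG aG (\<lambda>z. minv (snd z) \<cdot> ex (fst z) \<cdot> snd z)"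
  by (unfold_locales) (intro atlas param_intros; simp)+

lemma rho_eq: "rho G X f g = parametrised_map.dirderiv (\<lambda>z. snd z \<cdot> ex (fst z)) X f g"
  by (simp add: rho_def parametrised_map.dirderiv_def[OF right_param])

lemma lam_eq: "lam G X f g = parametrised_map.dirderiv (\<lambda>z. ex (fst z) \<cdot> snd z) X f g"
  by (simp add: lam_def parametrised_map.dirderiv_def[OF left_param])

context
  fixes W f assumes W: "openin tG W" and f: "smooth_function aG W f"
begin

lemma carrierW: "g \<in> W \<Longrightarrow> g \<in> cG"
  using openin_subset_carrier[OF W] by blast

lemma has_rho:
  "g \<in> W \<Longrightarrow> ((\<lambda>t. f (g \<cdot> ex (t *s X))) has_field_derivative rho G X f g) (at 0)"
  using parametrised_map.has_dirderiv[OF right_param W f, of g X] carrierW[of g]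
  by (simp add: rho_eq)

lemma has_lam:
  "g \<in> W \<Longrightarrow> ((\<lambda>t. f (ex (t *s X) \<cdot> g)) has_field_derivative lam G X f g) (at 0)"
  using parametrised_map.has_dirderiv[OF left_param W f, of g X] carrierW[of g]
  by (simp add: lam_eq)

lemma rho_linear: "g \<in> W \<Longrightarrow> rho G X f g = (\<Sum>a\<in>UNIV. X $ a * rho G (axis a 1) f g)"
  unfolding rho_eq
  by (rule parametrised_map.dirderiv_linear[OF right_param W f]) (use carrierW in simp_all)

lemma lam_linear: "g \<in> W \<Longrightarrow> lam G X f g = (\<Sum>a\<in>UNIV. X $ a * lam G (axis a 1) f g)"
  unfolding lam_eq
  by (rule parametrised_map.dirderiv_linear[OF left_param W f]) (use carrierW in simp_all)

lemma smooth_rho: "smooth_function aG W (rho G X f)"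
  using parametrised_map.smooth_dirderiv[OF right_param W f W, of X] carrierW
  by (simp add: rho_eq[abs_def])

lemma smooth_lam: "smooth_function aG W (lam G X f)"
  using parametrised_map.smooth_dirderiv[OF left_param W f W, of X] carrierW
  by (simp add: lam_eq[abs_def])

lemma rho_cong: "g \<in> W \<Longrightarrow> (\<And>x. x \<in> W \<Longrightarrow> f x = h x) \<Longrightarrow> rho G X f g = rho G X h g"
  unfolding rho_eq
  by (rule parametrised_map.dirderiv_cong[OF right_param W]) (use carrierW in simp_all)

lemma lam_cong: "g \<in> W \<Longrightarrow> (\<And>x. x \<in> W \<Longrightarrow> f x = h x) \<Longrightarrow> lam G X f g = lam G X h g"
  unfolding lam_eq
  by (rule parametrised_map.dirderiv_cong[OF left_param W]) (use carrierW in simp_all)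

lemma rho_mult:
  "smooth_function aG W h \<Longrightarrow> g \<in> W \<Longrightarrow>
    rho G X (\<lambda>x. f x * h x) g = f g * rho G X h g + h g * rho G X f g"
  unfolding rho_eq
  by (rule parametrised_map.dirderiv_mult[OF right_param W f]) (use carrierW in simp_all)

lemma rho_add:
  "smooth_function aG W h \<Longrightarrow> g \<in> W \<Longrightarrow> rho G X (\<lambda>x. f x + h x) g = rho G X f g + rho G X h g"
  unfolding rho_eq
  by (rule parametrised_map.dirderiv_add[OF right_param W f]) (use carrierW in simp_all)

text \<open>Left and right translations commute by associativity: both orders of differentiation
  belong to the two-parameter family \<open>ex X \<cdot> g \<cdot> ex Y\<close>.\<close>

lemma lam_rho_commute:
  assumes g: "g \<in> W" shows "lam G X (rho G Y f) g = rho G Y (lam G X f) g"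
proof -
  have C: "smooth_atlas (prod_topology euclidean euclidean) (prod_atlas stdc stdc)"
    by (intro smooth_atlas_prod smooth_atlas_euclidean)
  have s: "smooth_map (prod_topology euclidean euclidean) (prod_atlas stdc stdc) euclidean stdc fst"
    "smooth_map (prod_topology euclidean euclidean) (prod_atlas stdc stdc) euclidean stdc snd"
    by (rule smooth_map_fst[OF smooth_atlas_euclidean smooth_atlas_euclidean],
        rule smooth_map_snd[OF smooth_atlas_euclidean smooth_atlas_euclidean])
  have "smooth_map (prod_topology euclidean euclidean) (prod_atlas stdc stdc) tG aG
      (\<lambda>z. ex (fst z) \<cdot> g \<cdot> ex (snd z))"
    by (intro smooth_mult smooth_exp C s smooth_constG carrierW g)
  from dirderiv_commute[OF atlas this W f, of X Y]
  show ?thesis using g carrierW[OF g] by (simp add: lam_def rho_def m_assoc)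
qed

end

lemma rho_sum:
  assumes W: "openin tG W" "\<And>i. i \<in> I \<Longrightarrow> smooth_function aG W (f i)" "g \<in> W"
  shows "rho G X (\<lambda>x. \<Sum>i\<in>I. f i x) g = (\<Sum>i\<in>I. rho G X (f i) g)"
  using W(2)
proof (induction I rule: infinite_finite_induct)
  case (insert i I)
  then have "smooth_function aG W (\<lambda>x. \<Sum>i\<in>I. f i x)"
    by (intro smooth_function_sum[OF atlas W(1)]) auto
  with insert show ?case by (simp add: rho_add[OF W(1) _ _ W(3)])
qed simp_all

lemma rho_cmult:
  assumes "openin tG W" "smooth_function aG W f" "g \<in> W"
  shows "rho G X (\<lambda>x. c * f x) g = c * rho G X f g"
  using rho_mult[OF assms(1) smooth_function_const assms(2,3), of X c] by simp

lemma smooth_function_pullback: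
  assumes "smooth_map tG aG tG aG F" "openin tG W" "smooth_function aG W f"
  shows "openin tG {x\<in>cG. F x \<in> W}" "smooth_function aG {x\<in>cG. F x \<in> W} (\<lambda>x. f (F x))"
proof -
  show o: "openin tG {x\<in>cG. F x \<in> W}"
    using openin_smooth_map_preimage[OF assms(1,2)] by simp
  show "smooth_function aG {x\<in>cG. F x \<in> W} (\<lambda>x. f (F x))"
    by (rule smooth_function_compose[OF atlas atlas assms(1-3) o]) simp
qed

lemma smooth_left_mult: "g \<in> cG \<Longrightarrow> smooth_map tG aG tG aG (\<lambda>x. g \<cdot> x)"
  by (intro smooth_mult atlas smooth_constG smooth_map_ident)

lemma rho_left_translate: "g \<in> cG \<Longrightarrow> h \<in> cG \<Longrightarrow> rho G X (\<lambda>x. f (g \<cdot> x)) h = rho G X f (g \<cdot> h)"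
  by (simp add: rho_def m_assoc)

subsection \<open>Coordinates at the identity\<close>

text \<open>A function sees a curve only through its velocity in coordinates. Applied to
  \<open>ex\<close> and to a conjugate of \<open>ex\<close>, this lets one compare curves by the
  finitely many coordinate functions.\<close>

lemma curve_derivative:
  assumes \<Psi>: "smooth_map euclidean stdc tG aG \<Psi>" and W: "openin tG W" "smooth_function aG W h"
    and c: "(U, \<phi>) \<in> aG" "\<Psi> 0 \<in> U" "\<Psi> 0 \<in> W"
  shows "deriv (\<lambda>t. h (\<Psi> (t *s X))) 0 =
    (\<Sum>i\<in>UNIV. partial i (\<lambda>x. h (inv_into U \<phi> x)) (\<phi> (\<Psi> 0)) * deriv (\<lambda>t. \<phi> (\<Psi> (t *s X)) $ i) 0)"
proof -
  \<comment> \<open>The curve is regarded as a family that does not depend on the point of the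
    group, so that the results on parametrised maps apply.\<close>
  have "smooth_map (prod_topology euclidean tG) (prod_atlas stdc aG) tG aG (\<lambda>z. \<Psi> (fst z))"
    by (rule smooth_map_compose[OF param_atlas smooth_atlas_euclidean atlas param_fst \<Psi>])
  then interpret P: parametrised_map tG aG tG aG "\<lambda>z. \<Psi> (fst z)"
    by unfold_locales (rule atlas)
  have U: "openin tG U" by (rule smooth_atlas_chart(1)[OF atlas c(1)])
  have p: "e0 \<in> topspace tG" by simp
  have "((\<lambda>t. \<phi> (\<Psi> (t *s X)) $ i) has_field_derivative deriv (\<lambda>t. \<phi> (\<Psi> (t *s X)) $ i) 0) (at 0)" for i
    using P.has_dirderiv[OF U smooth_function_chart[OF atlas c(1), of i] p, of X] c
    by (simp add: P.dirderiv_def)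
  then have \<gamma>: "((\<lambda>t. \<phi> (\<Psi> (t *s X))) has_derivative
      (\<lambda>h. \<chi> i. deriv (\<lambda>t. \<phi> (\<Psi> (t *s X)) $ i) 0 * h)) (at 0)"
    by (intro has_derivative_vec) (simp add: has_field_derivative_def)
  define K where "K = (\<lambda>x. h (inv_into U \<phi> x))"
  have o: "open (\<phi> ` (U \<inter> W))" by (rule smooth_atlas_chart(5)[OF atlas c(1) W(1)])
  have "has_gradient K (\<lambda>i. partial i K (\<phi> (\<Psi> 0))) (\<phi> (\<Psi> 0))"
    by (rule smooth_on_has_gradient[OF o])
      (use smooth_functionD[OF W(2) c(1)] c in \<open>auto simp: K_def\<close>)
  then have "(K has_derivative (\<lambda>h. \<Sum>i\<in>UNIV. partial i K (\<phi> (\<Psi> 0)) * h $ i)) (at (\<phi> (\<Psi> (0 *s X))))"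
    by (simp add: has_gradient_def)
  from has_derivative_compose[OF \<gamma> this]
  have "((\<lambda>t. K (\<phi> (\<Psi> (t *s X)))) has_field_derivative
     (\<Sum>i\<in>UNIV. partial i K (\<phi> (\<Psi> 0)) * deriv (\<lambda>t. \<phi> (\<Psi> (t *s X)) $ i) 0)) (at 0)"
    unfolding has_field_derivative_def
    by (rule has_derivative_eq_rhs) (simp add: fun_eq_iff sum_distrib_right mult.assoc)
  then have "deriv (\<lambda>t. K (\<phi> (\<Psi> (t *s X)))) 0 =
     (\<Sum>i\<in>UNIV. partial i K (\<phi> (\<Psi> 0)) * deriv (\<lambda>t. \<phi> (\<Psi> (t *s X)) $ i) 0)"
    by (rule DERIV_imp_deriv)
  moreover have "deriv (\<lambda>t. K (\<phi> (\<Psi> (t *s X)))) 0 = deriv (\<lambda>t. h (\<Psi> (t *s X))) 0"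
  proof (rule deriv_cong_ev[OF _ refl])
    have "eventually (\<lambda>t. \<Psi> (t *s X) \<in> U) (nhds 0)"
      using P.eventually_param[OF U p, of X] c by simp
    then show "eventually (\<lambda>t. K (\<phi> (\<Psi> (t *s X))) = h (\<Psi> (t *s X))) (nhds 0)"
      by (rule eventually_mono) (simp add: K_def smooth_atlas_chart(2)[OF atlas c(1)])
  qed
  ultimately show ?thesis unfolding K_def by simp
qed

lemma rho_one: "rho G X h e0 = deriv (\<lambda>t. h (ex (t *s X))) 0"
  by (simp add: rho_def)

text \<open>By \<open>chart_bij\<close> every coordinate direction at the identity is the velocity
  of some one-parameter subgroup.\<close>

lemma gradient_eq_zero:
  assumes c: "(U, \<phi>) \<in> aG" "e0 \<in> U" and W: "openin tG W" "smooth_function aG W h" "e0 \<in> W"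
    and zero: "\<And>X. rho G X h e0 = 0"
  shows "partial i (\<lambda>x. h (inv_into U \<phi> x)) (\<phi> e0) = 0"
proof -
  obtain X where "(\<chi> i. rho G X (\<lambda>g. \<phi> g $ i) e0) = axis i 1"
    using bij_is_surj[OF chart_bij[OF c]] unfolding surj_def by metis
  then have X: "deriv (\<lambda>t. \<phi> (ex (t *s X)) $ j) 0 = axis i 1 $ j" for j
    by (simp add: vec_eq_iff rho_one)
  show ?thesis
    using curve_derivative[OF exp_smooth W(1,2) c(1), of X] c W(3) zero[of X]
    by (simp add: rho_one X sum_axis)
qed

text \<open>The coordinate velocity \<open>L\<close> is linear and bijective; recombining the chart
  coordinates with the inverse of \<open>L\<close> gives functions whose differentials at the
  identity are dual to the basis.\<close>

lemma identity_frame: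
  obtains W f where "openin tG W" "e0 \<in> W" "\<And>a. smooth_function aG W (f a)"
    "\<And>X a. rho G X (f a) e0 = X $ a"
proof -
  obtain U \<phi> where U: "(U, \<phi>) \<in> aG" "e0 \<in> U"
    using smooth_atlas_cover[OF atlas, of e0] by auto
  have oU: "openin tG U" by (rule smooth_atlas_chart(1)[OF atlas U(1)])
  define L where "L X = (\<chi> i. rho G X (\<lambda>g. \<phi> g $ i) e0)" for X
  have L: "bij L" unfolding L_def by (rule chart_bij[OF U])
  have sc: "smooth_function aG U (\<lambda>g. \<phi> g $ i)" for i by (rule smooth_function_chart[OF atlas U(1)])
  have lin: "L X = (\<Sum>a\<in>UNIV. X $ a *s L (axis a 1))" for X
    unfolding vec_eq_iff L_def
    by (simp add: rho_linear[OF oU sc U(2), where X=X])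
  \<comment> \<open>The columns of the inverse matrix of \<open>L\<close>.\<close>
  define M where "M i = inv_into UNIV L (axis i 1)" for i
  have M: "L (M i) = axis i 1" for i
    unfolding M_def by (rule surj_f_inv_f[OF bij_is_surj[OF L]])
  have LS: "L (\<Sum>i\<in>UNIV. c i *s M i) = (\<Sum>i\<in>UNIV. c i *s L (M i))" for c
  proof -
    have "L (\<Sum>i\<in>UNIV. c i *s M i) =
        (\<Sum>a\<in>UNIV. \<Sum>i\<in>UNIV. c i *s (M i $ a *s L (axis a 1)))"
      by (subst lin) (simp add: vec_eq_iff sum_distrib_right mult.assoc)
    also have "\<dots> = (\<Sum>i\<in>UNIV. c i *s (\<Sum>a\<in>UNIV. M i $ a *s L (axis a 1)))"
      by (subst sum.swap) (simp add: vec_eq_iff sum_distrib_left mult.assoc)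
    finally show ?thesis by (simp add: lin[symmetric])
  qed
  have inverse: "(\<Sum>i\<in>UNIV. L X $ i *s M i) = X" for X
  proof -
    have "L (\<Sum>i\<in>UNIV. L X $ i *s M i) = L X"
      by (simp add: LS M vec_eq_iff axis_def if_distrib[of "(*) _"] cong: if_cong)
    then show ?thesis using bij_is_inj[OF L] by (simp add: inj_eq)
  qed
  define f where "f a g = (\<Sum>i\<in>UNIV. M i $ a * \<phi> g $ i)" for a g
  have sf: "smooth_function aG U (f a)" for a
    unfolding f_def by (intro smooth_function_sum[OF atlas oU] smooth_function_mult[OF atlas oU]
        smooth_function_const sc)
  have "rho G X (f a) e0 = X $ a" for X a
  proof -
    have "rho G X (f a) e0 = (\<Sum>i\<in>UNIV. M i $ a * L X $ i)"
      unfolding f_def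
      by (subst rho_sum[OF oU _ U(2)])
        (simp_all add: smooth_function_mult[OF atlas oU smooth_function_const sc]
          rho_cmult[OF oU sc U(2)] L_def)
    also have "\<dots> = (\<Sum>i\<in>UNIV. L X $ i *s M i) $ a" by (simp add: mult.commute)
    finally show ?thesis by (simp only: inverse)
  qed
  with oU U(2) sf show thesis by (rule that)
qed

text \<open>The fields \<rho> are invariant under left translation, which therefore carries the
  functions found at the identity to \<open>g\<close>.\<close>

lemma frame:
  assumes g: "g \<in> cG"
  obtains W f where "openin tG W" "g \<in> W" "\<And>a. smooth_function aG W (f a)"
    "\<And>X a. rho G X (f a) g = X $ a"
proof -
  obtain W f where W: "openin tG W" "e0 \<in> W" "\<And>a. smooth_function aG W (f a)"
    "\<And>X a. rho G X (f a) e0 = X $ a" by (rule identity_frame) blast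
  have m: "smooth_map tG aG tG aG (\<lambda>x. minv g \<cdot> x)" by (rule smooth_left_mult) (simp add: g)
  show thesis
  proof (rule that)
    show "openin tG {x\<in>cG. minv g \<cdot> x \<in> W}"
      by (rule smooth_function_pullback(1)[OF m W(1,3)])
    show "smooth_function aG {x\<in>cG. minv g \<cdot> x \<in> W} (\<lambda>x. f a (minv g \<cdot> x))" for a
      by (rule smooth_function_pullback(2)[OF m W(1,3)])
    show "g \<in> {x\<in>cG. minv g \<cdot> x \<in> W}" using g W(2) by simp
    show "rho G X (\<lambda>x. f a (minv g \<cdot> x)) g = X $ a" for X a
      using rho_left_translate[of "minv g" g X "f a"] g W(4) by simp
  qed
qed

text \<open>The link between \<rho> and coordinates is available at the identity. To see that the
  gradient vanishes at another point \<open>g\<close>, the function is translated to the identity,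
  where \<open>gradient_eq_zero\<close> applies, and the result is carried back by the chain rule. A
  function with zero derivative on a ball is constant.\<close>

lemma locally_constant:
  assumes W: "openin tG W" "smooth_function aG W h" and zero: "\<And>X g. g \<in> W \<Longrightarrow> rho G X h g = 0"
    and p: "p \<in> W"
  shows "\<exists>N. openin tG N \<and> p \<in> N \<and> (\<forall>q\<in>N. h q = h p)"
proof -
  have pG: "p \<in> cG" using p openin_subset_carrier[OF W(1)] by blast
  obtain V \<psi> where V: "(V, \<psi>) \<in> aG" "p \<in> V"
    using smooth_atlas_cover[OF atlas, of p] pG by auto
  define H where "H x = h (inv_into V \<psi> x)" for x
  have oV: "openin tG V" by (rule smooth_atlas_chart(1)[OF atlas V(1)])
  have oVW: "open (\<psi> ` (V \<inter> W))" by (rule smooth_atlas_chart(5)[OF atlas V(1) W(1)])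
  have injV: "inj_on \<psi> V" by (rule smooth_atlas_chart(2)[OF atlas V(1)])
  have H0: "has_gradient H (\<lambda>i. 0) x" if x: "x \<in> \<psi> ` (V \<inter> W)" for x
  proof -
    obtain g where g: "g \<in> V" "g \<in> W" "x = \<psi> g" using x by auto
    have gG: "g \<in> cG" using g(2) openin_subset_carrier[OF W(1)] by blast
    obtain U \<phi> where U: "(U, \<phi>) \<in> aG" "e0 \<in> U"
      using smooth_atlas_cover[OF atlas, of e0] by auto
    have oU: "openin tG U" by (rule smooth_atlas_chart(1)[OF atlas U(1)])
    have injU: "inj_on \<phi> U" by (rule smooth_atlas_chart(2)[OF atlas U(1)])
    define k where "k y = h (g \<cdot> y)" for y
    define Wk where "Wk = {y\<in>cG. g \<cdot> y \<in> W}"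
    have k: "openin tG Wk" "smooth_function aG Wk k"
      unfolding Wk_def k_def by (rule smooth_function_pullback[OF smooth_left_mult[OF gG] W])+
    have e: "e0 \<in> Wk" using g gG by (simp add: Wk_def)
    have "rho G X k e0 = 0" for X
      unfolding k_def using rho_left_translate[OF gG, of e0 X h] zero[OF g(2)] gG by simp
    from gradient_eq_zero[OF U k e this]
    have pz: "partial i (\<lambda>x. k (inv_into U \<phi> x)) (\<phi> e0) = 0" for i .
    have oUk: "open (\<phi> ` (U \<inter> Wk))" by (rule smooth_atlas_chart(5)[OF atlas U(1) k(1)])
    have grad: "has_gradient (\<lambda>x. k (inv_into U \<phi> x)) (\<lambda>i. 0) (\<phi> e0)"
      using smooth_on_has_gradient[OF oUk smooth_functionD[OF k(2) U(1)], of "\<phi> e0"] U e pz by simp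
    \<comment> \<open>Coordinate expression, in charts around \<open>g\<close> and around the
      identity, of the translation that moves \<open>g\<close> to the identity.\<close>
    define M where "M y = \<phi> (minv g \<cdot> inv_into V \<psi> y)" for y
    define N where "N = {y\<in>cG. minv g \<cdot> y \<in> U}"
    have m: "smooth_map tG aG tG aG (\<lambda>y. minv g \<cdot> y)" by (rule smooth_left_mult) (simp add: gG)
    have N: "openin tG N"
      unfolding N_def by (rule smooth_function_pullback(1)[OF m oU smooth_function_const])
    have gN: "g \<in> N" using gG U by (simp add: N_def)
    have sM: "smooth_on (\<psi> ` (V \<inter> N)) (\<lambda>y. M y $ j)" for j
    proof -
      have "smooth_function aG N (\<lambda>y. \<phi> (minv g \<cdot> y) $ j)"
        unfolding N_def
        by (rule smooth_function_pullback(2)[OF m oU smooth_function_chart[OF atlas U(1)]])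
      from smooth_functionD[OF this V(1)] show ?thesis unfolding M_def .
    qed
    have oVN: "open (\<psi> ` (V \<inter> N))" by (rule smooth_atlas_chart(5)[OF atlas V(1) N])
    have xV: "x \<in> \<psi> ` (V \<inter> N)" using g gN by blast
    have Mx: "M x = \<phi> e0" using g gG injV by (simp add: M_def)
    have "has_gradient (\<lambda>y. k (inv_into U \<phi> (M y)))
       (\<lambda>i. \<Sum>j\<in>UNIV. 0 * partial i (\<lambda>y. M y $ j) x) x"
      by (rule has_gradient_compose)
        (use grad smooth_on_has_gradient[OF oVN sM xV] in \<open>simp_all add: Mx\<close>)
    then have gk: "has_gradient (\<lambda>y. k (inv_into U \<phi> (M y))) (\<lambda>i. 0) x" by simp
    have kH: "k (inv_into U \<phi> (M y)) = H y" if y: "y \<in> \<psi> ` (V \<inter> N)" for y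
    proof -
      obtain z where z: "z \<in> V" "z \<in> N" "y = \<psi> z" using y by auto
      have zG: "z \<in> cG" using z(2) by (simp add: N_def)
      have "inv_into V \<psi> y = z" using z injV by simp
      moreover have "inv_into U \<phi> (\<phi> (minv g \<cdot> z)) = minv g \<cdot> z"
        using z(2) injU by (simp add: N_def)
      ultimately show ?thesis
        using gG zG by (simp add: M_def H_def k_def m_assoc[symmetric])
    qed
    have "has_gradient (\<lambda>y. k (inv_into U \<phi> (M y))) (\<lambda>i. 0) x \<longleftrightarrow> has_gradient H (\<lambda>i. 0) x"
      by (rule has_gradient_cong[OF oVN xV]) (rule kH)
    with gk show ?thesis by simp
  qed
  have "\<psi> p \<in> \<psi> ` (V \<inter> W)" using V p by blast
  then obtain d where d: "d > 0" "ball (\<psi> p) d \<subseteq> \<psi> ` (V \<inter> W)"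
    using oVW open_contains_ball by blast
  have "\<exists>c. \<forall>x\<in>ball (\<psi> p) d. H x = c"
  proof (rule has_derivative_zero_constant)
    fix x assume "x \<in> ball (\<psi> p) d"
    then have "has_gradient H (\<lambda>i. 0) x" using d(2) by (intro H0) blast
    then have "(H has_derivative (\<lambda>h. 0)) (at x)" by (simp add: has_gradient_def)
    then show "(H has_derivative (\<lambda>h. 0)) (at x within ball (\<psi> p) d)"
      by (rule has_derivative_at_withinI)
  qed simp
  then obtain c where c: "\<And>x. x \<in> ball (\<psi> p) d \<Longrightarrow> H x = c" by blast
  show ?thesis
  proof (intro exI conjI ballI)
    show "openin tG {q\<in>V. \<psi> q \<in> ball (\<psi> p) d}"
      by (rule smooth_atlas_chart(6)[OF atlas V(1)]) simp
    show "p \<in> {q\<in>V. \<psi> q \<in> ball (\<psi> p) d}" using V d by simp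
    fix q assume q: "q \<in> {q\<in>V. \<psi> q \<in> ball (\<psi> p) d}"
    have "h q = H (\<psi> q)" "h p = H (\<psi> p)" using q V injV by (simp_all add: H_def)
    then show "h q = h p" using c[of "\<psi> q"] c[of "\<psi> p"] q d(1) by simp
  qed
qed

lemma constant_if_rho_zero:
  assumes conn: "connected_space tG" and h: "smooth_function aG cG h"
    and zero: "\<And>X g. g \<in> cG \<Longrightarrow> rho G X h g = 0" and pq: "p \<in> cG" "q \<in> cG"
  shows "h p = h q"
proof (rule ccontr)
  assume ne: "h p \<noteq> h q"
  have oG: "openin tG cG" using openin_topspace[of tG] by simp
  \<comment> \<open>Local constancy makes the preimage of an arbitrary set of values open; this
    serves both for a level set and for its complement.\<close>
  have o: "openin tG {x\<in>cG. P (h x)}" for P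
  proof (subst openin_subopen, intro ballI)
    fix x assume x: "x \<in> {x\<in>cG. P (h x)}"
    then have xG: "x \<in> cG" by simp
    have "\<exists>N. openin tG N \<and> x \<in> N \<and> (\<forall>y\<in>N. h y = h x)"
      by (rule locally_constant[OF oG h zero xG])
    then obtain N where N: "openin tG N" "x \<in> N" "\<forall>y\<in>N. h y = h x" by blast
    have "N \<subseteq> {x\<in>cG. P (h x)}"
    proof
      fix y assume y: "y \<in> N"
      have "h y = h x" using N(3) y by (rule bspec)
      then show "y \<in> {x\<in>cG. P (h x)}" using x y openin_subset_carrier[OF N(1)] by auto
    qed
    with N show "\<exists>T. openin tG T \<and> x \<in> T \<and> T \<subseteq> {x\<in>cG. P (h x)}" by blast
  qed
  have "openin tG {x\<in>cG. h x = h p}" "openin tG {x\<in>cG. h x \<noteq> h p}"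
    using o[of "\<lambda>y. y = h p"] o[of "\<lambda>y. y \<noteq> h p"] by simp_all
  moreover have "topspace tG \<subseteq> {x\<in>cG. h x = h p} \<union> {x\<in>cG. h x \<noteq> h p}" by auto
  moreover have "{x\<in>cG. h x = h p} \<inter> {x\<in>cG. h x \<noteq> h p} = {}" by auto
  moreover have "{x\<in>cG. h x = h p} \<noteq> {}" "{x\<in>cG. h x \<noteq> h p} \<noteq> {}" using pq ne by auto
  ultimately show False using conn unfolding connected_space_def by blast
qed

end

subsection \<open>Self-dual Lie algebras\<close>

lemma sum_rotate:
  "(\<Sum>i\<in>I. \<Sum>j\<in>J. \<Sum>k\<in>K. h i j k) = (\<Sum>j\<in>J. \<Sum>k\<in>K. \<Sum>i\<in>I. h i j k)"
  by (rule trans[OF sum.swap], rule sum.cong[OF refl], rule sum.swap)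

lemma sum_rotate2:
  "(\<Sum>a\<in>I. \<Sum>c\<in>J. \<Sum>j\<in>K. \<Sum>k\<in>L. h a c j k) = (\<Sum>j\<in>K. \<Sum>k\<in>L. \<Sum>a\<in>I. \<Sum>c\<in>J. h a c j k)"
  by (rule trans[OF _ sum_rotate], rule sum.cong[OF refl], rule sum_rotate)

locale lie_bracket =
  fixes br :: "'k::field_char_0 ^ 'n::finite \<Rightarrow> 'k ^ 'n \<Rightarrow> 'k ^ 'n"
  assumes lie: "lie_algebra br"
begin

lemma br_lin: "br (X + c *s Y) Z = br X Z + c *s br Y Z" "br Z (X + c *s Y) = br Z X + c *s br Z Y"
  and br_self: "br X X = 0"
  using lie unfolding lie_algebra_def by blast+

lemma br_add: "br (X + Y) Z = br X Z + br Y Z" "br Z (X + Y) = br Z X + br Z Y"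
  using br_lin(1)[of X 1 Y Z] br_lin(2)[of Z X 1 Y] by simp_all

lemma br_zero: "br 0 Z = 0" "br Z 0 = 0"
  using br_add(1)[of 0 0 Z] br_add(2)[of Z 0 0] by simp_all

lemma br_scale: "br (c *s X) Z = c *s br X Z" "br Z (c *s X) = c *s br Z X"
  using br_lin(1)[of 0 c X Z] br_lin(2)[of Z 0 c X] by (simp_all add: br_zero)

lemma br_uminus: "br (- X) Z = - br X Z" "br Z (- X) = - br Z X"
  using br_scale[where c="- 1" and X=X and Z=Z] by simp_all

lemma br_diff: "br (X - Y) Z = br X Z - br Y Z" "br Z (X - Y) = br Z X - br Z Y"
  using br_add(1)[of X "- Y" Z] br_add(2)[of Z X "- Y"] by (simp_all add: br_uminus)

lemma br_anti: "br X Y = - br Y X"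
proof -
  have "br X Y + br Y X = 0"
    using br_self[of "X + Y"] br_self[of X] br_self[of Y] by (simp add: br_add add.commute)
  then show ?thesis by (simp only: eq_neg_iff_add_eq_0)
qed

lemma br_sum_left: "br (\<Sum>i\<in>I. h i) Z = (\<Sum>i\<in>I. br (h i) Z)"
  by (induction I rule: infinite_finite_induct) (simp_all add: br_zero br_add)

lemma br_sum_right: "br Z (\<Sum>i\<in>I. h i) = (\<Sum>i\<in>I. br Z (h i))"
  by (induction I rule: infinite_finite_induct) (simp_all add: br_zero br_add)

lemma vec_basis: "(X :: 'k ^ 'n) = (\<Sum>a\<in>UNIV. X $ a *s axis a 1)"
  by (simp add: vec_eq_iff axis_def if_distrib[of "(*) _"] cong: if_cong)

lemma br_expand: "br X Y $ c = (\<Sum>a\<in>UNIV. \<Sum>b\<in>UNIV. struct_const br a b c * X $ a * Y $ b)"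
  by (subst vec_basis[of X], subst vec_basis[of Y])
    (simp add: br_sum_left br_sum_right br_scale sum_distrib_left struct_const_def mult_ac, rule sum.swap)

end

locale self_dual = lie_bracket br
  for br :: "'k::field_char_0 ^ 'n::finite \<Rightarrow> 'k ^ 'n \<Rightarrow> 'k ^ 'n" +
  fixes B :: "'k ^ 'n \<Rightarrow> 'k ^ 'n \<Rightarrow> 'k"
  assumes inv_prod: "invariant_scalar_product br B"
begin

lemma B_lin: "B (X + c *s Y) Z = B X Z + c * B Y Z"
  and B_sym: "B X Y = B Y X"
  and B_inv: "B (br X Y) Z = B X (br Y Z)"
proof -
  note p = inv_prod[unfolded invariant_scalar_product_def]
  show "B (X + c *s Y) Z = B X Z + c * B Y Z" by (rule p[THEN conjunct1, rule_format])
  show "B X Y = B Y X" by (rule p[THEN conjunct2, THEN conjunct1, rule_format])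
  show "B (br X Y) Z = B X (br Y Z)"
    by (rule p[THEN conjunct2, THEN conjunct2, THEN conjunct2, rule_format])
qed

lemma B_nondeg: "(\<And>Y. B X Y = 0) \<Longrightarrow> X = 0"
  using inv_prod unfolding invariant_scalar_product_def by simp

lemma B_add: "B (X + Y) Z = B X Z + B Y Z" "B Z (X + Y) = B Z X + B Z Y"
  using B_lin[of X 1 Y Z] by (simp_all add: B_sym[of Z])

lemma B_zero: "B 0 Z = 0" "B Z 0 = 0"
  using B_add(1)[of 0 0 Z] by (simp_all add: B_sym[of Z])

lemma B_scale: "B (c *s X) Z = c * B X Z" "B Z (c *s X) = c * B Z X"
  using B_lin[of 0 c X Z] by (simp_all add: B_zero B_sym[of Z])

lemma B_uminus: "B (- X) Z = - B X Z" "B Z (- X) = - B Z X"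
  using B_scale[where c="- 1" and X=X and Z=Z] by (simp_all add: B_sym[of Z])

lemma B_diff: "B (X - Y) Z = B X Z - B Y Z" "B Z (X - Y) = B Z X - B Z Y"
  using B_add(1)[of X "- Y" Z] by (simp_all add: B_uminus B_sym[of Z])

lemma B_sum: "B (\<Sum>i\<in>I. h i) Z = (\<Sum>i\<in>I. B (h i) Z)"
  by (induction I rule: infinite_finite_induct) (simp_all add: B_zero B_add)

lemma B_expand: "B X Y = (\<Sum>a\<in>UNIV. X $ a * B (axis a 1) Y)"
  by (subst vec_basis[of X]) (simp add: B_sum B_scale)

lemma B_ext: "(\<And>a. B X (axis a 1) = B Y (axis a 1)) \<Longrightarrow> X = Y"
proof -
  assume *: "\<And>a. B X (axis a 1) = B Y (axis a 1)"
  have "B (X - Y) Z = 0" for Z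
    by (subst B_sym, subst B_expand) (simp add: B_diff * B_sym[of "axis _ _"])
  from B_nondeg[OF this] show ?thesis by simp
qed

text \<open>Nondegeneracy makes the map from a vector to its scalar products with the basis
  injective, hence bijective in finite dimension. This gives existence and uniqueness for the
  description in \<open>dual_basis_def\<close>.\<close>

lemma dual_basis: "B (axis a 1) (dual_basis B b) = (if a = b then 1 else 0)"
proof -
  define L where "L X = (\<chi> a. B (axis a 1) X)" for X
  have lin: "Vector_Spaces.linear (*s) (*s) L"
    by unfold_locales (simp_all add: L_def vec_eq_iff B_add B_scale algebra_simps)
  have inj: "inj L"
  proof (rule injI)
    fix X Y assume "L X = L Y"
    then have "\<And>a. B X (axis a 1) = B Y (axis a 1)" by (simp add: L_def vec_eq_iff B_sym[of "axis _ _"])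
    then show "X = Y" by (rule B_ext)
  qed
  have "surj L" by (rule vec.linear_inj_imp_surj[OF lin inj])
  then obtain X where "L X = axis b 1" by (metis surjD)
  then have X: "\<forall>a. B (axis a 1) X = (if a = b then 1 else 0)"
    by (simp add: L_def vec_eq_iff axis_def)
  have "\<forall>a. B (axis a 1) (dual_basis B b) = (if a = b then 1 else 0)"
    unfolding dual_basis_def
  proof (rule theI[of "\<lambda>X. \<forall>a. B (axis a 1) X = (if a = b then 1 else 0)", OF X])
    fix Y assume "\<forall>a. B (axis a 1) Y = (if a = b then 1 else 0)"
    with X show "Y = X" by (intro B_ext) (simp add: B_sym[of _ "axis _ _"])
  qed
  then show ?thesis by blast
qed

text \<open>The covector \<open>u\<close> with its index raised: the vector that represents
  \<open>u\<close> through the scalar product.\<close>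

definition tovec :: "('n \<Rightarrow> 'k) \<Rightarrow> 'k ^ 'n" where "tovec u = (\<Sum>a\<in>UNIV. u a *s dual_basis B a)"

lemma B_tovec: "B (tovec u) X = (\<Sum>a\<in>UNIV. u a * X $ a)"
proof -
  have "B (dual_basis B a) X = X $ a" for a
    by (subst B_sym, subst B_expand) (simp add: dual_basis if_distrib[of "(*) _"] cong: if_cong)
  then show ?thesis by (simp add: tovec_def B_sum B_scale)
qed

lemma B_tovec_axis: "B (tovec u) (axis a 1) = u a"
  by (simp add: B_tovec axis_def if_distrib[of "(*) _"] cong: if_cong)

lemma tovec_eqI: "(\<And>a. B X (axis a 1) = u a) \<Longrightarrow> tovec u = X"
  by (rule B_ext) (simp add: B_tovec_axis)

lemma tovec_B: "tovec (\<lambda>a. B X (axis a 1)) = X"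
  by (rule tovec_eqI) simp

lemma tovec_uminus: "tovec (\<lambda>a. - u a) = - tovec u"
  by (rule tovec_eqI) (simp add: B_uminus B_tovec_axis)

lemma casimir_sym: "casimir B a b = casimir B b a"
proof -
  have "dual_basis B a $ b = B (dual_basis B b) (dual_basis B a)" for a b
    by (subst B_sym, subst B_expand)
      (simp add: B_sym[of "axis _ _"] dual_basis[unfolded B_sym[of "axis _ _"]] 
        if_distrib[of "(*) _"] cong: if_cong)
  then show ?thesis unfolding casimir_def by (metis B_sym)
qed

lemma tovec_nth: "tovec u $ b = (\<Sum>a\<in>UNIV. casimir B a b * u a)"
  by (simp add: tovec_def casimir_def mult.commute)

text \<open>The tensor as an endomorphism: the argument is turned into a covector by the scalar
  product and inserted into the first factor.\<close>

definition oper :: "('k, 'n) tensor2 \<Rightarrow> 'k ^ 'n \<Rightarrow> 'k ^ 'n" where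
  "oper s X = (\<chi> b. \<Sum>a\<in>UNIV. s a b * B X (axis a 1))"

lemma oper_tovec: "oper s (tovec u) $ b = (\<Sum>a\<in>UNIV. s a b * u a)"
  by (simp add: oper_def B_tovec_axis)

lemma contract_oper: "contract s u v = B (oper s (tovec u)) (tovec v)"
  unfolding contract_def
  by (subst B_sym, subst B_tovec, subst sum.swap)
    (simp add: oper_tovec sum_distrib_left sum_distrib_right mult_ac)

lemma oper_add: "oper s (X + Y) = oper s X + oper s Y"
  and oper_diff: "oper s (X - Y) = oper s X - oper s Y"
  and oper_uminus: "oper s (- X) = - oper s X"
  by (simp_all add: oper_def vec_eq_iff B_add B_diff B_uminus B_scale sum.distrib sum_subtractf
      sum_negf sum_distrib_left algebra_simps)

lemma oper_anti: assumes "antisym2 s" shows "B (oper s X) Y = - B X (oper s Y)"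
proof -
  have a: "s b a = - s a b" for a b by (rule assms[unfolded antisym2_def, rule_format])
  have "B (oper s (tovec u)) (tovec v) = - B (oper s (tovec v)) (tovec u)" for u v
  proof -
    have "(\<Sum>a\<in>UNIV. \<Sum>b\<in>UNIV. s a b * u a * v b) = (\<Sum>b\<in>UNIV. \<Sum>a\<in>UNIV. s a b * u a * v b)"
      by (rule sum.swap)
    also have "\<dots> = - (\<Sum>b\<in>UNIV. \<Sum>a\<in>UNIV. s b a * v b * u a)"
      unfolding sum_negf[symmetric]
    proof (intro sum.cong refl)
      fix b a show "s a b * u a * v b = - (s b a * v b * u a)" using a[of b a] by simp
    qed
    finally show ?thesis by (simp add: contract_oper[symmetric] contract_def)
  qed
  from this[of "\<lambda>a. B X (axis a 1)" "\<lambda>a. B Y (axis a 1)"]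
  show ?thesis by (simp add: tovec_B B_sym)
qed

definition tri :: "'k ^ 'n \<Rightarrow> 'k ^ 'n \<Rightarrow> 'k ^ 'n \<Rightarrow> 'k" where "tri X Y Z = B (br X Y) Z"

lemma tri_add: "tri (X + X') Y Z = tri X Y Z + tri X' Y Z" "tri X (Y + Y') Z = tri X Y Z + tri X Y' Z"
    "tri X Y (Z + Z') = tri X Y Z + tri X Y Z'"
  and tri_diff: "tri (X - X') Y Z = tri X Y Z - tri X' Y Z" "tri X (Y - Y') Z = tri X Y Z - tri X Y' Z"
    "tri X Y (Z - Z') = tri X Y Z - tri X Y Z'"
  and tri_uminus: "tri (- X) Y Z = - tri X Y Z" "tri X (- Y) Z = - tri X Y Z" "tri X Y (- Z) = - tri X Y Z"
  and tri_scale: "tri (c *s X) Y Z = c * tri X Y Z" "tri X (c *s Y) Z = c * tri X Y Z"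
    "tri X Y (c *s Z) = c * tri X Y Z"
  by (simp_all add: tri_def br_add br_diff br_uminus br_scale B_add B_diff B_uminus B_scale)

lemma tri_cyc: "tri X Y Z = tri Y Z X"
  by (simp add: tri_def B_inv B_sym[of X])

lemma tri_anti: "tri X Y Z = - tri Y X Z"
  by (simp add: tri_def br_anti[of X Y] B_uminus)

lemma tri_sum: "tri (tovec u) (tovec v) (tovec w) =
    (\<Sum>c\<in>UNIV. w c * br (tovec u) (tovec v) $ c)"
  by (simp add: tri_def B_sym[of _ "tovec w"] B_tovec)

section \<open>Three-tensors contracted with covectors\<close>

definition contract3 :: "('k, 'n) tensor3 \<Rightarrow> ('n \<Rightarrow> 'k) \<Rightarrow> ('n \<Rightarrow> 'k) \<Rightarrow> ('n \<Rightarrow> 'k) \<Rightarrow> 'k" where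
  "contract3 s u v w = (\<Sum>i\<in>UNIV. \<Sum>j\<in>UNIV. \<Sum>k\<in>UNIV. s i j k * u i * v j * w k)"

lemma contract3_cycl: "contract3 (cycl s) u v w = contract3 s u v w + contract3 s v w u + contract3 s w u v"
proof -
  have "contract3 (\<lambda>i j k. s j k i) u v w = contract3 s v w u"
    unfolding contract3_def by (rule trans[OF sum_rotate]) (simp only: mult_ac)
  moreover have "contract3 (\<lambda>i j k. s k i j) u v w = contract3 s w u v"
    unfolding contract3_def by (rule trans[OF _ sum_rotate[symmetric]]) (simp only: mult_ac)
  ultimately show ?thesis
    by (simp add: contract3_def cycl_def sum.distrib algebra_simps)
qed

text \<open>The commutator leaves the second factors of both copies of \<open>s\<close> to be
  contracted, whereas \<open>oper\<close> contracts the first; antisymmetry exchanges them and the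
  two signs cancel.\<close>

lemma contract3_comm:
  assumes "antisym2 s"
  shows "contract3 (comm_12_13 br s) u v w = tri (oper s (tovec v)) (oper s (tovec w)) (tovec u)"
proof -
  have a: "s b a = - s a b" for a b by (rule assms[unfolded antisym2_def, rule_format])
  have o: "oper s (tovec u) $ b = - (\<Sum>a\<in>UNIV. s b a * u a)" for u b
    unfolding oper_tovec sum_negf[symmetric]
  proof (intro sum.cong refl)
    fix c show "s c b * u c = - (s b c * u c)" using a[of b c] by simp
  qed
  have "tri (oper s (tovec v)) (oper s (tovec w)) (tovec u) =
    (\<Sum>i\<in>UNIV. u i * (\<Sum>a\<in>UNIV. \<Sum>c\<in>UNIV. struct_const br a c i * oper s (tovec v) $ a * oper s (tovec w) $ c))"
    by (simp only: tri_def B_sym[of _ "tovec u"] B_tovec br_expand)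
  also have "\<dots> = (\<Sum>i\<in>UNIV. \<Sum>a\<in>UNIV. \<Sum>c\<in>UNIV. \<Sum>j\<in>UNIV. \<Sum>k\<in>UNIV.
      s a j * s c k * struct_const br a c i * u i * v j * w k)"
    by (simp add: o sum_product sum_negf sum_distrib_left mult_ac)
  also have "\<dots> = (\<Sum>i\<in>UNIV. \<Sum>j\<in>UNIV. \<Sum>k\<in>UNIV. \<Sum>a\<in>UNIV. \<Sum>c\<in>UNIV.
      s a j * s c k * struct_const br a c i * u i * v j * w k)"
    by (rule sum.cong[OF refl], rule sum_rotate2)
  also have "\<dots> = contract3 (comm_12_13 br s) u v w"
    by (simp add: contract3_def comm_12_13_def sum_distrib_right)
  finally show ?thesis ..
qed

lemma contract3_f: "contract3 (f_tensor br B) u v w = tri (tovec u) (tovec v) (tovec w)"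
proof -
  have "tri (tovec u) (tovec v) (tovec w) =
    (\<Sum>c\<in>UNIV. w c * (\<Sum>a\<in>UNIV. \<Sum>b\<in>UNIV. struct_const br a b c * tovec u $ a * tovec v $ b))"
    unfolding tri_sum br_expand ..
  also have "\<dots> = (\<Sum>k\<in>UNIV. \<Sum>a\<in>UNIV. \<Sum>b\<in>UNIV. \<Sum>i\<in>UNIV. \<Sum>j\<in>UNIV.
      struct_const br a b k * dual_basis B a $ i * dual_basis B b $ j * u i * v j * w k)"
    by (simp add: tovec_nth casimir_sym[of _ _] sum_product sum_distrib_left mult_ac)
      (simp add: casimir_def mult_ac)
  also have "\<dots> = (\<Sum>k\<in>UNIV. \<Sum>i\<in>UNIV. \<Sum>j\<in>UNIV. \<Sum>a\<in>UNIV. \<Sum>b\<in>UNIV.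
      struct_const br a b k * dual_basis B a $ i * dual_basis B b $ j * u i * v j * w k)"
    by (rule sum.cong[OF refl], rule sum_rotate2)
  also have "\<dots> = contract3 (f_tensor br B) u v w"
    unfolding contract3_def f_tensor_def
    by (subst sum.swap, rule sum.cong[OF refl], subst sum.swap)
      (simp add: sum_distrib_right)
  finally show ?thesis ..
qed

end

subsection \<open>The Jacobiator of a bracket given in a frame\<close>

text \<open>The fields \<open>D i\<close> may be linearly dependent and need not commute: closure
  under commutators with constant coefficients \<open>c\<close> suffices. This admits \<lambda> and
  \<rho> side by side on each factor of the product.\<close>

locale derivations =
  fixes W :: "'p set" and S :: "('p \<Rightarrow> 'k::field) set"
    and D :: "'i::finite \<Rightarrow> ('p \<Rightarrow> 'k) \<Rightarrow> 'p \<Rightarrow> 'k"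
    and c :: "'i \<Rightarrow> 'i \<Rightarrow> 'i \<Rightarrow> 'k"
    and \<pi> :: "'i \<Rightarrow> 'i \<Rightarrow> 'p \<Rightarrow> 'k"
  assumes S_const: "(\<lambda>p. a) \<in> S"
    and S_add: "f \<in> S \<Longrightarrow> h \<in> S \<Longrightarrow> (\<lambda>p. f p + h p) \<in> S"
    and S_mult: "f \<in> S \<Longrightarrow> h \<in> S \<Longrightarrow> (\<lambda>p. f p * h p) \<in> S"
    and S_D: "f \<in> S \<Longrightarrow> D i f \<in> S"
    and S_\<pi>: "\<pi> i j \<in> S"
    and D_const: "p \<in> W \<Longrightarrow> D i (\<lambda>p. a) p = 0"
    and D_add: "f \<in> S \<Longrightarrow> h \<in> S \<Longrightarrow> p \<in> W \<Longrightarrow> D i (\<lambda>p. f p + h p) p = D i f p + D i h p"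
    and D_mult: "f \<in> S \<Longrightarrow> h \<in> S \<Longrightarrow> p \<in> W \<Longrightarrow>
      D i (\<lambda>p. f p * h p) p = f p * D i h p + h p * D i f p"
    and D_comm: "f \<in> S \<Longrightarrow> p \<in> W \<Longrightarrow>
      D i (D j f) p - D j (D i f) p = (\<Sum>k\<in>UNIV. c i j k * D k f p)"
    and \<pi>_anti: "p \<in> W \<Longrightarrow> \<pi> j i p = - \<pi> i j p"
begin

definition bracket :: "('p \<Rightarrow> 'k) \<Rightarrow> ('p \<Rightarrow> 'k) \<Rightarrow> 'p \<Rightarrow> 'k" where
  "bracket f h p = (\<Sum>i\<in>UNIV. \<Sum>j\<in>UNIV. \<pi> i j p * D i f p * D j h p)"

text \<open>The components, in the frame \<open>D\<close>, of the Hamiltonian vector of the covector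
  \<open>u\<close>.\<close>

definition sharp :: "'p \<Rightarrow> ('i \<Rightarrow> 'k) \<Rightarrow> 'i \<Rightarrow> 'k" where
  "sharp p u j = (\<Sum>i\<in>UNIV. \<pi> i j p * u i)"

text \<open>One of the three cyclic terms of the Jacobiator: the derivative of the tensor along the
  Hamiltonian vector of \<open>u\<close>, and the contribution of the noncommuting frame.\<close>

definition trivector :: "'p \<Rightarrow> ('i \<Rightarrow> 'k) \<Rightarrow> ('i \<Rightarrow> 'k) \<Rightarrow> ('i \<Rightarrow> 'k) \<Rightarrow> 'k" where
  "trivector p u v w =
    (\<Sum>i\<in>UNIV. \<Sum>j\<in>UNIV. (\<Sum>b\<in>UNIV. sharp p u b * D b (\<pi> i j) p) * v i * w j) +
    (\<Sum>b\<in>UNIV. \<Sum>d\<in>UNIV. \<Sum>e\<in>UNIV. c b d e * sharp p u b * sharp p v d * w e)"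

lemma S_sum: "(\<And>i. i \<in> I \<Longrightarrow> f i \<in> S) \<Longrightarrow> (\<lambda>p. \<Sum>i\<in>I. f i p) \<in> S"
  by (induction I rule: infinite_finite_induct) (simp_all add: S_const S_add)

lemma D_sum:
  "(\<And>i. i \<in> I \<Longrightarrow> f i \<in> S) \<Longrightarrow> p \<in> W \<Longrightarrow> D b (\<lambda>p. \<Sum>i\<in>I. f i p) p = (\<Sum>i\<in>I. D b (f i) p)"
proof (induction I rule: infinite_finite_induct)
  case (insert i I)
  then show ?case using D_add[of "f i" "\<lambda>p. \<Sum>i\<in>I. f i p" p b] by (simp add: S_sum)
qed (simp_all add: D_const)

lemma bracket_in_S: "f \<in> S \<Longrightarrow> h \<in> S \<Longrightarrow> bracket f h \<in> S"
  unfolding bracket_def[abs_def] by (intro S_sum S_mult S_\<pi> S_D)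

lemma bracket_sharp: "bracket f h p = (\<Sum>b\<in>UNIV. sharp p (\<lambda>i. D i f p) b * D b h p)"
  unfolding bracket_def sharp_def sum_distrib_right by (rule sum.swap)

lemma sharp_anti: "p \<in> W \<Longrightarrow> (\<Sum>j\<in>UNIV. \<pi> i j p * w j) = - sharp p w i"
  unfolding sharp_def sum_negf[symmetric] by (rule sum.cong[OF refl]) (simp add: \<pi>_anti[of p i])

lemma D_bracket:
  assumes hk: "h \<in> S" "k \<in> S" and p: "p \<in> W"
  shows "D b (bracket h k) p =
    (\<Sum>i\<in>UNIV. \<Sum>j\<in>UNIV. D b (\<pi> i j) p * D i h p * D j k p) -
    (\<Sum>d\<in>UNIV. sharp p (\<lambda>i. D i k p) d * D b (D d h) p) +
    (\<Sum>d\<in>UNIV. sharp p (\<lambda>i. D i h p) d * D b (D d k) p)"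
proof -
  note S = S_\<pi> S_D[OF hk(1)] S_D[OF hk(2)] S_mult S_sum
  have "D b (bracket h k) p = (\<Sum>i\<in>UNIV. \<Sum>j\<in>UNIV. D b (\<lambda>p. \<pi> i j p * D i h p * D j k p) p)"
    unfolding bracket_def[abs_def]
    by (subst D_sum[OF _ p], intro S, rule sum.cong[OF refl], subst D_sum[OF _ p], intro S, rule refl)
  also have "\<dots> = (\<Sum>i\<in>UNIV. \<Sum>j\<in>UNIV. D b (\<pi> i j) p * D i h p * D j k p +
      \<pi> i j p * D j k p * D b (D i h) p + \<pi> i j p * D i h p * D b (D j k) p)"
  proof (intro sum.cong refl)
    fix i j
    have 1: "D b (\<lambda>p. \<pi> i j p * D i h p * D j k p) p = \<pi> i j p * D i h p * D b (D j k) p +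
        D j k p * D b (\<lambda>p. \<pi> i j p * D i h p) p"
      by (rule D_mult[OF S_mult[OF S_\<pi> S_D[OF hk(1)]] S_D[OF hk(2)] p])
    have 2: "D b (\<lambda>p. \<pi> i j p * D i h p) p = \<pi> i j p * D b (D i h) p + D i h p * D b (\<pi> i j) p"
      by (rule D_mult[OF S_\<pi> S_D[OF hk(1)] p])
    show "D b (\<lambda>p. \<pi> i j p * D i h p * D j k p) p = D b (\<pi> i j) p * D i h p * D j k p +
      \<pi> i j p * D j k p * D b (D i h) p + \<pi> i j p * D i h p * D b (D j k) p"
      unfolding 1 2 by (simp add: algebra_simps)
  qed
  also have "\<dots> = (\<Sum>i\<in>UNIV. \<Sum>j\<in>UNIV. D b (\<pi> i j) p * D i h p * D j k p) +
      (\<Sum>i\<in>UNIV. (\<Sum>j\<in>UNIV. \<pi> i j p * D j k p) * D b (D i h) p) +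
      (\<Sum>i\<in>UNIV. \<Sum>j\<in>UNIV. \<pi> i j p * D i h p * D b (D j k) p)"
    by (simp add: sum.distrib sum_distrib_right)
  also have "(\<Sum>i\<in>UNIV. \<Sum>j\<in>UNIV. \<pi> i j p * D i h p * D b (D j k) p) =
      (\<Sum>d\<in>UNIV. sharp p (\<lambda>i. D i h p) d * D b (D d k) p)"
    unfolding sharp_def sum_distrib_right by (rule sum.swap)
  also have "(\<Sum>i\<in>UNIV. (\<Sum>j\<in>UNIV. \<pi> i j p * D j k p) * D b (D i h) p) =
      - (\<Sum>d\<in>UNIV. sharp p (\<lambda>i. D i k p) d * D b (D d h) p)"
    by (simp add: sharp_anti[OF p] sum_negf)
  finally show ?thesis by simp
qed

text \<open>Second derivatives of each of the three functions occur twice, with opposite signs and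
  with the order of differentiation exchanged, so only commutators of frame fields survive.\<close>

lemma jacobiator:
  assumes fhk: "f \<in> S" "h \<in> S" "k \<in> S" and p: "p \<in> W"
  defines "u \<equiv> \<lambda>i. D i f p" and "v \<equiv> \<lambda>i. D i h p" and "w \<equiv> \<lambda>i. D i k p"
  shows "bracket f (bracket h k) p + bracket h (bracket k f) p + bracket k (bracket f h) p =
    trivector p u v w + trivector p v w u + trivector p w u v"
proof -
  \<comment> \<open>\<open>Q\<close> collects the second derivatives, \<open>T\<close> the
    derivatives of the tensor and \<open>C\<close> the structure constants.\<close>
  define Q where "Q x y m = (\<Sum>b\<in>UNIV. \<Sum>d\<in>UNIV. sharp p x b * sharp p y d * D b (D d m) p)" for x y m
  define T where "T x y z =
    (\<Sum>i\<in>UNIV. \<Sum>j\<in>UNIV. (\<Sum>b\<in>UNIV. sharp p x b * D b (\<pi> i j) p) * y i * z j)" for x y z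
  define C where "C x y z =
    (\<Sum>b\<in>UNIV. \<Sum>d\<in>UNIV. \<Sum>e\<in>UNIV. c b d e * sharp p x b * sharp p y d * z e)" for x y z
  have one: "bracket f (bracket h k) p = T (\<lambda>i. D i f p) (\<lambda>i. D i h p) (\<lambda>i. D i k p) -
      Q (\<lambda>i. D i f p) (\<lambda>i. D i k p) h + Q (\<lambda>i. D i f p) (\<lambda>i. D i h p) k"
    if hk: "h \<in> S" "k \<in> S" for f h k
  proof -
    have T: "T x y z = (\<Sum>b\<in>UNIV. sharp p x b * (\<Sum>i\<in>UNIV. \<Sum>j\<in>UNIV. D b (\<pi> i j) p * y i * z j))" for x y z
    proof -
      have "(\<Sum>b\<in>UNIV. sharp p x b * (\<Sum>i\<in>UNIV. \<Sum>j\<in>UNIV. D b (\<pi> i j) p * y i * z j)) =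
        (\<Sum>b\<in>UNIV. \<Sum>i\<in>UNIV. \<Sum>j\<in>UNIV. sharp p x b * D b (\<pi> i j) p * y i * z j)"
        by (simp add: sum_distrib_left mult.assoc)
      also have "\<dots> = (\<Sum>i\<in>UNIV. \<Sum>b\<in>UNIV. \<Sum>j\<in>UNIV. sharp p x b * D b (\<pi> i j) p * y i * z j)"
        by (rule sum.swap)
      also have "\<dots> = (\<Sum>i\<in>UNIV. \<Sum>j\<in>UNIV. \<Sum>b\<in>UNIV. sharp p x b * D b (\<pi> i j) p * y i * z j)"
        by (rule sum.cong[OF refl], rule sum.swap)
      finally show ?thesis by (simp add: T_def sum_distrib_right)
    qed
    show ?thesis
      unfolding bracket_sharp[of f] D_bracket[OF hk p] Q_def T
      by (simp only: distrib_left right_diff_distrib sum.distrib sum_subtractf)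
        (simp only: sum_distrib_left mult.assoc)
  qed
  have comm: "Q x y m - Q y x m = C x y (\<lambda>i. D i m p)" if m: "m \<in> S" for x y m
  proof -
    have "Q y x m = (\<Sum>b\<in>UNIV. \<Sum>d\<in>UNIV. sharp p x b * sharp p y d * D d (D b m) p)"
      unfolding Q_def by (subst sum.swap) (simp add: mult_ac)
    then have "Q x y m - Q y x m =
        (\<Sum>b\<in>UNIV. \<Sum>d\<in>UNIV. sharp p x b * sharp p y d * (D b (D d m) p - D d (D b m) p))"
      unfolding Q_def by (simp add: sum_subtractf right_diff_distrib)
    also have "\<dots> = C x y (\<lambda>i. D i m p)"
      unfolding C_def D_comm[OF m p] by (simp add: sum_distrib_left mult_ac)
    finally show ?thesis .
  qed
  have tri: "trivector p x y z = T x y z + C x y z" for x y z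
    by (simp add: trivector_def T_def C_def)
  show ?thesis
    unfolding one[OF fhk(2,3)] one[OF fhk(3,1)] one[OF fhk(1,2)] tri u_def v_def w_def
    using comm[OF fhk(1), of "\<lambda>i. D i h p" "\<lambda>i. D i k p"] comm[OF fhk(2), of "\<lambda>i. D i k p" "\<lambda>i. D i f p"]
      comm[OF fhk(3), of "\<lambda>i. D i f p" "\<lambda>i. D i h p"] by (simp add: algebra_simps)
qed

end

subsection \<open>The Jacobiator of one half of the bracket\<close>

context self_dual begin

text \<open>
  In the next two lemmas \<open>ul\<close>, \<open>ur\<close>, \<open>ug\<close> are the components of a differential along \<open>\<lambda>\<close>,
  \<open>\<rho>\<close> (on \<open>\<Omega>\<close>) and \<open>\<ell>\<close>, and \<open>s1\<close>, \<open>s2\<close>, \<open>s3\<close> those of its Hamiltonian vector; \<open>dR X Y v w\<close>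
  is \<open>(\<lambda>\<^sub>X R + \<rho>\<^sub>Y R)(v, w)\<close>. To avoid fractions, the first lemma is stated for the halves of the
  components, while \<open>xu\<close> stands for \<open>r\<close> and \<open>Ru\<close> for \<open>R(\<Omega>)\<close> applied to the full vectors.
\<close>

lemma side_identity_aux:
  assumes yb: "tri xu xv (wl - wr + wg) + tri (ul - ur + ug) xv xw + tri xu (vl - vr + vg) xw =
      - tri (ul - ur + ug) (vl - vr + vg) (wl - wr + wg)"
    and lr: "tri ul vl wl = tri ur vr wr"
  shows "(- tri (xu + ur - ug) (xv + vr - vg) wl - tri ul (xv + vr - vg) (xw + wr - wg)
      - tri (xu + ur - ug) vl (xw + wr - wg)) +
    (tri (xu + ul + ug) (xv + vl + vg) wr + tri ur (xv + vl + vg) (xw + wl + wg)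
      + tri (xu + ul + ug) vr (xw + wl + wg)) +
    (- tri (xu + ul + ur + Ru) (xv + vl + vr + Rv) wg - tri ug (xv + vl + vr + Rv) (xw + wl + wr + Rw)
      - tri (xu + ul + ur + Ru) vg (xw + wl + wr + Rw)) +
    (tri (xu + ul + ur) vg Rw + tri (xu + ul + ur) Rv wg + tri Ru (xv + vl + vr) wg +
     tri ug (xv + vl + vr) Rw + tri ug Rv (xw + wl + wr) + tri Ru vg (xw + wl + wr)) =
    - (tri Ru Rv wg + tri ug Rv Rw + tri Ru vg Rw) + tri ug vg wg"
    (is "?L = ?R")
proof -
  \<comment> \<open>Trilinear expansion cancels everything except the defect of the Yang-Baxter
    equation and the difference of the two cubic terms, and both vanish by assumption.\<close>
  have "?L - ?R = - (tri xu xv (wl - wr + wg) + tri (ul - ur + ug) xv xw + tri xu (vl - vr + vg) xw +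
      tri (ul - ur + ug) (vl - vr + vg) (wl - wr + wg)) + (tri ul vl wl - tri ur vr wr)"
    by (simp only: tri_add tri_diff tri_uminus) (simp add: algebra_simps)
  then show ?thesis using yb lr by simp
qed

lemma side_identity:
  fixes dR :: "'k ^ 'n \<Rightarrow> 'k ^ 'n \<Rightarrow> 'k ^ 'n \<Rightarrow> 'k ^ 'n \<Rightarrow> 'k"
  assumes s: "antisym2 s"
    and yb: "cycl (comm_12_13 br r) = (\<lambda>i j k. - 1 / 4 * f_tensor br B i j k)" and r: "antisym2 r"
    and dR_add: "\<And>X X' Y Y' v w. dR (X + X') (Y + Y') v w = dR X Y v w + dR X' Y' v w"
    and dR_scale: "\<And>c X Y v w. dR (c *s X) (c *s Y) v w = c * dR X Y v w"
    and dR_ad: "\<And>X v w. dR X (- X) v w = - B (oper s (br X v)) w - B (oper s v) (br X w)"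
    and dR_lr: "\<And>y z. dR ul (- ur) y z = 0" "\<And>y z. dR vl (- vr) y z = 0" "\<And>y z. dR wl (- wr) y z = 0"
    and lr: "tri ul vl wl = tri ur vr wr"
  defines "s1 \<equiv> \<lambda>l k g. oper r (l - k + g) + (1 / 2) *s (k - g)"
    and "s2 \<equiv> \<lambda>l k g. - oper r (l - k + g) - (1 / 2) *s (l + g)"
    and "s3 \<equiv> \<lambda>l k g. oper r (l - k + g) + (1 / 2) *s (l + k) + oper s g"
  defines "side \<equiv> \<lambda>ul ur ug vl vr vg wl wr wg.
      - tri (s1 ul ur ug) (s1 vl vr vg) wl + tri (s2 ul ur ug) (s2 vl vr vg) wr
      - tri (s3 ul ur ug) (s3 vl vr vg) wg + dR (s1 ul ur ug) (s2 ul ur ug) vg wg"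
  shows "side ul ur ug vl vr vg wl wr wg + side vl vr vg wl wr wg ul ur ug + side wl wr wg ul ur ug vl vr vg =
    - (tri (oper s ug) (oper s vg) wg + tri (oper s vg) (oper s wg) ug + tri (oper s wg) (oper s ug) vg)
    - 1 / 2 * (dR ug ug vg wg + dR vg vg wg ug + dR wg wg ug vg) + 1 / 4 * tri ug vg wg"
proof -
  define x where "x l k g = oper r (l - k + g)" for l k g
  \<comment> \<open>The direction of differentiation splits into three parts:
    \<open>(Y, - Y)\<close>, an infinitesimal conjugation, evaluated by equivariance; a multiple of
    \<open>(l, - k)\<close>, along which the derivative vanishes because \<open>l\<close> and
    \<open>k\<close> are the two gradients of one function; and \<open>- 1 / 2\<close> times
    \<open>(g, g)\<close>, which produces the derivative term of the dynamical equation.\<close>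
  have dR: "dR (s1 l k g) (s2 l k g) y z = tri (x l k g + (1/2) *s (l + k)) y (oper s z) +
      tri (x l k g + (1/2) *s (l + k)) (oper s y) z - 1 / 2 * dR g g y z"
    if lk: "\<And>y z. dR l (- k) y z = 0" for l k g y z
  proof -
    define Y where "Y = x l k g + (1/2) *s (l + k)"
    have e1: "s1 l k g = (Y + (-1/2) *s l) + (-1/2) *s g"
      by (simp add: s1_def Y_def x_def vec_eq_iff algebra_simps)
    have e2: "s2 l k g = (- Y + (-1/2) *s (- k)) + (-1/2) *s g"
      by (simp add: s2_def Y_def x_def vec_eq_iff algebra_simps)
    have "dR (s1 l k g) (s2 l k g) y z = dR Y (- Y) y z - 1 / 2 * dR g g y z"
      unfolding e1 e2 dR_add dR_scale lk by simp
    also have "dR Y (- Y) y z = tri Y y (oper s z) + tri Y (oper s y) z"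
    proof -
      have "B (oper s (br Y y)) z = - tri Y y (oper s z)"
        unfolding oper_anti[OF s] tri_def ..
      moreover have "B (oper s y) (br Y z) = - tri Y (oper s y) z"
        using tri_cyc[of Y z "oper s y"] tri_anti[of "oper s y" Y z] tri_cyc[of "oper s y" Y z]
        by (simp add: tri_def B_sym[of "oper s y"])
      ultimately show ?thesis by (simp add: dR_ad)
    qed
    finally show ?thesis unfolding Y_def .
  qed
  \<comment> \<open>The Yang-Baxter equation for arbitrary vectors: every vector is
    \<open>tovec\<close> of some covector, so the tensor equation can be contracted freely.\<close>
  have mYB: "tri (oper r X) (oper r Y) Z + tri (oper r Y) (oper r Z) X + tri (oper r Z) (oper r X) Y =
      - 1 / 4 * tri X Y Z" for X Y Z
  proof -
    define u v w where "u = (\<lambda>a. B X (axis a 1))" and "v = (\<lambda>a. B Y (axis a 1))" and "w = (\<lambda>a. B Z (axis a 1))"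
    have t: "tovec u = X" "tovec v = Y" "tovec w = Z" by (simp_all add: u_def v_def w_def tovec_B)
    have "contract3 (cycl (comm_12_13 br r)) u v w = - 1 / 4 * contract3 (f_tensor br B) u v w"
      unfolding yb by (simp add: contract3_def sum_distrib_left mult.assoc)
    then show ?thesis unfolding contract3_cycl contract3_comm[OF r] contract3_f t
      by (simp add: add_ac)
  qed
  define h :: "'k ^ 'n \<Rightarrow> 'k ^ 'n" where "h X = (1/2) *s X" for X
  have tri_h: "tri (h X) Y Z = 1 / 2 * tri X Y Z" "tri X (h Y) Z = 1 / 2 * tri X Y Z"
    "tri X Y (h Z) = 1 / 2 * tri X Y Z" for X Y Z by (simp_all add: h_def tri_scale)
  have h_lin: "h X - h Y + h Z = h (X - Y + Z)" for X Y Z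
    by (simp add: h_def vec_eq_iff algebra_simps)
  let ?R = "oper s"
  \<comment> \<open>Half of the Yang-Baxter identity: the resulting coefficient \<open>1/8\<close>
    is absorbed by halving all three arguments on the right.\<close>
  have yb: "tri (x ul ur ug) (x vl vr vg) (h wl - h wr + h wg) + tri (h ul - h ur + h ug) (x vl vr vg) (x wl wr wg)
      + tri (x ul ur ug) (h vl - h vr + h vg) (x wl wr wg) =
      - tri (h ul - h ur + h ug) (h vl - h vr + h vg) (h wl - h wr + h wg)"
    using mYB[of "ul - ur + ug" "vl - vr + vg" "wl - wr + wg"]
    unfolding h_lin tri_h x_def[symmetric]
      tri_cyc[of "ul - ur + ug" "x vl vr vg" "x wl wr wg"] tri_cyc[of "x wl wr wg" "x ul ur ug" "vl - vr + vg"]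
    by (simp add: add_divide_distrib[symmetric])
  have lr': "tri (h ul) (h vl) (h wl) = tri (h ur) (h vr) (h wr)" unfolding tri_h lr ..
  have side: "side ul ur ug vl vr vg wl wr wg =
      - tri (x ul ur ug + h ur - h ug) (x vl vr vg + h vr - h vg) wl
      + tri (x ul ur ug + h ul + h ug) (x vl vr vg + h vl + h vg) wr
      - tri (x ul ur ug + h ul + h ur + ?R ug) (x vl vr vg + h vl + h vr + ?R vg) wg
      + tri (x ul ur ug + h ul + h ur) vg (?R wg) + tri (x ul ur ug + h ul + h ur) (?R vg) wg
      - 1 / 2 * dR ug ug vg wg"
    if lk: "\<And>y z. dR ul (- ur) y z = 0" for ul ur ug vl vr vg wl wr wg
  proof -
    have e1: "s1 l k g = x l k g + h k - h g" for l k g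
      by (simp add: s1_def x_def h_def vec_eq_iff algebra_simps)
    have e2: "s2 l k g = - (x l k g + h l + h g)" for l k g
      by (simp add: s2_def x_def h_def vec_eq_iff algebra_simps)
    have e3: "s3 l k g = x l k g + h l + h k + ?R g" for l k g
      by (simp add: s3_def x_def h_def vec_eq_iff algebra_simps)
    have e4: "x l k g + (1/2) *s (l + k) = x l k g + h l + h k" for l k g
      by (simp add: h_def vec_eq_iff algebra_simps)
    show ?thesis
      unfolding side_def dR[OF lk] e4 unfolding e1 e2 e3 tri_uminus by simp
  qed
  note c = tri_cyc[symmetric]
  \<comment> \<open>Cyclicity of \<open>tri\<close> restores the order \<open>u\<close>,
    \<open>v\<close>, \<open>w\<close> in which the auxiliary identity is stated.\<close>
  have 2: "side vl vr vg wl wr wg ul ur ug =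
      - tri ul (x vl vr vg + h vr - h vg) (x wl wr wg + h wr - h wg)
      + tri ur (x vl vr vg + h vl + h vg) (x wl wr wg + h wl + h wg)
      - tri ug (x vl vr vg + h vl + h vr + ?R vg) (x wl wr wg + h wl + h wr + ?R wg)
      + tri (?R ug) (x vl vr vg + h vl + h vr) wg + tri ug (x vl vr vg + h vl + h vr) (?R wg)
      - 1 / 2 * dR vg vg wg ug"
    unfolding side[OF dR_lr(2)] c[of _ _ ul] c[of _ _ ur] c[of _ _ ug] c[of _ _ "?R ug"] ..
  have 3: "side wl wr wg ul ur ug vl vr vg =
      - tri (x ul ur ug + h ur - h ug) vl (x wl wr wg + h wr - h wg)
      + tri (x ul ur ug + h ul + h ug) vr (x wl wr wg + h wl + h wg)
      - tri (x ul ur ug + h ul + h ur + ?R ug) vg (x wl wr wg + h wl + h wr + ?R wg)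
      + tri ug (?R vg) (x wl wr wg + h wl + h wr) + tri (?R ug) vg (x wl wr wg + h wl + h wr)
      - 1 / 2 * dR wg wg ug vg"
    unfolding side[OF dR_lr(3)]
      tri_cyc[of "x wl wr wg + h wr - h wg"] tri_cyc[of "x wl wr wg + h wl + h wg"]
      tri_cyc[of "x wl wr wg + h wl + h wr + ?R wg"] tri_cyc[of "x wl wr wg + h wl + h wr"] ..
  have 4: "tri (?R vg) (?R wg) ug = tri ug (?R vg) (?R wg)" "tri (?R wg) (?R ug) vg = tri (?R ug) vg (?R wg)"
    by (rule c, rule tri_cyc)
  have half: "2 * (1 / 2 * z) = z" for z :: 'k by simp
  \<comment> \<open>Every term of \<open>side\<close> other than those in \<open>dR\<close> has one
    undivided component, while the auxiliary identity contains its half; hence the doubling. The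
    last term acquires \<open>2 / 8 = 1 / 4\<close>.\<close>
  note double = arg_cong[OF side_identity_aux[OF yb lr', of "?R ug" "?R vg" "?R wg", unfolded tri_h],
      of "\<lambda>z. 2 * z", unfolded distrib_left right_diff_distrib mult_minus_right half]
  have combine: "(- a1 + b1 - c1 + d1 + e1 - 1 / 2 * y1) + (- a2 + b2 - c2 + d2 + e2 - 1 / 2 * y2) +
      (- a3 + b3 - c3 + d3 + e3 - 1 / 2 * y3) = - (p1 + p2 + p3) - 1 / 2 * (y1 + y2 + y3) + 1 / 4 * q"
    if "(- a1 - a2 - a3) + (b1 + b2 + b3) + (- c1 - c2 - c3) + (d1 + e1 + d2 + e2 + d3 + e3) =
      - p1 + - p2 + - p3 + 1 / 2 * (1 / 2 * q)"
    for a1 b1 c1 d1 e1 y1 a2 b2 c2 d2 e2 y2 a3 b3 c3 d3 e3 y3 p1 p2 p3 q :: 'k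
  proof -
    have "(- a1 + b1 - c1 + d1 + e1 - 1 / 2 * y1) + (- a2 + b2 - c2 + d2 + e2 - 1 / 2 * y2) +
      (- a3 + b3 - c3 + d3 + e3 - 1 / 2 * y3) =
      ((- a1 - a2 - a3) + (b1 + b2 + b3) + (- c1 - c2 - c3) + (d1 + e1 + d2 + e2 + d3 + e3))
      - 1 / 2 * (y1 + y2 + y3)"
      by (simp add: algebra_simps add_divide_distrib)
    then show ?thesis unfolding that by (simp add: algebra_simps)
  qed
  show ?thesis unfolding side[OF dR_lr(1)] 2 3 4
    by (rule combine) (use double in \<open>simp only: distrib_left mult_minus_right half minus_add_distrib\<close>)
qed

end

subsection \<open>The adjoint action\<close>

context lie begin

lemma carrier_open: "openin tG cG" using openin_topspace[of tG] by simp

text \<open>Some one-parameter subgroup has the same coordinate velocity at the identity as the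
  conjugated one, and by \<open>curve_derivative\<close> this equality passes to all
  functions.\<close>

lemma Ad_exists:
  assumes q: "q \<in> cG"
  shows "\<exists>Y. \<forall>W f. openin tG W \<and> e0 \<in> W \<and> smooth_function aG W f \<longrightarrow>
     deriv (\<lambda>t. f (ex (t *s Y))) 0 = deriv (\<lambda>t. f (q \<cdot> ex (t *s X) \<cdot> minv q)) 0"
proof -
  obtain U \<phi> where U: "(U, \<phi>) \<in> aG" "e0 \<in> U"
    using smooth_atlas_cover[OF atlas, of e0] by auto
  have \<Psi>: "smooth_map euclidean stdc tG aG (\<lambda>Y. q \<cdot> ex Y \<cdot> minv q)"
    by (intro smooth_mult smooth_constG smooth_atlas_euclidean exp_smooth q inv_closed)
  obtain Y where "(\<chi> i. rho G Y (\<lambda>g. \<phi> g $ i) e0) = (\<chi> i. deriv (\<lambda>t. \<phi> (q \<cdot> ex (t *s X) \<cdot> minv q) $ i) 0)"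
    using surjD[OF bij_is_surj[OF chart_bij[OF U]]] by metis
  then have Y: "deriv (\<lambda>t. \<phi> (ex (t *s Y)) $ i) 0 = deriv (\<lambda>t. \<phi> (q \<cdot> ex (t *s X) \<cdot> minv q) $ i) 0" for i
    by (simp add: vec_eq_iff rho_one)
  show ?thesis
  proof (intro exI[of _ Y] allI impI, elim conjE)
    fix W f assume W: "openin tG W" "e0 \<in> W" "smooth_function aG W f"
    show "deriv (\<lambda>t. f (ex (t *s Y))) 0 = deriv (\<lambda>t. f (q \<cdot> ex (t *s X) \<cdot> minv q)) 0"
      using curve_derivative[OF exp_smooth W(1,3) U(1), of Y] curve_derivative[OF \<Psi> W(1,3) U(1), of X]
        U W(2) q Y by simp
  qed
qed

text \<open>Uniqueness, tested on the functions of \<open>identity_frame\<close>, turns the definite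
  description of \<open>Ad\<close> into its defining property.\<close>

lemma Ad_deriv:
  assumes q: "q \<in> cG" and W: "openin tG W" "e0 \<in> W" "smooth_function aG W f"
  shows "rho G (Ad G q X) f e0 = deriv (\<lambda>t. f (q \<cdot> ex (t *s X) \<cdot> minv q)) 0"
proof -
  let ?P = "\<lambda>Y. \<forall>W f. openin tG W \<and> e0 \<in> W \<and> smooth_function aG W f \<longrightarrow>
     deriv (\<lambda>t. f (ex (t *s Y))) 0 = deriv (\<lambda>t. f (q \<cdot> ex (t *s X) \<cdot> minv q)) 0"
  obtain Y where Y: "?P Y" using Ad_exists[OF q] by blast
  have uniq: "Z = Y" if Z: "?P Z" for Z
  proof -
    obtain V f where V: "openin tG V" "e0 \<in> V" "\<And>a. smooth_function aG V (f a)"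
      "\<And>X a. rho G X (f a) e0 = X $ a" by (rule identity_frame) blast
    have "Z $ a = Y $ a" for a
      using Y[rule_format, of V "f a"] Z[rule_format, of V "f a"] V(1-3) V(4)[of Z a] V(4)[of Y a]
      by (simp add: rho_one)
    then show ?thesis by (simp add: vec_eq_iff)
  qed
  have "Ad G q X = Y" unfolding Ad_def by (rule the_equality[of ?P, OF Y uniq])
  then show ?thesis using Y[rule_format, of W f] W by (simp add: rho_one)
qed

lemma Ad_nth:
  assumes q: "q \<in> cG" and W: "openin tG W" "e0 \<in> W" "\<And>a. smooth_function aG W (f a)"
    "\<And>X a. rho G X (f a) e0 = X $ a"
  shows "Ad G q X $ a = deriv (\<lambda>t. f a (q \<cdot> ex (t *s X) \<cdot> minv q)) 0"
  using Ad_deriv[OF q W(1,2) W(3)[of a], of X] W(4)[of "Ad G q X" a] by simp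

lemma Ad_linear:
  assumes q: "q \<in> cG"
  shows "Ad G q X $ i = (\<Sum>a\<in>UNIV. Ad_matrix G q i a * X $ a)"
proof -
  obtain V f where V: "openin tG V" "e0 \<in> V" "\<And>a. smooth_function aG V (f a)"
    "\<And>X a. rho G X (f a) e0 = X $ a" by (rule identity_frame) blast
  interpret P: parametrised_map tG aG tG aG "\<lambda>z. q \<cdot> ex (fst z) \<cdot> minv q" by (rule conj_param[OF q])
  have "P.dirderiv X (f i) e0 = (\<Sum>a\<in>UNIV. X $ a * P.dirderiv (axis a 1) (f i) e0)"
    by (rule P.dirderiv_linear[OF V(1) V(3)]) (use q V(2) in simp_all)
  moreover have "P.dirderiv X (f i) e0 = Ad G q X $ i" for X
    unfolding P.dirderiv_def fst_conv by (rule Ad_nth[OF q V, symmetric])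
  ultimately show ?thesis by (simp only: Ad_matrix_def mult.commute)
qed

lemma Ad_one: "Ad G e0 X = X"
proof -
  obtain V f where V: "openin tG V" "e0 \<in> V" "\<And>a. smooth_function aG V (f a)"
    "\<And>X a. rho G X (f a) e0 = X $ a" by (rule identity_frame) blast
  have "Ad G e0 X $ a = X $ a" for a
    unfolding Ad_nth[OF one_closed V] using V(4)[of X a] by (simp add: rho_one)
  then show ?thesis by (simp add: vec_eq_iff)
qed

lemma conj_curve_derivative:
  assumes q: "q \<in> cG" and z: "z \<in> cG" and W: "openin tG W" "z \<in> W" "smooth_function aG W f"
  shows "deriv (\<lambda>t. f (z \<cdot> (q \<cdot> ex (t *s X) \<cdot> minv q))) 0 = rho G (Ad G q X) f z"
proof -
  note pb = smooth_function_pullback[OF smooth_left_mult[OF z] W(1,3)]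
  have "rho G (Ad G q X) (\<lambda>x. f (z \<cdot> x)) e0 = deriv (\<lambda>t. f (z \<cdot> (q \<cdot> ex (t *s X) \<cdot> minv q))) 0"
    by (rule Ad_deriv[OF q pb(1) _ pb(2)]) (use z W(2) in simp)
  then show ?thesis using rho_left_translate[OF z, of e0 "Ad G q X" f] z by simp
qed

text \<open>A left translate of \<open>g\<close> is a right translate by a conjugated element:
  \<open>ex X \<cdot> g\<close> equals
  \<open>g \<cdot> (minv g \<cdot> ex X \<cdot> g)\<close>.\<close>

lemma lam_eq_rho:
  assumes W: "openin tG W" "smooth_function aG W f" and g: "g \<in> W"
  shows "lam G X f g = rho G (Ad G (minv g) X) f g"
proof -
  have gG: "g \<in> cG" using g openin_subset_carrier[OF W(1)] by blast
  have "ex (t *s X) \<cdot> g = g \<cdot> (minv g \<cdot> ex (t *s X) \<cdot> minv (minv g))" for t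
    using gG by (simp add: m_assoc[symmetric])
  then have "lam G X f g = deriv (\<lambda>t. f (g \<cdot> (minv g \<cdot> ex (t *s X) \<cdot> minv (minv g)))) 0"
    by (simp add: lam_def)
  also have "\<dots> = rho G (Ad G (minv g) X) f g"
    by (rule conj_curve_derivative[OF inv_closed[OF gG] gG W(1) g W(2)])
  finally show ?thesis .
qed

lemma smooth_Ad: "smooth_function aG cG (\<lambda>g. Ad G (minv g) X $ a)"
proof -
  obtain V f where V: "openin tG V" "e0 \<in> V" "\<And>a. smooth_function aG V (f a)"
    "\<And>X a. rho G X (f a) e0 = X $ a" by (rule identity_frame) blast
  interpret P: parametrised_map tG aG tG aG "\<lambda>z. minv (snd z) \<cdot> ex (fst z) \<cdot> snd z" by (rule conj_inv_param)
  have "smooth_function aG cG (P.dirderiv X (f a))"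
    by (rule P.smooth_dirderiv[OF V(1) V(3) carrier_open]) (use V(2) in simp)
  moreover have "P.dirderiv X (f a) g = Ad G (minv g) X $ a" if g: "g \<in> cG" for g
    unfolding Ad_nth[OF inv_closed[OF g] V] P.dirderiv_def using g by simp
  ultimately show ?thesis using smooth_function_cong[OF atlas carrier_open, of "P.dirderiv X (f a)"] by simp
qed

text \<open>Inversion of the group carries \<open>lam G X\<close> to \<open>rho G (- X)\<close>. The
  two signs disappear in the bracket, and the one from translating back remains.\<close>

lemma lam_commutator:
  assumes W: "openin tG W" "smooth_function aG W f" and g: "g \<in> W"
  shows "lam G X (lam G Y f) g - lam G Y (lam G X f) g = - lam G (br X Y) f g"
proof -
  define F where "F = (\<lambda>x. f (minv x))"
  define V where "V = {x\<in>cG. minv x \<in> W}"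
  have V: "openin tG V" "smooth_function aG V F"
    unfolding V_def F_def by (rule smooth_function_pullback[OF inv_smooth W])+
  have WG: "W \<subseteq> cG" by (rule openin_subset_carrier[OF W(1)])
  have gV: "minv g \<in> V" using g WG by (auto simp: V_def)
  have lam_rho: "lam G X (\<lambda>x. h (minv x)) x = rho G (- X) h (minv x)" if x: "x \<in> cG" for X h x
    using x by (simp add: lam_def rho_def inv_mult_group exp_uminus[symmetric])
  have lam_rho': "lam G X f x = rho G (- X) F (minv x)" if x: "x \<in> cG" for X x
  proof -
    have "lam G X f x = lam G X (\<lambda>x. F (minv x)) x"
      using x by (simp add: lam_def F_def)
    then show ?thesis by (simp only: lam_rho[OF x])
  qed
  have second: "lam G X (lam G Y f) g = rho G (- X) (rho G (- Y) F) (minv g)" for X Y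
  proof -
    have gG: "g \<in> cG" using g WG by blast
    have "lam G X (lam G Y f) g = lam G X (\<lambda>x. rho G (- Y) F (minv x)) g"
      by (rule lam_cong[OF W(1) smooth_lam[OF W] g]) (use WG in \<open>auto intro: lam_rho'\<close>)
    then show ?thesis by (simp only: lam_rho[OF gG])
  qed
  have gG: "g \<in> cG" using g WG by blast
  interpret A: lie_bracket br by unfold_locales (rule lie_algebra)
  have b: "br (- X) (- Y) = br X Y" by (simp add: A.br_uminus)
  have "lam G X (lam G Y f) g - lam G Y (lam G X f) g = rho G (br X Y) F (minv g)"
    unfolding second rho_commutator[OF V gV] b ..
  also have "\<dots> = lam G (- br X Y) f g" by (simp add: lam_rho'[OF gG])
  also have "\<dots> = - lam G (br X Y) f g"
    using lam_linear[OF W g, of "- br X Y"] lam_linear[OF W g, of "br X Y"] by (simp add: sum_negf)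
  finally show ?thesis .
qed

lemma rho_uminus:
  assumes "openin tG W" "smooth_function aG W f" "g \<in> W"
  shows "rho G (- X) f g = - rho G X f g"
  using rho_linear[OF assms, of "- X"] rho_linear[OF assms, of X] by (simp add: sum_negf)

text \<open>Conjugation is an automorphism that pulls \<rho> along \<open>X\<close> back to \<rho>
  along \<open>Ad G q X\<close>. Comparing commutators at the identity on the frame functions gives
  the claim componentwise.\<close>

lemma Ad_bracket:
  assumes q: "q \<in> cG"
  shows "Ad G q (br X Y) = br (Ad G q X) (Ad G q Y)"
proof -
  obtain V f where V: "openin tG V" "e0 \<in> V" "\<And>a. smooth_function aG V (f a)"
    "\<And>X a. rho G X (f a) e0 = X $ a" by (rule identity_frame) blast
  define c where "c x = q \<cdot> x \<cdot> minv q" for x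
  have sc: "smooth_map tG aG tG aG c"
    unfolding c_def[abs_def]
    by (intro smooth_mult smooth_constG atlas smooth_map_ident q inv_closed)
  have cG: "c x \<in> cG" if "x \<in> cG" for x using that q by (simp add: c_def)
  have c_mult: "c (x \<cdot> y) = c x \<cdot> c y" if xy: "x \<in> cG" "y \<in> cG" for x y
    using q xy by (simp add: c_def m_assoc inv_solve_left)
  have rho_c: "rho G X (\<lambda>x. h (c x)) z = rho G (Ad G q X) h (c z)"
    if h: "smooth_function aG V h" and z: "z \<in> cG" "c z \<in> V" for h z X
  proof -
    have "rho G X (\<lambda>x. h (c x)) z = deriv (\<lambda>t. h (c z \<cdot> (q \<cdot> ex (t *s X) \<cdot> minv q))) 0"
      using z by (simp add: rho_def c_mult) (simp add: c_def)
    also have "\<dots> = rho G (Ad G q X) h (c z)"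
      by (rule conj_curve_derivative[OF q cG[OF z(1)] V(1) z(2) h])
    finally show ?thesis .
  qed
  have c1: "c e0 = e0" using q by (simp add: c_def)
  have "Ad G q (br X Y) $ a = br (Ad G q X) (Ad G q Y) $ a" for a
  proof -
    define F where "F = (\<lambda>x. f a (c x))"
    define V' where "V' = {x\<in>cG. c x \<in> V}"
    have V': "openin tG V'" "smooth_function aG V' F"
      unfolding V'_def F_def by (rule smooth_function_pullback[OF sc V(1,3)])+
    have eV': "e0 \<in> V'" using V(2) by (simp add: V'_def c1)
    have second: "rho G X (rho G Y F) e0 = rho G (Ad G q X) (rho G (Ad G q Y) (f a)) e0" for X Y
    proof -
      have "rho G X (rho G Y F) e0 = rho G X (\<lambda>z. rho G (Ad G q Y) (f a) (c z)) e0"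
        by (rule rho_cong[OF V'(1) smooth_rho[OF V'] eV'])
          (simp add: F_def rho_c[OF V(3)] V'_def)
      also have "\<dots> = rho G (Ad G q X) (rho G (Ad G q Y) (f a)) (c e0)"
        by (rule rho_c[OF smooth_rho[OF V(1) V(3)]]) (simp_all add: c1 V(2))
      finally show ?thesis by (simp add: c1)
    qed
    have "rho G (br X Y) F e0 = rho G (br (Ad G q X) (Ad G q Y)) (f a) e0"
      unfolding rho_commutator[OF V' eV', symmetric] second
      by (rule rho_commutator[OF V(1) V(3) V(2)])
    moreover have "rho G (br X Y) F e0 = rho G (Ad G q (br X Y)) (f a) (c e0)"
      unfolding F_def by (rule rho_c[OF V(3)]) (simp_all add: c1 V(2))
    ultimately show ?thesis by (simp add: c1 V(4))
  qed
  then show ?thesis by (simp add: vec_eq_iff)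
qed

text \<open>Differentiate \<open>\<lambda>\<^sub>X = \<rho>\<^sub>Y\<close>, with \<open>Y\<close> the image of \<open>X\<close> under \<open>Ad\<close> of \<open>g\<close> inverse, along \<open>\<rho>\<^sub>Z\<close>, which commutes
  with \<open>\<lambda>\<^sub>X\<close>.\<close>

lemma rho_Ad:
  assumes g: "g \<in> cG"
  shows "rho G Z (\<lambda>g. Ad G (minv g) X $ b) g = br (Ad G (minv g) X) Z $ b"
proof -
  obtain V f where V: "openin tG V" "g \<in> V" "\<And>a. smooth_function aG V (f a)"
    "\<And>X a. rho G X (f a) g = X $ a" by (rule frame[OF g]) blast
  have VG: "V \<subseteq> cG" by (rule openin_subset_carrier[OF V(1)])
  have sA: "smooth_function aG V (\<lambda>g. Ad G (minv g) X $ c)" for c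
    by (rule smooth_function_subset[OF atlas carrier_open V(1) VG smooth_Ad])
  note sf = V(3)[of b]
  let ?A = "\<lambda>g. Ad G (minv g) X"
  have "rho G Z (lam G X (f b)) g = rho G Z (\<lambda>x. \<Sum>c\<in>UNIV. ?A x $ c * rho G (axis c 1) (f b) x) g"
    by (rule rho_cong[OF V(1) smooth_lam[OF V(1) sf] V(2)])
      (simp add: lam_eq_rho[OF V(1) sf] rho_linear[OF V(1) sf, where X="Ad G _ _"])
  also have "\<dots> = (\<Sum>c\<in>UNIV. rho G Z (\<lambda>x. ?A x $ c * rho G (axis c 1) (f b) x) g)"
    by (rule rho_sum[OF V(1) _ V(2)]) (rule smooth_function_mult[OF atlas V(1) sA smooth_rho[OF V(1) sf]])
  also have "\<dots> = (\<Sum>c\<in>UNIV. ?A g $ c * rho G Z (rho G (axis c 1) (f b)) g +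
      rho G (axis c 1) (f b) g * rho G Z (\<lambda>x. ?A x $ c) g)"
    by (rule sum.cong[OF refl]) (rule rho_mult[OF V(1) sA smooth_rho[OF V(1) sf] V(2)])
  also have "\<dots> = (\<Sum>c\<in>UNIV. ?A g $ c * rho G Z (rho G (axis c 1) (f b)) g) + rho G Z (\<lambda>x. ?A x $ b) g"
    by (simp add: sum.distrib V(4) axis_def if_distrib[of "\<lambda>x. x * _"] cong: if_cong)
  finally have 1: "rho G Z (lam G X (f b)) g =
      (\<Sum>c\<in>UNIV. ?A g $ c * rho G Z (rho G (axis c 1) (f b)) g) + rho G Z (\<lambda>x. ?A x $ b) g" .
  have "rho G Z (lam G X (f b)) g = lam G X (rho G Z (f b)) g"
    by (rule lam_rho_commute[OF V(1) sf V(2), symmetric])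
  also have "\<dots> = (\<Sum>c\<in>UNIV. ?A g $ c * rho G (axis c 1) (rho G Z (f b)) g)"
    unfolding lam_eq_rho[OF V(1) smooth_rho[OF V(1) sf] V(2)]
    by (rule rho_linear[OF V(1) smooth_rho[OF V(1) sf] V(2)])
  \<comment> \<open>The frame functions are normalised at \<open>g\<close> only, so their second
    derivatives remain on both sides; they combine into a commutator, which is again known at
    \<open>g\<close>.\<close>
  finally have "rho G Z (\<lambda>x. ?A x $ b) g = (\<Sum>c\<in>UNIV. ?A g $ c *
      (rho G (axis c 1) (rho G Z (f b)) g - rho G Z (rho G (axis c 1) (f b)) g))"
    unfolding 1 by (simp add: right_diff_distrib sum_subtractf algebra_simps)
  also have "\<dots> = (\<Sum>c\<in>UNIV. ?A g $ c * br (axis c 1) Z $ b)"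
    by (simp add: rho_commutator[OF V(1) sf V(2)] V(4))
  also have "\<dots> = br (?A g) Z $ b"
  proof -
    interpret A: lie_bracket br by unfold_locales (rule lie_algebra)
    show ?thesis by (subst (2) A.vec_basis[of "?A g"]) (simp add: A.br_sum_left A.br_scale)
  qed
  finally show ?thesis .
qed

end

subsection \<open>Equivariant maps\<close>

locale self_dual_group = lie G + self_dual "lie_br G" B
  for G :: "('g, 'k::{real_normed_field,euclidean_space}, 'n::finite) lie_group_data"
    and B :: "'k ^ 'n \<Rightarrow> 'k ^ 'n \<Rightarrow> 'k" +
  assumes connected: "connected_space (topol G)"
begin

lemma B_expand2: "B X Y = (\<Sum>a\<in>UNIV. \<Sum>b\<in>UNIV. X $ a * (Y $ b * B (axis a 1) (axis b 1)))"
proof -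
  have "B (axis a 1) Y = (\<Sum>b\<in>UNIV. Y $ b * B (axis a 1) (axis b 1))" for a
    by (subst B_sym, subst B_expand) (simp add: B_sym[of _ "axis a 1"])
  then show ?thesis by (subst B_expand) (simp add: sum_distrib_left)
qed

text \<open>The scalar product of \<open>Ad G (minv g) X\<close> and \<open>Ad G (minv g) Y\<close>
  has zero derivative in \<open>g\<close>, by \<open>rho_Ad\<close> and infinitesimal invariance. On
  a connected group it is constant, and at the identity it is \<open>B X Y\<close>.\<close>

lemma B_Ad:
  assumes q: "q \<in> cG"
  shows "B (Ad G q X) (Ad G q Y) = B X Y"
proof -
  let ?A = "\<lambda>g. Ad G (minv g) X" and ?A' = "\<lambda>g. Ad G (minv g) Y"
  define h where "h g = (\<Sum>a\<in>UNIV. \<Sum>b\<in>UNIV. ?A g $ a * (?A' g $ b * B (axis a 1) (axis b 1)))" for g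
  have h: "h g = B (?A g) (?A' g)" for g unfolding h_def by (rule B_expand2[symmetric])
  note s = smooth_function_mult[OF atlas carrier_open] smooth_function_sum[OF atlas carrier_open]
    smooth_function_const smooth_Ad
  have s2: "smooth_function aG cG (\<lambda>g. ?A' g $ b * B (axis a 1) (axis b 1))" for a b
    by (rule s(1)[OF smooth_Ad smooth_function_const])
  have s1: "smooth_function aG cG (\<lambda>g. ?A g $ a * (?A' g $ b * B (axis a 1) (axis b 1)))" for a b
    by (rule s(1)[OF smooth_Ad s2])
  have s0: "smooth_function aG cG (\<lambda>g. \<Sum>b\<in>UNIV. ?A g $ a * (?A' g $ b * B (axis a 1) (axis b 1)))" for a
    by (rule s(2)) (rule s1)
  have sh: "smooth_function aG cG h"
    unfolding h_def[abs_def] by (rule s(2)) (rule s0)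
  have zero: "rho G Z h g = 0" if g: "g \<in> cG" for Z g
  proof -
    have "rho G Z h g = (\<Sum>a\<in>UNIV. rho G Z (\<lambda>g. \<Sum>b\<in>UNIV. ?A g $ a * (?A' g $ b * B (axis a 1) (axis b 1))) g)"
      unfolding h_def[abs_def] by (rule rho_sum[OF carrier_open s0 g])
    also have "\<dots> = (\<Sum>a\<in>UNIV. \<Sum>b\<in>UNIV. rho G Z (\<lambda>g. ?A g $ a * (?A' g $ b * B (axis a 1) (axis b 1))) g)"
      by (rule sum.cong[OF refl]) (rule rho_sum[OF carrier_open s1 g])
    also have "\<dots> = (\<Sum>a\<in>UNIV. \<Sum>b\<in>UNIV. ?A g $ a * (br (?A' g) Z $ b * B (axis a 1) (axis b 1)) +
        br (?A g) Z $ a * (?A' g $ b * B (axis a 1) (axis b 1)))"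
    proof (intro sum.cong refl)
      fix a b
      have 1: "rho G Z (\<lambda>g. ?A g $ a * (?A' g $ b * B (axis a 1) (axis b 1))) g =
        ?A g $ a * rho G Z (\<lambda>g. ?A' g $ b * B (axis a 1) (axis b 1)) g +
        (?A' g $ b * B (axis a 1) (axis b 1)) * rho G Z (\<lambda>g. ?A g $ a) g"
        by (rule rho_mult[OF carrier_open smooth_Ad s2 g])
      have 2: "rho G Z (\<lambda>g. ?A' g $ b * B (axis a 1) (axis b 1)) g =
        br (?A' g) Z $ b * B (axis a 1) (axis b 1)"
        using rho_cmult[OF carrier_open smooth_Ad g, of Z "B (axis a 1) (axis b 1)" Y b]
        by (simp add: rho_Ad[OF g] mult.commute)
      show "rho G Z (\<lambda>g. ?A g $ a * (?A' g $ b * B (axis a 1) (axis b 1))) g =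
        ?A g $ a * (br (?A' g) Z $ b * B (axis a 1) (axis b 1)) +
        br (?A g) Z $ a * (?A' g $ b * B (axis a 1) (axis b 1))"
        unfolding 1 2 rho_Ad[OF g] by (simp only: mult.commute)
    qed
    also have "\<dots> = B (?A g) (br (?A' g) Z) + B (br (?A g) Z) (?A' g)"
      unfolding B_expand2[of "?A g"] B_expand2[of "br (?A g) Z"] by (simp add: sum.distrib)
    also have "\<dots> = 0"
      unfolding B_inv br_anti[of Z "?A' g"] B_uminus by simp
    finally show ?thesis .
  qed
  have "h (minv q) = h e0"
    by (rule constant_if_rho_zero[OF connected sh zero]) (use q in simp_all)
  then show ?thesis using q by (simp add: h Ad_one)
qed

lemma tri_Ad: "q \<in> cG \<Longrightarrow> tri (Ad G q X) (Ad G q Y) (Ad G q Z) = tri X Y Z"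
  by (simp add: tri_def Ad_bracket[symmetric] B_Ad)

lemma Ad_add: assumes "q \<in> cG" shows "Ad G q (X + Y) = Ad G q X + Ad G q Y"
  and Ad_scale: "Ad G q (c *s X) = c *s Ad G q X"
  using assms by (simp_all add: vec_eq_iff Ad_linear sum.distrib sum_distrib_left algebra_simps)

lemma surj_Ad: assumes q: "q \<in> cG" shows "surj (Ad G q)"
proof -
  have lin: "Vector_Spaces.linear (*s) (*s) (Ad G q)"
    by unfold_locales (simp_all add: Ad_add[OF q] Ad_scale[OF q] vec_eq_iff algebra_simps)
  have "inj (Ad G q)"
  proof (rule injI)
    fix X Y assume "Ad G q X = Ad G q Y"
    then have "B X Z = B Y Z" for Z using B_Ad[OF q, of X Z] B_Ad[OF q, of Y Z] by simp
    then show "X = Y" by (intro B_ext) simp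
  qed
  then show ?thesis by (rule vec.linear_inj_imp_surj[OF lin])
qed

text \<open>The differentials with respect to \<lambda> and \<rho> are related by the transpose of
  \<open>Ad\<close>. Since \<open>Ad\<close> is orthogonal for the scalar product, the raised
  differentials are related by \<open>Ad\<close> itself.\<close>

lemma tovec_rho_eq:
  assumes W: "openin tG W" "smooth_function aG W f" and g: "g \<in> W"
  shows "tovec (\<lambda>a. rho G (axis a 1) f g) = Ad G (minv g) (tovec (\<lambda>a. lam G (axis a 1) f g))"
proof -
  have q: "minv g \<in> cG" using g openin_subset_carrier[OF W(1)] by auto
  obtain Z where Z: "tovec (\<lambda>a. rho G (axis a 1) f g) = Ad G (minv g) Z"
    using surjD[OF surj_Ad[OF q]] by metis
  have "B Z (axis a 1) = lam G (axis a 1) f g" for a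
  proof -
    have "lam G (axis a 1) f g = rho G (Ad G (minv g) (axis a 1)) f g"
      by (rule lam_eq_rho[OF W g])
    also have "\<dots> = B (tovec (\<lambda>a. rho G (axis a 1) f g)) (Ad G (minv g) (axis a 1))"
      unfolding B_tovec by (subst rho_linear[OF W g]) (simp add: mult.commute)
    also have "\<dots> = B Z (axis a 1)" unfolding Z by (rule B_Ad[OF q])
    finally show ?thesis by simp
  qed
  then have "tovec (\<lambda>a. lam G (axis a 1) f g) = Z" by (rule tovec_eqI)
  then show ?thesis unfolding Z by simp
qed

text \<open>This is the identity
  \<open>C \<lambda> \<otimes> \<lambda> = C \<rho> \<otimes> \<rho>\<close> applied to
  \<open>f\<close> and \<open>h\<close>.\<close>

lemma lam_rho_tovec:
  assumes W: "openin tG W" "smooth_function aG W f" "g \<in> W"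
    and V: "openin tG V" "smooth_function aG V h" "g \<in> V"
  shows "lam G (tovec (\<lambda>a. lam G (axis a 1) f g)) h g = rho G (tovec (\<lambda>a. rho G (axis a 1) f g)) h g"
  unfolding tovec_rho_eq[OF W] by (rule lam_eq_rho[OF V])

end

locale equivariant_group = self_dual_group G B
  for G :: "('g, 'k::{real_normed_field,euclidean_space}, 'n::finite) lie_group_data"
    and B :: "'k ^ 'n \<Rightarrow> 'k ^ 'n \<Rightarrow> 'k" +
  fixes r :: "('k, 'n) tensor2" and G' :: "'g set" and R :: "'g \<Rightarrow> ('k, 'n) tensor2"
  assumes r_anti: "antisym2 r"
    and r_yb: "cycl (comm_12_13 (lie_br G) r) = (\<lambda>i j k. - 1 / 4 * f_tensor (lie_br G) B i j k)"
    and G'_open: "openin (topol G) G'" and G'_ne: "G' \<noteq> {}"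
    and G'_conj: "\<And>q \<Omega>. q \<in> carrier G \<Longrightarrow> \<Omega> \<in> G' \<Longrightarrow> q \<otimes>\<^bsub>G\<^esub> \<Omega> \<otimes>\<^bsub>G\<^esub> inv\<^bsub>G\<^esub> q \<in> G'"
    and R_smooth: "\<And>a b. smooth_function (charts G) G' (\<lambda>\<Omega>. R \<Omega> a b)"
    and R_anti: "\<And>\<Omega>. \<Omega> \<in> G' \<Longrightarrow> antisym2 (R \<Omega>)"
    and R_equi: "\<And>q \<Omega>. q \<in> carrier G \<Longrightarrow> \<Omega> \<in> G' \<Longrightarrow>
           R (q \<otimes>\<^bsub>G\<^esub> \<Omega> \<otimes>\<^bsub>G\<^esub> inv\<^bsub>G\<^esub> q) = Ad2 G q (R \<Omega>)"
begin

lemma G'_carrier: "\<Omega> \<in> G' \<Longrightarrow> \<Omega> \<in> cG"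
  using openin_subset_carrier[OF G'_open] by blast

text \<open>Obtained from the derivative of \<open>Ad G (minv g)\<close> at the identity by
  following the one-parameter subgroup backwards.\<close>

lemma has_derivative_Ad_exp:
  "((\<lambda>t. Ad_matrix G (ex (t *s X)) a c) has_field_derivative br X (axis c 1) $ a) (at 0)"
proof -
  have "((\<lambda>t. Ad G (minv (e0 \<cdot> ex (t *s (- X)))) (axis c 1) $ a) has_field_derivative
      rho G (- X) (\<lambda>g. Ad G (minv g) (axis c 1) $ a) e0) (at 0)"
    by (rule has_rho[OF carrier_open smooth_Ad]) simp
  moreover have "minv (e0 \<cdot> ex (t *s (- X))) = ex (t *s X)" for t
    by (simp add: exp_uminus[symmetric] vector_smult_rneg)
  moreover have "rho G (- X) (\<lambda>g. Ad G (minv g) (axis c 1) $ a) e0 = br X (axis c 1) $ a"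
    by (simp add: rho_Ad[OF one_closed] Ad_one br_uminus br_anti[of "axis c 1" X])
  ultimately show ?thesis by (simp add: Ad_matrix_def)
qed

text \<open>Equivariance is used at the point \<open>\<Omega> \<cdot> ex (t *s X)\<close>, whose
  conjugate by \<open>ex (t *s X)\<close> is \<open>ex (t *s X) \<cdot> \<Omega>\<close>.
  Differentiating at \<open>t = 0\<close> gives \<lambda> on one side, \<rho> and two adjoint terms
  on the other.\<close>

lemma R_infinitesimal:
  assumes \<Omega>: "\<Omega> \<in> G'"
  shows "lam G X (\<lambda>x. R x a b) \<Omega> - rho G X (\<lambda>x. R x a b) \<Omega> =
    (\<Sum>c\<in>UNIV. br X (axis c 1) $ a * R \<Omega> c b) + (\<Sum>c\<in>UNIV. br X (axis c 1) $ b * R \<Omega> a c)"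
proof -
  have \<Omega>G: "\<Omega> \<in> cG" by (rule G'_carrier[OF \<Omega>])
  let ?M = "\<lambda>t a c. Ad_matrix G (ex (t *s X)) a c"
  let ?M' = "\<lambda>a c. br X (axis c 1) $ a"
  let ?r = "\<lambda>t c d. R (\<Omega> \<cdot> ex (t *s X)) c d"
  have sum_if: "(\<Sum>d\<in>UNIV. if P then h d else 0) = (if P then (\<Sum>d\<in>UNIV. h d) else 0)"
    for P and h :: "'n \<Rightarrow> 'k" by simp
  have M0: "?M 0 a c = (if a = c then 1 else 0)" for a c
    by (simp add: Ad_matrix_def Ad_one axis_def)
  have d1: "((\<lambda>t. \<Sum>c\<in>UNIV. \<Sum>d\<in>UNIV. ?M t a c * ?M t b d * ?r t c d) has_field_derivative
     (\<Sum>c\<in>UNIV. \<Sum>d\<in>UNIV. (?M' a c * ?M 0 b d + ?M' b d * ?M 0 a c) * ?r 0 c d +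
        rho G X (\<lambda>x. R x c d) \<Omega> * (?M 0 a c * ?M 0 b d))) (at 0)"
    by (intro DERIV_sum DERIV_mult has_derivative_Ad_exp has_rho[OF G'_open R_smooth \<Omega>])
  have d2: "(\<Sum>c\<in>UNIV. \<Sum>d\<in>UNIV. (?M' a c * ?M 0 b d + ?M' b d * ?M 0 a c) * ?r 0 c d +
        rho G X (\<lambda>x. R x c d) \<Omega> * (?M 0 a c * ?M 0 b d)) =
      (\<Sum>c\<in>UNIV. ?M' a c * R \<Omega> c b) + (\<Sum>c\<in>UNIV. ?M' b c * R \<Omega> a c) + rho G X (\<lambda>x. R x a b) \<Omega>"
    unfolding M0 using \<Omega>G
    by (simp add: sum_if sum.distrib distrib_right if_distrib[of "\<lambda>x. _ * x"] if_distrib[of "\<lambda>x. x * _"]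
        cong: if_cong)
  \<comment> \<open>The shifted point lies in \<open>G'\<close> for small \<open>t\<close> because
    \<open>G'\<close> is open.\<close>
  have ev: "eventually (\<lambda>t. (\<Sum>c\<in>UNIV. \<Sum>d\<in>UNIV. ?M t a c * ?M t b d * ?r t c d) =
      R (ex (t *s X) \<cdot> \<Omega>) a b) (nhds 0)"
  proof -
    interpret P: parametrised_map tG aG tG aG "\<lambda>z. snd z \<cdot> ex (fst z)" by (rule right_param)
    have "eventually (\<lambda>t. \<Omega> \<cdot> ex (t *s X) \<in> G') (nhds 0)"
      using P.eventually_param[OF G'_open, of \<Omega> X] \<Omega> \<Omega>G by simp
    then show ?thesis
    proof (rule eventually_mono)
      fix t assume "\<Omega> \<cdot> ex (t *s X) \<in> G'"
      from R_equi[OF exp_closed this, of "t *s X"]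
      have "R (ex (t *s X) \<cdot> (\<Omega> \<cdot> ex (t *s X)) \<cdot> minv (ex (t *s X))) a b =
          Ad2 G (ex (t *s X)) (R (\<Omega> \<cdot> ex (t *s X))) a b" by simp
      moreover have "ex (t *s X) \<cdot> (\<Omega> \<cdot> ex (t *s X)) \<cdot> minv (ex (t *s X)) = ex (t *s X) \<cdot> \<Omega>"
        using \<Omega>G by (simp add: m_assoc)
      ultimately show "(\<Sum>c\<in>UNIV. \<Sum>d\<in>UNIV. ?M t a c * ?M t b d * ?r t c d) = R (ex (t *s X) \<cdot> \<Omega>) a b"
        by (simp add: Ad2_def)
    qed
  qed
  have "((\<lambda>t. R (ex (t *s X) \<cdot> \<Omega>) a b) has_field_derivative
      (\<Sum>c\<in>UNIV. ?M' a c * R \<Omega> c b) + (\<Sum>c\<in>UNIV. ?M' b c * R \<Omega> a c) + rho G X (\<lambda>x. R x a b) \<Omega>) (at 0)"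
    using d1 unfolding d2 DERIV_cong_ev[OF refl ev refl] .
  then have "lam G X (\<lambda>x. R x a b) \<Omega> =
      (\<Sum>c\<in>UNIV. ?M' a c * R \<Omega> c b) + (\<Sum>c\<in>UNIV. ?M' b c * R \<Omega> a c) + rho G X (\<lambda>x. R x a b) \<Omega>"
    unfolding lam_def by (rule DERIV_imp_deriv)
  then show ?thesis by simp
qed

section \<open>Derivatives of R contracted with vectors\<close>

definition dR :: "'g \<Rightarrow> 'k ^ 'n \<Rightarrow> 'k ^ 'n \<Rightarrow> 'k ^ 'n \<Rightarrow> 'k ^ 'n \<Rightarrow> 'k" where
  "dR \<Omega> X Y v w = (\<Sum>a\<in>UNIV. \<Sum>b\<in>UNIV.
    (lam G X (\<lambda>x. R x a b) \<Omega> + rho G Y (\<lambda>x. R x a b) \<Omega>) * B v (axis a 1) * B w (axis b 1))"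

lemma lam_R_linear: "\<Omega> \<in> G' \<Longrightarrow> lam G X (\<lambda>x. R x a b) \<Omega> = (\<Sum>c\<in>UNIV. X $ c * lam G (axis c 1) (\<lambda>x. R x a b) \<Omega>)"
  and rho_R_linear: "\<Omega> \<in> G' \<Longrightarrow> rho G X (\<lambda>x. R x a b) \<Omega> = (\<Sum>c\<in>UNIV. X $ c * rho G (axis c 1) (\<lambda>x. R x a b) \<Omega>)"
  by (rule lam_linear[OF G'_open R_smooth], assumption, rule rho_linear[OF G'_open R_smooth], assumption)

lemma lam_R_add: "\<Omega> \<in> G' \<Longrightarrow> lam G (X + Y) (\<lambda>x. R x a b) \<Omega> = lam G X (\<lambda>x. R x a b) \<Omega> + lam G Y (\<lambda>x. R x a b) \<Omega>"
  and rho_R_add: "\<Omega> \<in> G' \<Longrightarrow> rho G (X + Y) (\<lambda>x. R x a b) \<Omega> = rho G X (\<lambda>x. R x a b) \<Omega> + rho G Y (\<lambda>x. R x a b) \<Omega>"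
  and lam_R_scale: "\<Omega> \<in> G' \<Longrightarrow> lam G (c *s X) (\<lambda>x. R x a b) \<Omega> = c * lam G X (\<lambda>x. R x a b) \<Omega>"
  and rho_R_scale: "\<Omega> \<in> G' \<Longrightarrow> rho G (c *s X) (\<lambda>x. R x a b) \<Omega> = c * rho G X (\<lambda>x. R x a b) \<Omega>"
proof -
  assume \<Omega>: "\<Omega> \<in> G'"
  note l = lam_R_linear[OF \<Omega>] rho_R_linear[OF \<Omega>]
  show "lam G (X + Y) (\<lambda>x. R x a b) \<Omega> = lam G X (\<lambda>x. R x a b) \<Omega> + lam G Y (\<lambda>x. R x a b) \<Omega>"
    by (simp add: l[of "X + Y"] l[of X] l[of Y] sum.distrib distrib_right)
  show "rho G (X + Y) (\<lambda>x. R x a b) \<Omega> = rho G X (\<lambda>x. R x a b) \<Omega> + rho G Y (\<lambda>x. R x a b) \<Omega>"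
    by (simp add: l[of "X + Y"] l[of X] l[of Y] sum.distrib distrib_right)
  show "lam G (c *s X) (\<lambda>x. R x a b) \<Omega> = c * lam G X (\<lambda>x. R x a b) \<Omega>"
    by (simp add: l[of "c *s X"] l[of X] sum_distrib_left mult.assoc)
  show "rho G (c *s X) (\<lambda>x. R x a b) \<Omega> = c * rho G X (\<lambda>x. R x a b) \<Omega>"
    by (simp add: l[of "c *s X"] l[of X] sum_distrib_left mult.assoc)
qed

lemma dR_add: "\<Omega> \<in> G' \<Longrightarrow> dR \<Omega> (X + X') (Y + Y') v w = dR \<Omega> X Y v w + dR \<Omega> X' Y' v w"
  by (simp add: dR_def lam_R_add rho_R_add sum.distrib[symmetric] algebra_simps)

lemma dR_scale: "\<Omega> \<in> G' \<Longrightarrow> dR \<Omega> (c *s X) (c *s Y) v w = c * dR \<Omega> X Y v w"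
  by (simp add: dR_def lam_R_scale rho_R_scale sum_distrib_left algebra_simps)

lemma dR_ad:
  assumes \<Omega>: "\<Omega> \<in> G'"
  shows "dR \<Omega> X (- X) v w = - B (oper (R \<Omega>) (br X v)) w - B (oper (R \<Omega>) v) (br X w)"
proof -
  have rm: "rho G (- X) (\<lambda>x. R x a b) \<Omega> = - rho G X (\<lambda>x. R x a b) \<Omega>" for a b
    by (rule rho_uminus[OF G'_open R_smooth \<Omega>])
  \<comment> \<open>Invariance of the scalar product moves the adjoint action from the tensor
    indices to the vectors with which they are contracted.\<close>
  have bx: "(\<Sum>a\<in>UNIV. br X (axis c 1) $ a * B v (axis a 1)) = - B (br X v) (axis c 1)" for c v
  proof -
    have "(\<Sum>a\<in>UNIV. br X (axis c 1) $ a * B v (axis a 1)) = B v (br X (axis c 1))"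
      by (subst (2) B_sym, subst B_expand) (simp add: B_sym)
    also have "\<dots> = - B (br X v) (axis c 1)"
      by (simp add: B_inv[symmetric] br_anti[of v X] B_uminus)
    finally show ?thesis .
  qed
  have con: "B (oper s X) Y = (\<Sum>a\<in>UNIV. \<Sum>b\<in>UNIV. s a b * B X (axis a 1) * B Y (axis b 1))" for s X Y
    using contract_oper[of s "\<lambda>a. B X (axis a 1)" "\<lambda>a. B Y (axis a 1)"] by (simp add: tovec_B contract_def)
  have "dR \<Omega> X (- X) v w = (\<Sum>a\<in>UNIV. \<Sum>b\<in>UNIV.
      ((\<Sum>c\<in>UNIV. br X (axis c 1) $ a * R \<Omega> c b) + (\<Sum>c\<in>UNIV. br X (axis c 1) $ b * R \<Omega> a c)) *
        B v (axis a 1) * B w (axis b 1))"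
    unfolding dR_def rm by (simp add: R_infinitesimal[OF \<Omega>])
  also have "\<dots> = (\<Sum>a\<in>UNIV. \<Sum>b\<in>UNIV. \<Sum>c\<in>UNIV. R \<Omega> c b * (br X (axis c 1) $ a * B v (axis a 1)) * B w (axis b 1)) +
      (\<Sum>a\<in>UNIV. \<Sum>b\<in>UNIV. \<Sum>c\<in>UNIV. R \<Omega> a c * B v (axis a 1) * (br X (axis c 1) $ b * B w (axis b 1)))"
    by (simp add: algebra_simps sum.distrib sum_distrib_left sum_distrib_right)
  also have "(\<Sum>a\<in>UNIV. \<Sum>b\<in>UNIV. \<Sum>c\<in>UNIV. R \<Omega> c b * (br X (axis c 1) $ a * B v (axis a 1)) * B w (axis b 1)) =
     (\<Sum>b\<in>UNIV. \<Sum>c\<in>UNIV. R \<Omega> c b * (\<Sum>a\<in>UNIV. br X (axis c 1) $ a * B v (axis a 1)) * B w (axis b 1))"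
    by (rule trans[OF sum_rotate]) (simp add: sum_distrib_left sum_distrib_right)
  also have "\<dots> = - (\<Sum>b\<in>UNIV. \<Sum>c\<in>UNIV. R \<Omega> c b * B (br X v) (axis c 1) * B w (axis b 1))"
    unfolding bx by (simp add: sum_negf)
  also have "(\<Sum>b\<in>UNIV. \<Sum>c\<in>UNIV. R \<Omega> c b * B (br X v) (axis c 1) * B w (axis b 1)) = B (oper (R \<Omega>) (br X v)) w"
    unfolding con by (rule sum.swap)
  also have "(\<Sum>a\<in>UNIV. \<Sum>b\<in>UNIV. \<Sum>c\<in>UNIV. R \<Omega> a c * B v (axis a 1) * (br X (axis c 1) $ b * B w (axis b 1))) =
     (\<Sum>a\<in>UNIV. \<Sum>c\<in>UNIV. R \<Omega> a c * B v (axis a 1) * (\<Sum>b\<in>UNIV. br X (axis c 1) $ b * B w (axis b 1)))"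
    by (rule sum.cong[OF refl], rule trans[OF sum.swap]) (simp add: sum_distrib_left)
  also have "\<dots> = - B (oper (R \<Omega>) v) (br X w)"
    unfolding bx con by (simp add: sum_negf)
  finally show ?thesis by simp
qed

text \<open>Contracting the factor \<open>T^a\<close> in the third place with \<open>w\<close> turns
  the sum over \<open>a\<close> into one derivative in the direction \<open>tovec w\<close>.\<close>

lemma contract3_dynamical_YB:
  assumes \<Omega>: "\<Omega> \<in> G'"
  shows "contract3 (dynamical_YB G B R \<Omega>) u v w =
    (tri (oper (R \<Omega>) (tovec u)) (oper (R \<Omega>) (tovec v)) (tovec w) +
     tri (oper (R \<Omega>) (tovec v)) (oper (R \<Omega>) (tovec w)) (tovec u) +
     tri (oper (R \<Omega>) (tovec w)) (oper (R \<Omega>) (tovec u)) (tovec v)) +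
    1 / 2 * (dR \<Omega> (tovec u) (tovec u) (tovec v) (tovec w) + dR \<Omega> (tovec v) (tovec v) (tovec w) (tovec u) +
      dR \<Omega> (tovec w) (tovec w) (tovec u) (tovec v))"
proof -
  define K where "K = (\<lambda>i j k. \<Sum>a\<in>UNIV. dual_basis B a $ k *
       (rho G (axis a 1) (\<lambda>x. R x i j) \<Omega> + lam G (axis a 1) (\<lambda>x. R x i j) \<Omega>))"
  have K: "contract3 K u v w = dR \<Omega> (tovec w) (tovec w) (tovec u) (tovec v)" for u v w
  proof -
    have "(\<Sum>k\<in>UNIV. K i j k * w k) = lam G (tovec w) (\<lambda>x. R x i j) \<Omega> + rho G (tovec w) (\<lambda>x. R x i j) \<Omega>" for i j
    proof -
      have t: "tovec w $ a = (\<Sum>k\<in>UNIV. dual_basis B a $ k * w k)" for a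
        unfolding tovec_nth by (simp only: casimir_sym[of _ a]) (simp only: casimir_def)
      have "(\<Sum>k\<in>UNIV. K i j k * w k) = (\<Sum>a\<in>UNIV. tovec w $ a *
          (rho G (axis a 1) (\<lambda>x. R x i j) \<Omega> + lam G (axis a 1) (\<lambda>x. R x i j) \<Omega>))"
        unfolding t K_def sum_distrib_right by (rule trans[OF sum.swap]) (simp only: mult_ac)
      then show ?thesis
        by (simp add: lam_R_linear[OF \<Omega>, of "tovec w"] rho_R_linear[OF \<Omega>, of "tovec w"]
            sum.distrib distrib_left add.commute)
    qed
    then have k: "(\<Sum>k\<in>UNIV. K i j k * u i * v j * w k) =
      (lam G (tovec w) (\<lambda>x. R x i j) \<Omega> + rho G (tovec w) (\<lambda>x. R x i j) \<Omega>) * u i * v j" for i j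
      by (simp add: sum_distrib_left sum_distrib_right mult_ac flip: \<open>\<And>i j. (\<Sum>k\<in>UNIV. K i j k * w k) = _ i j\<close>)
    show ?thesis unfolding contract3_def k dR_def B_tovec_axis ..
  qed
  have "dynamical_YB G B R \<Omega> = cycl (\<lambda>i j k. comm_12_13 br (R \<Omega>) i j k + 1 / 2 * K i j k)"
    by (simp add: dynamical_YB_def K_def)
  moreover have "contract3 (\<lambda>i j k. comm_12_13 br (R \<Omega>) i j k + 1 / 2 * K i j k) u v w =
      contract3 (comm_12_13 br (R \<Omega>)) u v w + 1 / 2 * contract3 K u v w" for u v w
    by (simp add: contract3_def sum.distrib distrib_right sum_distrib_left)
  ultimately show ?thesis
    by (simp add: contract3_cycl contract3_comm[OF R_anti[OF \<Omega>]] K algebra_simps)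
qed

end

subsection \<open>Frames on the triple product\<close>

text \<open>The suffixes \<open>L\<close>, \<open>M\<close>, \<open>R\<close> stand for the variables \<open>\<Omega>\<^sup>L\<close>, \<open>g\<close>, \<open>\<Omega>\<^sup>R\<close>.\<close>

datatype frame = LamL | RhoL | LamM | RhoM | LamR | RhoR

lemma UNIV_frame: "UNIV = {LamL, RhoL, LamM, RhoM, LamR, RhoR}"
  using frame.exhaust by auto

instance frame :: finite
  by standard (simp add: UNIV_frame)

lemma sum_frame: "(\<Sum>s\<in>UNIV. h s) = h LamL + h RhoL + h LamM + h RhoM + h LamR + h RhoR"
  by (simp add: UNIV_frame add_ac)

lemma sum_UNIV_pair: "(\<Sum>i\<in>UNIV. h i) = (\<Sum>s\<in>UNIV. \<Sum>a\<in>UNIV. h (s, a))"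
  by (simp add: sum.cartesian_product)

text \<open>Holds without differentiability, since both functions have the same derivatives; the
  constant \<open>r\<close> can thus be split off from the coefficients \<open>r + R\<close>
  freely.\<close>

lemma deriv_add_const: "deriv (\<lambda>t. c + h t) x = deriv h x"
proof -
  have "((\<lambda>t. c + h t) has_field_derivative D) (at x) \<longleftrightarrow> (h has_field_derivative D) (at x)" for D
  proof
    assume "((\<lambda>t. c + h t) has_field_derivative D) (at x)"
    from DERIV_add[OF DERIV_const[of "- c"] this] show "(h has_field_derivative D) (at x)" by simp
  next
    assume "(h has_field_derivative D) (at x)"
    from DERIV_add[OF DERIV_const[of c] this] show "((\<lambda>t. c + h t) has_field_derivative D) (at x)" by simp
  qed
  then show ?thesis by (simp add: deriv_def)
qed

context lie begin

abbreviation tP where "tP \<equiv> prod_topology tG (prod_topology tG tG)"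
abbreviation aP where "aP \<equiv> prod_atlas aG (prod_atlas aG aG)"

lemma atlasP: "smooth_atlas tP aP"
  by (intro smooth_atlas_prod atlas)

text \<open>One map for all six flows, so that linearity, smoothness and the Leibniz rule come from
  a single instance of \<open>parametrised_map\<close>.\<close>

definition act :: "frame \<Rightarrow> ('k ^ 'n) \<times> 'g \<times> 'g \<times> 'g \<Rightarrow> 'g \<times> 'g \<times> 'g" where
  "act s w = (case w of (Y, x, y, z) \<Rightarrow> (case s of
     LamL \<Rightarrow> (ex Y \<cdot> x, y, z) | RhoL \<Rightarrow> (x \<cdot> ex Y, y, z)
   | LamM \<Rightarrow> (x, ex Y \<cdot> y, z) | RhoM \<Rightarrow> (x, y \<cdot> ex Y, z)
   | LamR \<Rightarrow> (x, y, ex Y \<cdot> z) | RhoR \<Rightarrow> (x, y, z \<cdot> ex Y)))"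

definition DD :: "frame \<Rightarrow> 'k ^ 'n \<Rightarrow> ('g \<times> 'g \<times> 'g \<Rightarrow> 'k) \<Rightarrow> 'g \<times> 'g \<times> 'g \<Rightarrow> 'k" where
  "DD s X F p = deriv (\<lambda>t. F (act s (t *s X, p))) 0"

lemma DD_slices:
  "DD LamL X F (x, y, z) = lam G X (\<lambda>x. F (x, y, z)) x"
  "DD RhoL X F (x, y, z) = rho G X (\<lambda>x. F (x, y, z)) x"
  "DD LamM X F (x, y, z) = lam G X (\<lambda>y. F (x, y, z)) y"
  "DD RhoM X F (x, y, z) = rho G X (\<lambda>y. F (x, y, z)) y"
  "DD LamR X F (x, y, z) = lam G X (\<lambda>z. F (x, y, z)) z"
  "DD RhoR X F (x, y, z) = rho G X (\<lambda>z. F (x, y, z)) z"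
  by (simp_all add: DD_def act_def lam_def rho_def)

lemma act_zero: "p \<in> cG \<times> cG \<times> cG \<Longrightarrow> act s (0, p) = p"
  by (cases s) (auto simp: act_def)

text \<open>On one factor this is the associative law for left and right translation; flows on
  different factors do not interact.\<close>

lemma act_commute:
  "s \<noteq> s' \<Longrightarrow> p \<in> cG \<times> cG \<times> cG \<Longrightarrow> act s (X, act s' (Y, p)) = act s' (Y, act s (X, p))"
  by (cases s; cases s'; auto simp: act_def m_assoc)

lemma smooth_act:
  fixes C :: "('s, 'k, 'c::finite) atlas"
  assumes C: "smooth_atlas Z C" and Y: "smooth_map Z C euclidean stdc Y" and F: "smooth_map Z C tP aP F"
  shows "smooth_map Z C tP aP (\<lambda>w. act s (Y w, F w))"
proof -
  have atlas2: "smooth_atlas (prod_topology tG tG) (prod_atlas aG aG)"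
    by (intro smooth_atlas_prod atlas)
  have x: "smooth_map Z C tG aG (\<lambda>w. fst (F w))"
    by (rule smooth_map_compose[OF C atlasP atlas F smooth_map_fst[OF atlas atlas2]])
  have yz: "smooth_map Z C (prod_topology tG tG) (prod_atlas aG aG) (\<lambda>w. snd (F w))"
    by (rule smooth_map_compose[OF C atlasP atlas2 F smooth_map_snd[OF atlas atlas2]])
  have y: "smooth_map Z C tG aG (\<lambda>w. fst (snd (F w)))"
    by (rule smooth_map_compose[OF C atlas2 atlas yz smooth_map_fst[OF atlas atlas]])
  have z: "smooth_map Z C tG aG (\<lambda>w. snd (snd (F w)))"
    by (rule smooth_map_compose[OF C atlas2 atlas yz smooth_map_snd[OF atlas atlas]])
  note e = smooth_exp[OF C Y]
  note P = smooth_map_Pair[OF C atlas atlas2 _ smooth_map_Pair[OF C atlas atlas]]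
  show ?thesis
    unfolding act_def case_prod_beta fst_conv snd_conv
    by (cases s; simp only: frame.case; rule P; intro x y z smooth_mult[OF C] e)
qed

lemma act_param: "parametrised_map tP aP tP aP (act s)"
proof
  have a: "smooth_atlas (prod_topology euclidean tP) (prod_atlas stdc aP)"
    by (intro smooth_atlas_prod smooth_atlas_euclidean atlas)
  have "smooth_map (prod_topology euclidean tP) (prod_atlas stdc aP) tP aP (\<lambda>w. act s (fst w, snd w))"
    by (rule smooth_act[OF a smooth_map_fst[OF smooth_atlas_euclidean atlasP]
          smooth_map_snd[OF smooth_atlas_euclidean atlasP]])
  then show "smooth_map (prod_topology euclidean tP) (prod_atlas stdc aP) tP aP (act s)" by simp
qed (rule atlasP)+

lemma DD_eq: "DD s X F p = parametrised_map.dirderiv (act s) X F p"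
  unfolding DD_def parametrised_map.dirderiv_def[OF act_param] ..

lemma DD_const: "DD s X (\<lambda>p. c) p = 0"
  by (simp add: DD_def)

lemma smooth_slices:
  assumes "y \<in> cG" "z \<in> cG"
  shows "smooth_map tG aG tP aP (\<lambda>x. (x, y, z))" "smooth_map tG aG tP aP (\<lambda>x. (y, x, z))"
    "smooth_map tG aG tP aP (\<lambda>x. (y, z, x))"
  by (intro smooth_map_Pair smooth_atlas_prod atlas smooth_map_ident smooth_constG assms)+

context
  fixes W F assumes W: "openin tP W" and F: "smooth_function aP W F"
begin

lemma carrierP: "p \<in> W \<Longrightarrow> p \<in> cG \<times> cG \<times> cG"
  using openin_subset[OF W] by auto

lemma base_point: "p \<in> W \<Longrightarrow> p \<in> topspace tP" "p \<in> W \<Longrightarrow> act s (0, p) \<in> W" "p \<in> W \<Longrightarrow> act s (0, p) = p"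
  using carrierP[of p] act_zero[of p s] by auto

lemma DD_linear: "p \<in> W \<Longrightarrow> DD s X F p = (\<Sum>a\<in>UNIV. X $ a * DD s (axis a 1) F p)"
  unfolding DD_eq by (rule parametrised_map.dirderiv_linear[OF act_param W F]) (rule base_point, assumption)+

lemma smooth_DD: "smooth_function aP W (DD s X F)"
  unfolding DD_eq[abs_def] by (rule parametrised_map.smooth_dirderiv[OF act_param W F W]) (rule base_point(2))

lemma DD_cong: "p \<in> W \<Longrightarrow> (\<And>q. q \<in> W \<Longrightarrow> F q = H q) \<Longrightarrow> DD s X F p = DD s X H p"
  unfolding DD_eq by (rule parametrised_map.dirderiv_cong[OF act_param W]) (simp_all add: base_point carrierP)

lemma DD_add: "smooth_function aP W H \<Longrightarrow> p \<in> W \<Longrightarrow> DD s X (\<lambda>q. F q + H q) p = DD s X F p + DD s X H p"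
  unfolding DD_eq
  by (rule parametrised_map.dirderiv_add[OF act_param W F]) (simp_all add: base_point carrierP)

lemma DD_mult: "smooth_function aP W H \<Longrightarrow> p \<in> W \<Longrightarrow>
    DD s X (\<lambda>q. F q * H q) p = F p * DD s X H p + H p * DD s X F p"
  unfolding DD_eq
  by (rule parametrised_map.dirderiv_mult[OF act_param W F]) (simp_all add: base_point carrierP)

lemma DD_commute:
  assumes "s \<noteq> s'" and p: "p \<in> W"
  shows "DD s X (DD s' Y F) p = DD s' Y (DD s X F) p"
proof -
  have C: "smooth_atlas (prod_topology euclidean euclidean) (prod_atlas stdc stdc)"
    by (intro smooth_atlas_prod smooth_atlas_euclidean)
  have pP: "p \<in> cG \<times> cG \<times> cG" by (rule carrierP[OF p])
  have m: "smooth_map (prod_topology euclidean euclidean) (prod_atlas stdc stdc) tP aP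
      (\<lambda>w. act s' (snd w, act s (fst w, p)))"
    by (intro smooth_act C smooth_map_fst smooth_map_snd smooth_atlas_euclidean
        smooth_map_const) (use pP in simp)
  have "act s' (snd (0, 0), act s (fst (0, 0), p)) \<in> W"
    using p by (simp add: act_zero[OF pP])
  from dirderiv_commute[OF atlasP m W F this, of X Y]
  show ?thesis unfolding DD_def fst_conv snd_conv act_commute[OF assms(1) pP] .
qed

end

lemma DD_commutator:
  assumes W: "openin tP W" and F: "smooth_function aP W F" and p: "p \<in> W"
  shows "DD s X (DD s Y F) p - DD s Y (DD s X F) p =
    (if s \<in> {LamL, LamM, LamR} then -1 else 1) * DD s (br X Y) F p"
proof -
  obtain x y z where pe: "p = (x, y, z)" using prod_cases3 by blast
  have c: "x \<in> cG" "y \<in> cG" "z \<in> cG" using carrierP[OF W F p] by (auto simp: pe)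
  have slice: "openin tG {x\<in>cG. J x \<in> W}" "smooth_function aG {x\<in>cG. J x \<in> W} (\<lambda>x. F (J x))"
    if J: "smooth_map tG aG tP aP J" for J
  proof -
    show o: "openin tG {x\<in>cG. J x \<in> W}"
      using openin_smooth_map_preimage[OF J W] by simp
    show "smooth_function aG {x\<in>cG. J x \<in> W} (\<lambda>x. F (J x))"
      by (rule smooth_function_compose[OF atlas atlasP J W F o]) simp
  qed
  note J = smooth_slices[OF c(2,3)] smooth_slices[OF c(1,3)] smooth_slices[OF c(1,2)]
  show ?thesis
  proof (cases s)
    case LamL then show ?thesis
      using lam_commutator[OF slice[OF J(1)], of x X Y] c p by (simp add: pe DD_slices)
  next
    case RhoL then show ?thesis
      using rho_commutator[OF slice[OF J(1)], of x X Y] c p by (simp add: pe DD_slices)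
  next
    case LamM then show ?thesis
      using lam_commutator[OF slice[OF J(5)], of y X Y] c p by (simp add: pe DD_slices)
  next
    case RhoM then show ?thesis
      using rho_commutator[OF slice[OF J(5)], of y X Y] c p by (simp add: pe DD_slices)
  next
    case LamR then show ?thesis
      using lam_commutator[OF slice[OF J(9)], of z X Y] c p by (simp add: pe DD_slices)
  next
    case RhoR then show ?thesis
      using rho_commutator[OF slice[OF J(9)], of z X Y] c p by (simp add: pe DD_slices)
  qed
qed

end

subsection \<open>The Jacobiator of the exchange bracket\<close>

lemma sum_UNIV_pair2:
  "(\<Sum>i\<in>UNIV. \<Sum>j\<in>UNIV. h i j) = (\<Sum>s\<in>UNIV. \<Sum>s'\<in>UNIV. \<Sum>a\<in>UNIV. \<Sum>b\<in>UNIV. h (s, a) (s', b))"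
  by (rule trans[OF sum_UNIV_pair], rule sum.cong[OF refl], unfold sum_UNIV_pair, rule sum.swap)

context self_dual begin

lemma oper_minus_tensor: "oper (\<lambda>a b. - s a b) X = - oper s X"
  and oper_zero_tensor: "oper (\<lambda>a b. 0) X = 0"
  and oper_add_tensor: "oper (\<lambda>a b. s a b + s' a b) X = oper s X + oper s' X"
  by (simp_all add: oper_def vec_eq_iff sum_negf sum.distrib distrib_right)

lemma oper_casimir: "(\<Sum>a\<in>UNIV. casimir B a b * B X (axis a 1)) = X $ b"
  using tovec_nth[of "\<lambda>a. B X (axis a 1)" b] by (simp add: tovec_B)

lemma oper_r_plus: "oper (r_plus B s) X = oper s X + (1 / 2) *s X"
  and oper_r_minus: "oper (r_minus B s) X = oper s X - (1 / 2) *s X"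
  using oper_casimir[of _ X]
  by (simp_all add: oper_def r_plus_def r_minus_def vec_eq_iff distrib_right left_diff_distrib
      sum.distrib sum_subtractf sum_divide_distrib[symmetric])

lemma contract_minus_tensor: "contract (\<lambda>a b. - s a b) u v = - contract s u v"
  by (simp add: contract_def sum_negf)

lemma contract_zero_tensor: "contract (\<lambda>a b. 0) u v = 0"
  by (simp add: contract_def)

lemma r_plus_transpose: "antisym2 s \<Longrightarrow> r_plus B s b a = - r_minus B s a b"
  unfolding antisym2_def r_plus_def r_minus_def
  by (erule allE[of _ a], erule allE[of _ b]) (simp add: casimir_sym[of b a])

lemma contract_r_plus_transpose:
  assumes "antisym2 s" shows "contract (r_plus B s) u v = - contract (r_minus B s) v u"
  unfolding contract_def sum_negf[symmetric]
  by (rule trans[OF sum.swap], intro sum.cong refl) (simp add: r_plus_transpose[OF assms] mult_ac)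

lemma contract3_minus: "contract3 s (\<lambda>a. - u a) (\<lambda>a. - v a) (\<lambda>a. - w a) = - contract3 s u v w"
  by (simp add: contract3_def sum_negf)

lemma contract3_axis: "contract3 s (\<lambda>a. axis i 1 $ a) (\<lambda>a. axis j 1 $ a) (\<lambda>a. axis k 1 $ a) = s i j k"
  by (simp add: contract3_def sum_axis)

lemma contract3_transform:
  "contract3 s (\<lambda>a. \<Sum>i\<in>UNIV. m i a * u i) (\<lambda>a. \<Sum>i\<in>UNIV. m i a * v i) (\<lambda>a. \<Sum>i\<in>UNIV. m i a * w i) =
   contract3 (\<lambda>i j k. \<Sum>a\<in>UNIV. \<Sum>b\<in>UNIV. \<Sum>c\<in>UNIV. m i a * m j b * m k c * s a b c) u v w"
proof -
  let ?t = "\<lambda>a b c i j k. m i a * m j b * m k c * s a b c * u i * v j * w k"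
  have "contract3 s (\<lambda>a. \<Sum>i\<in>UNIV. m i a * u i) (\<lambda>a. \<Sum>i\<in>UNIV. m i a * v i) (\<lambda>a. \<Sum>i\<in>UNIV. m i a * w i) =
    (\<Sum>a\<in>UNIV. \<Sum>b\<in>UNIV. \<Sum>c\<in>UNIV. \<Sum>i\<in>UNIV. \<Sum>j\<in>UNIV. \<Sum>k\<in>UNIV. ?t a b c i j k)"
  proof -
    have e: "s a b c * (\<Sum>i\<in>UNIV. X i) * (\<Sum>j\<in>UNIV. Y j) * (\<Sum>k\<in>UNIV. Z k) =
        (\<Sum>i\<in>UNIV. \<Sum>j\<in>UNIV. \<Sum>k\<in>UNIV. s a b c * X i * Y j * Z k)"
      for a b c and X Y Z :: "'n \<Rightarrow> 'k"
      by (simp only: sum_distrib_left[symmetric] sum_distrib_right[symmetric])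
    show ?thesis unfolding contract3_def e by (simp only: mult_ac)
  qed
  also have "\<dots> = (\<Sum>i\<in>UNIV. \<Sum>j\<in>UNIV. \<Sum>k\<in>UNIV. \<Sum>a\<in>UNIV. \<Sum>b\<in>UNIV. \<Sum>c\<in>UNIV. ?t a b c i j k)"
  proof -
    have r3: "(\<Sum>c\<in>UNIV. \<Sum>i\<in>UNIV. \<Sum>j\<in>UNIV. \<Sum>k\<in>UNIV. h c i j k) =
      (\<Sum>i\<in>UNIV. \<Sum>j\<in>UNIV. \<Sum>k\<in>UNIV. \<Sum>c\<in>UNIV. h c i j k)" for h :: "'n \<Rightarrow> 'n \<Rightarrow> 'n \<Rightarrow> 'n \<Rightarrow> 'k"
      by (rule trans[OF sum.swap], rule sum.cong[OF refl], rule sum_rotate)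
    show ?thesis
      by (subst (3) r3, subst (2) r3, subst r3, rule refl)
  qed
  finally show ?thesis
    unfolding contract3_def by (simp only: sum_distrib_right)
qed

end

text \<open>The cyclic sum is invariant under rotation, and rotations conjugate any two
  transpositions of the three indices, so antisymmetry under one of them is enough.\<close>

lemma antisym3_cycl_right:
  assumes "\<And>i j k. s i k j = - s i j k" shows "antisym3 (cycl s)"
  unfolding antisym3_def cycl_def
proof (intro allI conjI)
  fix a b c
  show "s b a c + s a c b + s c b a = - (s a b c + s b c a + s c a b)"
    using assms[of b c a] assms[of a b c] assms[of c a b] by (simp add: algebra_simps)
  show "s a c b + s c b a + s b a c = - (s a b c + s b c a + s c a b)"
    using assms[of b c a] assms[of a b c] assms[of c a b] by (simp add: algebra_simps)
qed

lemma antisym3_cycl_left: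
  assumes "\<And>i j k. s j i k = - s i j k" shows "antisym3 (cycl s)"
  unfolding antisym3_def cycl_def
proof (intro allI conjI)
  fix a b c
  show "s b a c + s a c b + s c b a = - (s a b c + s b c a + s c a b)"
    using assms[of b a c] assms[of c a b] assms[of c b a] assms[of a b c] assms[of b c a]
    by (simp add: algebra_simps)
  show "s a c b + s c b a + s b a c = - (s a b c + s b c a + s c a b)"
    using assms[of b a c] assms[of c a b] assms[of c b a] assms[of a b c] assms[of b c a]
    by (simp add: algebra_simps)
qed

lemma antisym3_add:
  assumes "antisym3 s" "antisym3 t" shows "antisym3 (\<lambda>i j k. s i j k + t i j k)"
  unfolding antisym3_def
proof (intro allI conjI)
  fix a b c
  have s: "s b a c = - s a b c" "s a c b = - s a b c"
    and t: "t b a c = - t a b c" "t a c b = - t a b c"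
    using assms unfolding antisym3_def by blast+
  show "s b a c + t b a c = - (s a b c + t a b c)" "s a c b + t a c b = - (s a b c + t a b c)"
    unfolding s t by simp_all
qed

context equivariant_group begin

text \<open>The mixed blocks coming from \<open>- Lg H F\<close> and \<open>- Rg H F\<close> are transposed by means of
  \<open>r_plus_transpose\<close>.\<close>

definition coef :: "frame \<Rightarrow> frame \<Rightarrow> 'g \<times> 'g \<times> 'g \<Rightarrow> ('k, 'n) tensor2" where
  "coef s s' p = (case s of
      LamL \<Rightarrow> (case s' of LamL \<Rightarrow> r | RhoL \<Rightarrow> (\<lambda>a b. - r_plus B r a b) | LamM \<Rightarrow> r_plus B r | _ \<Rightarrow> (\<lambda>a b. 0))
    | RhoL \<Rightarrow> (case s' of LamL \<Rightarrow> (\<lambda>a b. - r_minus B r a b) | RhoL \<Rightarrow> r | LamM \<Rightarrow> (\<lambda>a b. - r_minus B r a b)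
        | _ \<Rightarrow> (\<lambda>a b. 0))
    | LamM \<Rightarrow> (case s' of LamL \<Rightarrow> r_minus B r | RhoL \<Rightarrow> (\<lambda>a b. - r_plus B r a b)
        | LamM \<Rightarrow> (\<lambda>a b. r a b + R (fst p) a b) | _ \<Rightarrow> (\<lambda>a b. 0))
    | RhoM \<Rightarrow> (case s' of LamR \<Rightarrow> r_minus B r | RhoR \<Rightarrow> (\<lambda>a b. - r_plus B r a b)
        | RhoM \<Rightarrow> (\<lambda>a b. - (r a b + R (snd (snd p)) a b)) | _ \<Rightarrow> (\<lambda>a b. 0))
    | LamR \<Rightarrow> (case s' of LamR \<Rightarrow> (\<lambda>a b. - r a b) | RhoR \<Rightarrow> r_plus B r | RhoM \<Rightarrow> r_plus B r | _ \<Rightarrow> (\<lambda>a b. 0))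
    | RhoR \<Rightarrow> (case s' of LamR \<Rightarrow> r_minus B r | RhoR \<Rightarrow> (\<lambda>a b. - r a b) | RhoM \<Rightarrow> (\<lambda>a b. - r_minus B r a b)
        | _ \<Rightarrow> (\<lambda>a b. 0)))"

definition poisson_tensor :: "frame \<times> 'n \<Rightarrow> frame \<times> 'n \<Rightarrow> 'g \<times> 'g \<times> 'g \<Rightarrow> 'k" where
  "poisson_tensor i j p = coef (fst i) (fst j) p (snd i) (snd j)"

definition fderiv :: "frame \<times> 'n \<Rightarrow> ('g \<times> 'g \<times> 'g \<Rightarrow> 'k) \<Rightarrow> 'g \<times> 'g \<times> 'g \<Rightarrow> 'k" where
  "fderiv i F = DD (fst i) (axis (snd i) 1) F"

text \<open>The fields \<lambda> are right-invariant, and their commutators reproduce the Lie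
  bracket with the opposite sign.\<close>

definition fsgn :: "frame \<Rightarrow> 'k" where "fsgn s = (if s \<in> {LamL, LamM, LamR} then -1 else 1)"

definition fstruct :: "frame \<times> 'n \<Rightarrow> frame \<times> 'n \<Rightarrow> frame \<times> 'n \<Rightarrow> 'k" where
  "fstruct i j k = (if fst j = fst i then if fst k = fst i then
      fsgn (fst i) * struct_const br (snd i) (snd j) (snd k) else 0 else 0)"

abbreviation domain :: "('g \<times> 'g \<times> 'g) set" where "domain \<equiv> G' \<times> cG \<times> G'"

lemma domain_open: "openin tP domain"
  by (simp add: openin_prod_Times_iff G'_open carrier_open)

lemma r_flip: "r b a = - r a b" by (rule r_anti[unfolded antisym2_def, rule_format])

lemma R_flip: "\<Omega> \<in> G' \<Longrightarrow> R \<Omega> b a = - R \<Omega> a b"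
  by (rule R_anti[unfolded antisym2_def, rule_format])

lemma coef_anti:
  assumes p: "p \<in> domain" shows "coef s' s p b a = - coef s s' p a b"
proof -
  have "R (fst p) b a = - R (fst p) a b" "R (snd (snd p)) b a = - R (snd (snd p)) a b"
    using p by (auto intro: R_flip)
  then show ?thesis
    using r_flip[of b a] r_plus_transpose[OF r_anti, of b a] r_plus_transpose[OF r_anti, of a b]
    by (cases s; cases s'; simp add: coef_def)
qed

lemma smooth_coef:
  assumes W: "openin tP W" "W \<subseteq> domain"
  shows "smooth_function aP W (\<lambda>p. coef s s' p a b)"
proof -
  have a2: "smooth_atlas (prod_topology tG tG) (prod_atlas aG aG)" by (intro smooth_atlas_prod atlas)
  have RL: "smooth_function aP W (\<lambda>p. R (fst p) a b)"
    by (rule smooth_function_compose[OF atlasP atlas smooth_map_fst[OF atlas a2] G'_open R_smooth W(1)])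
      (use W(2) in auto)
  have RR: "smooth_function aP W (\<lambda>p. R (snd (snd p)) a b)"
    by (rule smooth_function_compose[OF atlasP atlas _ G'_open R_smooth W(1)])
      (use W(2) smooth_map_compose[OF atlasP a2 atlas smooth_map_snd[OF atlas a2] smooth_map_snd[OF atlas atlas]] in auto)
  have "smooth_function aP W (\<lambda>p. r a b + R (fst p) a b)"
    by (rule smooth_function_add[OF atlasP W(1) smooth_function_const RL])
  moreover have "smooth_function aP W (\<lambda>p. (- 1) * (r a b + R (snd (snd p)) a b))"
    by (rule smooth_function_mult[OF atlasP W(1) smooth_function_const
          smooth_function_add[OF atlasP W(1) smooth_function_const RR]])
  then have "smooth_function aP W (\<lambda>p. - (r a b + R (snd (snd p)) a b))" by simp
  ultimately show ?thesis
    by (cases s; cases s'; simp add: coef_def smooth_function_const del: minus_add_distrib)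
qed

lemma derivations:
  assumes W: "openin tP W" "W \<subseteq> domain"
  shows "derivations W {F. smooth_function aP W F} fderiv fstruct poisson_tensor"
proof
  fix f h :: "'g \<times> 'g \<times> 'g \<Rightarrow> 'k" and p i j
  show "(\<lambda>p. a) \<in> {F. smooth_function aP W F}" for a by (simp add: smooth_function_const)
  show "poisson_tensor i j \<in> {F. smooth_function aP W F}"
    unfolding poisson_tensor_def[abs_def] using smooth_coef[OF W] by simp
  show "fderiv i (\<lambda>p. a) p = 0" for a by (simp add: fderiv_def DD_const)
  assume f: "f \<in> {F. smooth_function aP W F}"
  then have sf: "smooth_function aP W f" by simp
  show "fderiv i f \<in> {F. smooth_function aP W F}"
    unfolding fderiv_def using smooth_DD[OF W(1) sf] by simp
  {
    assume "h \<in> {F. smooth_function aP W F}"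
    then have sh: "smooth_function aP W h" by simp
    show "(\<lambda>p. f p + h p) \<in> {F. smooth_function aP W F}"
      using smooth_function_add[OF atlasP W(1) sf sh] by simp
    show "(\<lambda>p. f p * h p) \<in> {F. smooth_function aP W F}"
      using smooth_function_mult[OF atlasP W(1) sf sh] by simp
    assume p: "p \<in> W"
    show "fderiv i (\<lambda>p. f p + h p) p = fderiv i f p + fderiv i h p"
      unfolding fderiv_def by (rule DD_add[OF W(1) sf sh p])
    show "fderiv i (\<lambda>p. f p * h p) p = f p * fderiv i h p + h p * fderiv i f p"
      unfolding fderiv_def by (rule DD_mult[OF W(1) sf sh p])
  }
  assume p: "p \<in> W"
  obtain s a s' b where ij: "i = (s, a)" "j = (s', b)" by (metis surj_pair)
  show "fderiv i (fderiv j f) p - fderiv j (fderiv i f) p = (\<Sum>k\<in>UNIV. fstruct i j k * fderiv k f p)"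
  proof (cases "s' = s")
    case False
    then show ?thesis
      using DD_commute[OF W(1) sf _ p, of s s' "axis a 1" "axis b 1"]
      by (simp add: fderiv_def[abs_def] ij fstruct_def)
  next
    case True
    have "(\<Sum>k\<in>UNIV. fstruct i j k * fderiv k f p) =
      (\<Sum>s''\<in>UNIV. if s'' = s then \<Sum>e\<in>UNIV. fsgn s * struct_const br a b e * DD s (axis e 1) f p else 0)"
      unfolding sum_UNIV_pair by (rule sum.cong[OF refl]) (simp add: fstruct_def ij True fderiv_def)
    also have "\<dots> = fsgn s * (\<Sum>e\<in>UNIV. br (axis a 1) (axis b 1) $ e * DD s (axis e 1) f p)"
      by (simp add: struct_const_def sum_distrib_left mult.assoc)
    also have "\<dots> = fsgn s * DD s (br (axis a 1) (axis b 1)) f p"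
      by (subst DD_linear[OF W(1) sf p, of s "br (axis a 1) (axis b 1)"]) (rule refl)
    finally show ?thesis
      using DD_commutator[OF W(1) sf p, of s "axis a 1" "axis b 1"]
      by (simp add: fderiv_def[abs_def] ij True fsgn_def)
  qed
next
  fix p i j assume "p \<in> W"
  then show "poisson_tensor j i p = - poisson_tensor i j p"
    unfolding poisson_tensor_def using W(2) by (intro coef_anti) auto
qed

abbreviation "pbr \<equiv> exchange_bracket G B r R"
abbreviation "YB \<equiv> dynamical_YB G B R"

lemma exchange_bracket_eq:
  "pbr F H p =
    (\<Sum>i\<in>UNIV. \<Sum>j\<in>UNIV. poisson_tensor i j p * fderiv i F p * fderiv j H p)"
proof -
  obtain x y z where p: "p = (x, y, z)" using prod_cases3 by blast
  define u v where "u s = (\<lambda>a. DD s (axis a 1) F p)" and "v s = (\<lambda>a. DD s (axis a 1) H p)" for s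
  have "(\<Sum>i\<in>UNIV. \<Sum>j\<in>UNIV. poisson_tensor i j p * fderiv i F p * fderiv j H p) =
      (\<Sum>s\<in>UNIV. \<Sum>s'\<in>UNIV. contract (coef s s' p) (u s) (v s'))"
    unfolding sum_UNIV_pair contract_def poisson_tensor_def fderiv_def u_def v_def fst_conv snd_conv
    by (rule sum.cong[OF refl], rule sum.swap)
  also have "\<dots> = pbr F H p"
    using contract_r_plus_transpose[OF r_anti, of "v LamL" "u LamM"]
      contract_r_plus_transpose[OF r_anti, of "u LamM" "v RhoL"]
      contract_r_plus_transpose[OF r_anti, of "v LamR" "u RhoM"]
      contract_r_plus_transpose[OF r_anti, of "u RhoM" "v RhoR"]
    by (simp add: sum_frame coef_def contract_minus_tensor contract_zero_tensor del: minus_add_distrib)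
      (simp add: exchange_bracket_def Let_def u_def v_def p DD_slices)
  finally show ?thesis ..
qed

lemma lam_add_const: "lam G X (\<lambda>x. c + h x) g = lam G X h g"
  and rho_add_const: "rho G X (\<lambda>x. c + h x) g = rho G X h g"
  by (simp_all only: lam_def rho_def deriv_add_const)

lemma lam_R_uminus: "\<Omega> \<in> G' \<Longrightarrow> lam G X (\<lambda>x. - (r a b + R x a b)) \<Omega> = - lam G X (\<lambda>x. R x a b) \<Omega>"
  and rho_R_uminus: "\<Omega> \<in> G' \<Longrightarrow> rho G X (\<lambda>x. - (r a b + R x a b)) \<Omega> = - rho G X (\<lambda>x. R x a b) \<Omega>"
proof -
  assume \<Omega>: "\<Omega> \<in> G'"
  have 1: "(\<lambda>x. - (r a b + R x a b)) = (\<lambda>x. - r a b + - R x a b)" by simp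
  show "lam G X (\<lambda>x. - (r a b + R x a b)) \<Omega> = - lam G X (\<lambda>x. R x a b) \<Omega>"
    unfolding 1 lam_add_const unfolding lam_def[of G X "\<lambda>x. - R x a b"]
    by (rule DERIV_imp_deriv[OF DERIV_minus[OF has_lam[OF G'_open R_smooth \<Omega>]]])
  show "rho G X (\<lambda>x. - (r a b + R x a b)) \<Omega> = - rho G X (\<lambda>x. R x a b) \<Omega>"
    unfolding 1 rho_add_const unfolding rho_def[of G X "\<lambda>x. - R x a b"]
    by (rule DERIV_imp_deriv[OF DERIV_minus[OF has_rho[OF G'_open R_smooth \<Omega>]]])
qed

lemma dR_minus: "\<Omega> \<in> G' \<Longrightarrow> dR \<Omega> (- X) (- Y) v w = - dR \<Omega> X Y v w"
  using dR_scale[of \<Omega> "- 1" X Y v w] by simp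

lemma dR_minus_right: "dR \<Omega> X Y (- v) w = - dR \<Omega> X Y v w" "dR \<Omega> X Y v (- w) = - dR \<Omega> X Y v w"
  by (simp_all add: dR_def B_uminus sum_negf)

definition sharp1 :: "'k ^ 'n \<Rightarrow> 'k ^ 'n \<Rightarrow> 'k ^ 'n \<Rightarrow> 'k ^ 'n" where
  "sharp1 l k m = oper r (l - k + m) + (1 / 2) *s (k - m)"
definition sharp2 :: "'k ^ 'n \<Rightarrow> 'k ^ 'n \<Rightarrow> 'k ^ 'n \<Rightarrow> 'k ^ 'n" where
  "sharp2 l k m = - oper r (l - k + m) - (1 / 2) *s (l + m)"
definition sharp3 :: "'g \<Rightarrow> 'k ^ 'n \<Rightarrow> 'k ^ 'n \<Rightarrow> 'k ^ 'n \<Rightarrow> 'k ^ 'n" where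
  "sharp3 \<Omega> l k m = oper r (l - k + m) + (1 / 2) *s (l + k) + oper (R \<Omega>) m"

definition side :: "'g \<Rightarrow> 'k ^ 'n \<Rightarrow> 'k ^ 'n \<Rightarrow> 'k ^ 'n \<Rightarrow> 'k ^ 'n \<Rightarrow> 'k ^ 'n \<Rightarrow> 'k ^ 'n \<Rightarrow>
    'k ^ 'n \<Rightarrow> 'k ^ 'n \<Rightarrow> 'k ^ 'n \<Rightarrow> 'k" where
  "side \<Omega> ul ur um vl vr vm wl wr wm =
      - tri (sharp1 ul ur um) (sharp1 vl vr vm) wl + tri (sharp2 ul ur um) (sharp2 vl vr vm) wr
      - tri (sharp3 \<Omega> ul ur um) (sharp3 \<Omega> vl vr vm) wm
      + dR \<Omega> (sharp1 ul ur um) (sharp2 ul ur um) vm wm"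

text \<open>The components along \<lambda> and \<rho> are gradients of actual functions of \<Omega>,
  which supplies the two relations demanded by \<open>side_identity\<close>; the middle covectors
  are left arbitrary, so that both halves can use the result.\<close>

lemma side_cyclic:
  assumes \<Omega>: "\<Omega> \<in> G'"
    and f: "openin tG U" "\<Omega> \<in> U" "smooth_function aG U f" "smooth_function aG U h" "smooth_function aG U k"
  defines "l \<equiv> \<lambda>f. tovec (\<lambda>a. lam G (axis a 1) f \<Omega>)" and "\<rho> \<equiv> \<lambda>f. tovec (\<lambda>a. rho G (axis a 1) f \<Omega>)"
  shows "side \<Omega> (l f) (\<rho> f) (tovec u) (l h) (\<rho> h) (tovec v) (l k) (\<rho> k) (tovec w) +
    side \<Omega> (l h) (\<rho> h) (tovec v) (l k) (\<rho> k) (tovec w) (l f) (\<rho> f) (tovec u) +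
    side \<Omega> (l k) (\<rho> k) (tovec w) (l f) (\<rho> f) (tovec u) (l h) (\<rho> h) (tovec v) =
    - contract3 (YB \<Omega>) u v w + 1 / 4 * tri (tovec u) (tovec v) (tovec w)"
proof -
  have \<Omega>G: "minv \<Omega> \<in> cG" using G'_carrier[OF \<Omega>] by simp
  have lr: "dR \<Omega> (l f) (- \<rho> f) y z = 0" if f: "smooth_function aG U f" for f y z
  proof -
    have "lam G (l f) (\<lambda>x. R x a b) \<Omega> + rho G (- \<rho> f) (\<lambda>x. R x a b) \<Omega> = 0" for a b
      unfolding rho_uminus[OF G'_open R_smooth \<Omega>] l_def \<rho>_def
        lam_rho_tovec[OF assms(2) f assms(3) G'_open R_smooth \<Omega>] by simp
    then show ?thesis by (simp add: dR_def)
  qed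
  have t: "tri (l f) (l h) (l k) = tri (\<rho> f) (\<rho> h) (\<rho> k)"
    unfolding l_def \<rho>_def tovec_rho_eq[OF f(1) f(3) f(2)] tovec_rho_eq[OF f(1) f(4) f(2)]
      tovec_rho_eq[OF f(1) f(5) f(2)] tri_Ad[OF \<Omega>G] ..
  show ?thesis
    unfolding side_def sharp1_def sharp2_def sharp3_def contract3_dynamical_YB[OF \<Omega>]
    by (subst side_identity[of "R \<Omega>" r "dR \<Omega>" "l f" "\<rho> f" "l h" "\<rho> h" "l k" "\<rho> k"
          "tovec u" "tovec v" "tovec w", OF R_anti[OF \<Omega>] r_yb r_anti dR_add[OF \<Omega>] dR_scale[OF \<Omega>]
          dR_ad[OF \<Omega>] lr[OF f(3)] lr[OF f(4)] lr[OF f(5)] t])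
      (simp only: minus_add_distrib diff_conv_add_uminus)
qed

section \<open>The Jacobiator on an open subset of the domain\<close>

context
  fixes W assumes W: "openin tP W" "W \<subseteq> domain"
begin

interpretation J: derivations W "{F. smooth_function aP W F}" fderiv fstruct poisson_tensor
  by (rule derivations[OF W])

lemma exchange_bracket_J: "pbr = J.bracket"
  by (intro ext) (simp only: exchange_bracket_eq J.bracket_def)

abbreviation cov :: "(frame \<times> 'n \<Rightarrow> 'k) \<Rightarrow> frame \<Rightarrow> 'k ^ 'n" where
  "cov u s \<equiv> tovec (\<lambda>a. u (s, a))"

abbreviation "left_side x u v w \<equiv> side x (cov u LamL) (cov u RhoL) (cov u LamM)
    (cov v LamL) (cov v RhoL) (cov v LamM) (cov w LamL) (cov w RhoL) (cov w LamM)"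

abbreviation "right_side z u v w \<equiv> side z (cov u LamR) (cov u RhoR) (- cov u RhoM)
    (cov v LamR) (cov v RhoR) (- cov v RhoM) (cov w LamR) (cov w RhoR) (- cov w RhoM)"

lemma sharp_coef: "(\<chi> b. J.sharp p u (s', b)) = (\<Sum>s\<in>UNIV. oper (coef s s' p) (cov u s))"
  by (simp add: vec_eq_iff J.sharp_def sum_UNIV_pair oper_tovec poisson_tensor_def)

text \<open>The right half is minus the left one with \<lambda> on \<open>g\<close> replaced by
  \<open>- \<rho>\<close>. Its components along the fields on the third variable change sign, while
  along \<open>RhoM\<close> the two signs cancel.\<close>

lemma sharp_components:
  "(\<chi> b. J.sharp p u (LamL, b)) = sharp1 (cov u LamL) (cov u RhoL) (cov u LamM)"
  "(\<chi> b. J.sharp p u (RhoL, b)) = sharp2 (cov u LamL) (cov u RhoL) (cov u LamM)"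
  "(\<chi> b. J.sharp p u (LamM, b)) = sharp3 (fst p) (cov u LamL) (cov u RhoL) (cov u LamM)"
  "(\<chi> b. J.sharp p u (LamR, b)) = - sharp1 (cov u LamR) (cov u RhoR) (- cov u RhoM)"
  "(\<chi> b. J.sharp p u (RhoR, b)) = - sharp2 (cov u LamR) (cov u RhoR) (- cov u RhoM)"
  "(\<chi> b. J.sharp p u (RhoM, b)) = sharp3 (snd (snd p)) (cov u LamR) (cov u RhoR) (- cov u RhoM)"
  unfolding sharp_coef sum_frame coef_def frame.case oper_minus_tensor oper_zero_tensor oper_add_tensor
    oper_r_plus oper_r_minus sharp1_def sharp2_def sharp3_def
  by (simp_all add: vec_eq_iff oper_add oper_diff oper_uminus algebra_simps)

text \<open>Commutators never mix the six families, so the structure constants give one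
  \<open>tri\<close> for each family. The tensor varies in two blocks only: \<open>R\<close> at
  \<open>x\<close> with derivatives in the first variable, and \<open>R\<close> at \<open>z\<close>
  with derivatives in the third. Hence the terms separate into the two halves.\<close>

lemma J_trivector:
  assumes p: "(x, y, z) \<in> W"
  shows "J.trivector (x, y, z) u v w = left_side x u v w + right_side z u v w"
proof -
  let ?p = "(x, y, z)"
  have x: "x \<in> G'" and z: "z \<in> G'" using p W(2) by auto
  define SH where "SH u s = (\<chi> b. J.sharp ?p u (s, b))" for u s
  have SHn: "J.sharp ?p u (s, b) = SH u s $ b" for u s b by (simp add: SH_def)
  have struct: "(\<Sum>b\<in>UNIV. \<Sum>d\<in>UNIV. \<Sum>e\<in>UNIV. fstruct b d e * J.sharp ?p u b * J.sharp ?p v d * w e) =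
    (\<Sum>s\<in>UNIV. fsgn s * tri (SH u s) (SH v s) (cov w s))"
  proof -
    have sum_if: "(\<Sum>d\<in>UNIV. if P then h d else 0) = (if P then (\<Sum>d\<in>UNIV. h d) else 0)"
      for P and h :: "'n \<Rightarrow> 'k" by simp
    have pair2: "(\<Sum>b\<in>UNIV. \<Sum>d\<in>UNIV. X b d) =
        (\<Sum>s\<in>UNIV. \<Sum>a\<in>UNIV. \<Sum>s'\<in>UNIV. \<Sum>b\<in>UNIV. X (s, a) (s', b))"
      for X :: "frame \<times> 'n \<Rightarrow> frame \<times> 'n \<Rightarrow> 'k"
      by (simp only: sum_UNIV_pair)
    have inner: "(\<Sum>e\<in>UNIV. fstruct (s, a) (s', b) e * c * d * w e) = (if s' = s then
        fsgn s * (\<Sum>e\<in>UNIV. struct_const br a b e * c * d * w (s, e)) else 0)" for s a s' b c d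
    proof -
      have "(\<Sum>e\<in>UNIV. fstruct (s, a) (s', b) e * c * d * w e) = (\<Sum>s''\<in>UNIV. if s'' = s then
        (\<Sum>e\<in>UNIV. if s' = s then fsgn s * struct_const br a b e * c * d * w (s, e) else 0) else 0)"
        unfolding sum_UNIV_pair
        by (rule sum.cong[OF refl], cases "s' = s") (auto simp: fstruct_def)
      then show ?thesis by (simp add: sum_distrib_left mult.assoc)
    qed
    have "(\<Sum>b\<in>UNIV. \<Sum>d\<in>UNIV. \<Sum>e\<in>UNIV. fstruct b d e * J.sharp ?p u b * J.sharp ?p v d * w e) =
      (\<Sum>s\<in>UNIV. \<Sum>a\<in>UNIV. \<Sum>s'\<in>UNIV. if s' = s then
        (\<Sum>b\<in>UNIV. fsgn s * (\<Sum>e\<in>UNIV. struct_const br a b e * SH u s $ a * SH v s $ b * w (s, e))) else 0)"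
      by (rule trans[OF pair2], unfold inner SHn, (rule sum.cong[OF refl])+) auto
    also have "\<dots> = (\<Sum>s\<in>UNIV. fsgn s * (\<Sum>a\<in>UNIV. \<Sum>b\<in>UNIV. \<Sum>e\<in>UNIV.
        struct_const br a b e * SH u s $ a * SH v s $ b * w (s, e)))"
      by (simp add: sum_distrib_left)
    also have "\<dots> = (\<Sum>s\<in>UNIV. fsgn s * tri (SH u s) (SH v s) (cov w s))"
    proof (rule sum.cong[OF refl])
      fix s
      have "tri (SH u s) (SH v s) (cov w s) = (\<Sum>e\<in>UNIV. w (s, e) *
          (\<Sum>a\<in>UNIV. \<Sum>b\<in>UNIV. struct_const br a b e * SH u s $ a * SH v s $ b))"
        by (simp only: tri_def B_sym[of _ "cov w s"] B_tovec br_expand)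
      also have "\<dots> = (\<Sum>e\<in>UNIV. \<Sum>a\<in>UNIV. \<Sum>b\<in>UNIV. struct_const br a b e * SH u s $ a * SH v s $ b * w (s, e))"
        by (simp only: sum_distrib_left) (simp only: mult_ac)
      also have "\<dots> = (\<Sum>a\<in>UNIV. \<Sum>b\<in>UNIV. \<Sum>e\<in>UNIV. struct_const br a b e * SH u s $ a * SH v s $ b * w (s, e))"
        by (rule sum_rotate)
      finally show "fsgn s * (\<Sum>a\<in>UNIV. \<Sum>b\<in>UNIV. \<Sum>e\<in>UNIV.
        struct_const br a b e * SH u s $ a * SH v s $ b * w (s, e)) = fsgn s * tri (SH u s) (SH v s) (cov w s)"
        by simp
    qed
    finally show ?thesis .
  qed
  define K where "K s s' a b = (\<Sum>c\<in>UNIV. J.sharp ?p u c * fderiv c (\<lambda>p. coef s s' p a b) ?p)" for s s' a b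
  have K0: "K s s' a b = 0" if "(s, s') \<noteq> (LamM, LamM)" "(s, s') \<noteq> (RhoM, RhoM)" for s s' a b
    using that by (cases s; cases s'; simp add: K_def coef_def fderiv_def DD_const)
  have KL: "K LamM LamM a b = lam G (SH u LamL) (\<lambda>x. R x a b) x + rho G (SH u RhoL) (\<lambda>x. R x a b) x" for a b
    by (simp add: K_def sum_UNIV_pair sum_frame fderiv_def coef_def DD_slices lam_add_const rho_add_const
        SHn lam_R_linear[OF x, of "SH u LamL"] rho_R_linear[OF x, of "SH u RhoL"])
  have KR: "K RhoM RhoM a b = - (lam G (SH u LamR) (\<lambda>x. R x a b) z + rho G (SH u RhoR) (\<lambda>x. R x a b) z)" for a b
    by (simp add: K_def sum_UNIV_pair sum_frame fderiv_def coef_def DD_slices lam_R_uminus[OF z] rho_R_uminus[OF z]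
        SHn lam_R_linear[OF z, of "SH u LamR"] rho_R_linear[OF z, of "SH u RhoR"] sum_negf
        del: minus_add_distrib)
  have "(\<Sum>i\<in>UNIV. \<Sum>j\<in>UNIV. (\<Sum>b\<in>UNIV. J.sharp ?p u b * fderiv b (poisson_tensor i j) ?p) * v i * w j) =
    (\<Sum>s\<in>UNIV. \<Sum>s'\<in>UNIV. \<Sum>a\<in>UNIV. \<Sum>b\<in>UNIV. K s s' a b * v (s, a) * w (s', b))"
  proof -
    have "poisson_tensor (s, a) (s', b) = (\<lambda>p. coef s s' p a b)" for s a s' b
      by (simp add: fun_eq_iff poisson_tensor_def)
    then show ?thesis by (simp only: K_def sum_UNIV_pair2)
  qed
  also have "\<dots> = (\<Sum>a\<in>UNIV. \<Sum>b\<in>UNIV. K LamM LamM a b * v (LamM, a) * w (LamM, b)) +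
      (\<Sum>a\<in>UNIV. \<Sum>b\<in>UNIV. K RhoM RhoM a b * v (RhoM, a) * w (RhoM, b))"
    by (simp add: sum_frame K0)
  also have "(\<Sum>a\<in>UNIV. \<Sum>b\<in>UNIV. K LamM LamM a b * v (LamM, a) * w (LamM, b)) =
      dR x (SH u LamL) (SH u RhoL) (cov v LamM) (cov w LamM)"
    by (simp add: KL dR_def B_tovec_axis)
  also have "(\<Sum>a\<in>UNIV. \<Sum>b\<in>UNIV. K RhoM RhoM a b * v (RhoM, a) * w (RhoM, b)) =
      - dR z (SH u LamR) (SH u RhoR) (cov v RhoM) (cov w RhoM)"
    by (simp add: KR dR_def B_tovec_axis sum_negf[symmetric] del: minus_add_distrib)
  finally have deriv: "(\<Sum>i\<in>UNIV. \<Sum>j\<in>UNIV. (\<Sum>b\<in>UNIV. J.sharp ?p u b * fderiv b (poisson_tensor i j) ?p) * v i * w j) =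
    dR x (SH u LamL) (SH u RhoL) (cov v LamM) (cov w LamM) - dR z (SH u LamR) (SH u RhoR) (cov v RhoM) (cov w RhoM)"
    by simp
  show ?thesis
    unfolding J.trivector_def struct deriv sum_frame side_def
    unfolding SH_def sharp_components
    by (simp add: fsgn_def tri_uminus dR_minus[OF z] dR_minus_right)
qed

text \<open>The derivatives in \<Omega> of the three functions have dropped out. Those by \<lambda>
  on \<open>g\<close> are rewritten in terms of \<rho>, which lets \<open>Ad3\<close> act on the
  tensor at \<open>x\<close> and makes the two tensors comparable.\<close>

lemma jacobiator_eq:
  assumes fhk: "smooth_function aP W f" "smooth_function aP W h" "smooth_function aP W k"
    and p: "(x, y, z) \<in> W"
  defines "\<rho> \<equiv> \<lambda>F a. DD RhoM (axis a 1) F (x, y, z)"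
  shows "J.bracket f (J.bracket h k) (x, y, z) + J.bracket h (J.bracket k f) (x, y, z) +
      J.bracket k (J.bracket f h) (x, y, z) =
    contract3 (YB z) (\<rho> f) (\<rho> h) (\<rho> k) -
    contract3 (Ad3 G (minv y) (YB x)) (\<rho> f) (\<rho> h) (\<rho> k)"
proof -
  have x: "x \<in> G'" and y: "y \<in> cG" and z: "z \<in> G'" using p W(2) by auto
  note c = G'_carrier[OF x] y G'_carrier[OF z]
  have slice: "openin tG {x\<in>cG. S x \<in> W}" "smooth_function aP W F \<Longrightarrow> smooth_function aG {x\<in>cG. S x \<in> W} (\<lambda>x. F (S x))"
    if S: "smooth_map tG aG tP aP S" for S F
  proof -
    show o: "openin tG {x\<in>cG. S x \<in> W}"
      using openin_smooth_map_preimage[OF S W(1)] by simp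
    show "smooth_function aG {x\<in>cG. S x \<in> W} (\<lambda>x. F (S x))" if F: "smooth_function aP W F"
      by (rule smooth_function_compose[OF atlas atlasP S W(1) F o]) simp
  qed
  note S = smooth_slices(1)[OF c(2,3)] smooth_slices(2)[OF c(1,3)] smooth_slices(3)[OF c(1,2)]
  let ?u = "\<lambda>F i. fderiv i F (x, y, z)"
  let ?lm = "\<lambda>F a. DD LamM (axis a 1) F (x, y, z)"
  have cov: "cov (?u F) LamL = tovec (\<lambda>a. lam G (axis a 1) (\<lambda>x. F (x, y, z)) x)"
    "cov (?u F) RhoL = tovec (\<lambda>a. rho G (axis a 1) (\<lambda>x. F (x, y, z)) x)"
    "cov (?u F) LamM = tovec (?lm F)"
    "- cov (?u F) RhoM = tovec (\<lambda>a. - \<rho> F a)"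
    "cov (?u F) LamR = tovec (\<lambda>a. lam G (axis a 1) (\<lambda>z. F (x, y, z)) z)"
    "cov (?u F) RhoR = tovec (\<lambda>a. rho G (axis a 1) (\<lambda>z. F (x, y, z)) z)" for F
    by (simp_all add: fderiv_def DD_slices tovec_uminus \<rho>_def)
  \<comment> \<open>The vector form is used for the invariant \<open>tri\<close>, the component form
    for moving \<open>Ad\<close> from the covectors to the tensor.\<close>
  have mid: "tovec (\<rho> F) = Ad G (minv y) (tovec (?lm F))"
    and mid': "?lm F a = (\<Sum>i\<in>UNIV. Ad_matrix G (minv y) i a * \<rho> F i)"
    if F: "smooth_function aP W F" for F a
  proof -
    have yW: "y \<in> {y\<in>cG. (x, y, z) \<in> W}" using p y by simp
    show "tovec (\<rho> F) = Ad G (minv y) (tovec (?lm F))"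
      unfolding \<rho>_def DD_slices by (rule tovec_rho_eq[OF slice[OF S(2)] yW]) (rule F)
    have "?lm F a = rho G (Ad G (minv y) (axis a 1)) (\<lambda>y. F (x, y, z)) y"
      unfolding DD_slices by (rule lam_eq_rho[OF slice[OF S(2)] yW]) (rule F)
    also have "\<dots> = (\<Sum>i\<in>UNIV. Ad_matrix G (minv y) i a * \<rho> F i)"
      unfolding \<rho>_def DD_slices Ad_matrix_def by (rule rho_linear[OF slice[OF S(2)] yW]) (rule F)
    finally show "?lm F a = (\<Sum>i\<in>UNIV. Ad_matrix G (minv y) i a * \<rho> F i)" .
  qed
  have L: "left_side x (?u f) (?u h) (?u k) + left_side x (?u h) (?u k) (?u f) +
      left_side x (?u k) (?u f) (?u h) =
    - contract3 (YB x) (?lm f) (?lm h) (?lm k) + 1 / 4 * tri (tovec (?lm f)) (tovec (?lm h)) (tovec (?lm k))"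
    unfolding cov
    by (rule side_cyclic[OF x slice(1)[OF S(1)] _ slice(2)[OF S(1) fhk(1)] slice(2)[OF S(1) fhk(2)]
          slice(2)[OF S(1) fhk(3)]]) (use p c in simp)
  have M: "right_side z (?u f) (?u h) (?u k) + right_side z (?u h) (?u k) (?u f) +
      right_side z (?u k) (?u f) (?u h) =
    contract3 (YB z) (\<rho> f) (\<rho> h) (\<rho> k) - 1 / 4 * tri (tovec (\<rho> f)) (tovec (\<rho> h)) (tovec (\<rho> k))"
    unfolding cov
    by (subst side_cyclic[OF z slice(1)[OF S(3)] _ slice(2)[OF S(3) fhk(1)] slice(2)[OF S(3) fhk(2)]
          slice(2)[OF S(3) fhk(3)]]) (use p c in \<open>simp_all add: contract3_minus tovec_uminus tri_uminus\<close>)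
  have "J.bracket f (J.bracket h k) (x, y, z) + J.bracket h (J.bracket k f) (x, y, z) +
      J.bracket k (J.bracket f h) (x, y, z) =
    contract3 (YB z) (\<rho> f) (\<rho> h) (\<rho> k) -
    contract3 (YB x) (?lm f) (?lm h) (?lm k) +
    1 / 4 * (tri (tovec (?lm f)) (tovec (?lm h)) (tovec (?lm k)) - tri (tovec (\<rho> f)) (tovec (\<rho> h)) (tovec (\<rho> k)))"
  proof -
    have "J.bracket f (J.bracket h k) (x, y, z) + J.bracket h (J.bracket k f) (x, y, z) +
      J.bracket k (J.bracket f h) (x, y, z) =
      J.trivector (x, y, z) (?u f) (?u h) (?u k) + J.trivector (x, y, z) (?u h) (?u k) (?u f) +
      J.trivector (x, y, z) (?u k) (?u f) (?u h)"
      by (rule J.jacobiator) (use fhk p in simp_all)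
    also have "\<dots> = (- contract3 (YB x) (?lm f) (?lm h) (?lm k) + 1 / 4 * tri (tovec (?lm f)) (tovec (?lm h)) (tovec (?lm k))) +
      (contract3 (YB z) (\<rho> f) (\<rho> h) (\<rho> k) - 1 / 4 * tri (tovec (\<rho> f)) (tovec (\<rho> h)) (tovec (\<rho> k)))"
      unfolding J_trivector[OF p] L[symmetric] M[symmetric] by (simp only: add_ac)
    finally show ?thesis by (simp add: right_diff_distrib)
  qed
  \<comment> \<open>The remainders \<open>f/4\<close> of the two halves coincide, since
    \<open>tri\<close> is invariant under \<open>Ad\<close>.\<close>
  also have "tri (tovec (\<rho> f)) (tovec (\<rho> h)) (tovec (\<rho> k)) = tri (tovec (?lm f)) (tovec (?lm h)) (tovec (?lm k))"
    unfolding mid[OF fhk(1)] mid[OF fhk(2)] mid[OF fhk(3)] by (rule tri_Ad[OF inv_closed[OF y]])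
  also have "contract3 (YB x) (?lm f) (?lm h) (?lm k) =
      contract3 (Ad3 G (minv y) (YB x)) (\<rho> f) (\<rho> h) (\<rho> k)"
    unfolding mid'[OF fhk(1)] mid'[OF fhk(2)] mid'[OF fhk(3)] contract3_transform Ad3_def[abs_def] ..
  finally show ?thesis by simp
qed

lemma exchange_bracket_smooth:
  assumes "smooth_function aP W f" "smooth_function aP W h"
  shows "smooth_function aP W (pbr f h)"
  unfolding exchange_bracket_J using J.bracket_in_S assms by blast

lemma exchange_bracket_local:
  assumes "smooth_function aP W f" "p \<in> W" "\<And>q. q \<in> W \<Longrightarrow> f' q = f q"
  shows "pbr f' h p = pbr f h p"
proof -
  have "fderiv i f' p = fderiv i f p" for i
    unfolding fderiv_def by (rule DD_cong[OF W(1) assms(1,2), symmetric]) (simp add: assms(3))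
  then show ?thesis by (simp add: exchange_bracket_eq)
qed

lemma exchange_bracket_antisym:
  assumes "p \<in> W" shows "pbr f h p = - pbr h f p"
  unfolding exchange_bracket_eq sum_negf[symmetric]
proof (rule trans[OF sum.swap], intro sum.cong refl)
  fix i j
  show "poisson_tensor j i p * fderiv j f p * fderiv i h p = - (poisson_tensor i j p * fderiv i h p * fderiv j f p)"
    using J.\<pi>_anti[OF assms, of j i] by simp
qed

lemma exchange_bracket_derivation:
  assumes f: "smooth_function aP W f" and h: "smooth_function aP W h" and p: "p \<in> W"
  shows "pbr (\<lambda>x. f x + c * h x) k p =
      pbr f k p + c * pbr h k p"
    and "pbr (\<lambda>x. f x * h x) k p =
      f p * pbr h k p + h p * pbr f k p"
proof -
  have 1: "fderiv i (\<lambda>x. f x + c * h x) p = fderiv i f p + c * fderiv i h p" for i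
  proof -
    have "(\<lambda>x. c * h x) \<in> {F. smooth_function aP W F}" using J.S_mult[OF J.S_const] h by blast
    then have "fderiv i (\<lambda>x. f x + c * h x) p = fderiv i f p + fderiv i (\<lambda>x. c * h x) p"
      using J.D_add[OF _ _ p] f by blast
    moreover have "fderiv i (\<lambda>x. c * h x) p = c * fderiv i h p + h p * fderiv i (\<lambda>x. c) p"
      by (rule J.D_mult[OF J.S_const _ p]) (use h in simp)
    ultimately show ?thesis by (simp add: J.D_const[OF p])
  qed
  show "pbr (\<lambda>x. f x + c * h x) k p =
      pbr f k p + c * pbr h k p"
    unfolding exchange_bracket_eq 1 sum_distrib_left sum.distrib[symmetric]
    by (intro sum.cong refl) (simp add: algebra_simps)
  have 2: "fderiv i (\<lambda>x. f x * h x) p = f p * fderiv i h p + h p * fderiv i f p" for i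
    by (rule J.D_mult[OF _ _ p]) (use f h in simp_all)
  show "pbr (\<lambda>x. f x * h x) k p =
      f p * pbr h k p + h p * pbr f k p"
    unfolding exchange_bracket_eq 2 sum_distrib_left sum.distrib[symmetric]
    by (intro sum.cong refl) (simp add: algebra_simps)
qed

lemma exchange_bracket_jacobiator:
  assumes "smooth_function aP W f" "smooth_function aP W h" "smooth_function aP W k" "(x, y, z) \<in> W"
  defines "\<rho> \<equiv> \<lambda>F a. DD RhoM (axis a 1) F (x, y, z)"
  shows "pbr f (pbr h k) (x, y, z) + pbr h (pbr k f) (x, y, z) + pbr k (pbr f h) (x, y, z) =
    contract3 (YB z) (\<rho> f) (\<rho> h) (\<rho> k) -
    contract3 (Ad3 G (minv y) (YB x)) (\<rho> f) (\<rho> h) (\<rho> k)"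
  unfolding exchange_bracket_J \<rho>_def by (rule jacobiator_eq[OF assms(1-4)])

end

text \<open>Before the cyclic sum, the commutator term is antisymmetric in its last two indices and
  the derivative term in its first two; either suffices.\<close>

lemma antisym3_dynamical_YB:
  assumes \<Omega>: "\<Omega> \<in> G'" shows "antisym3 (YB \<Omega>)"
proof -
  define K where "K = (\<lambda>i j k. 1 / 2 * (\<Sum>a\<in>UNIV. dual_basis B a $ k *
       (rho G (axis a 1) (\<lambda>x. R x i j) \<Omega> + lam G (axis a 1) (\<lambda>x. R x i j) \<Omega>)))"
  have rho_anti: "rho G X (\<lambda>x. R x j i) \<Omega> = - rho G X (\<lambda>x. R x i j) \<Omega>" for X i j
  proof -
    have "rho G X (\<lambda>x. R x j i) \<Omega> = rho G X (\<lambda>x. (- 1) * R x i j) \<Omega>"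
      by (rule rho_cong[OF G'_open R_smooth \<Omega>]) (simp add: R_flip[of _ j i])
    then show ?thesis using rho_cmult[OF G'_open R_smooth \<Omega>, of X "- 1"] by simp
  qed
  have lam_anti: "lam G X (\<lambda>x. R x j i) \<Omega> = - lam G X (\<lambda>x. R x i j) \<Omega>" for X i j
  proof -
    have "lam G X (\<lambda>x. R x j i) \<Omega> = lam G X (\<lambda>x. - R x i j) \<Omega>"
      by (rule lam_cong[OF G'_open R_smooth \<Omega>]) (rule R_flip)
    also have "\<dots> = - lam G X (\<lambda>x. R x i j) \<Omega>"
      unfolding lam_def[of G X "\<lambda>x. - R x i j"]
      by (rule DERIV_imp_deriv[OF DERIV_minus[OF has_lam[OF G'_open R_smooth \<Omega>]]])
    finally show ?thesis .
  qed
  have "K j i k = - K i j k" for i j k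
    unfolding K_def rho_anti[where i=i and j=j] lam_anti[where i=i and j=j]
    by (simp only: minus_add_distrib[symmetric] mult_minus_right sum_negf)
  then have 1: "antisym3 (cycl K)" by (rule antisym3_cycl_left)
  have "comm_12_13 br (R \<Omega>) i k j = - comm_12_13 br (R \<Omega>) i j k" for i j k
    unfolding comm_12_13_def sum_negf[symmetric]
  proof (rule trans[OF sum.swap], intro sum.cong refl)
    fix a c
    have "struct_const br c a i = - struct_const br a c i"
      by (simp add: struct_const_def br_anti[of "axis c 1" "axis a 1"])
    then show "R \<Omega> c k * R \<Omega> a j * struct_const br c a i = - (R \<Omega> a j * R \<Omega> c k * struct_const br a c i)"
      by simp
  qed
  then have 2: "antisym3 (cycl (comm_12_13 br (R \<Omega>)))" by (rule antisym3_cycl_right)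
  have "YB \<Omega> = (\<lambda>i j k. cycl (comm_12_13 br (R \<Omega>)) i j k + cycl K i j k)"
    by (simp add: dynamical_YB_def cycl_def K_def fun_eq_iff algebra_simps)
  then show ?thesis using antisym3_add[OF 2 1] by simp
qed

section \<open>Equivalence of the Jacobi identity and the dynamical equation\<close>

lemma Ad3_one: "Ad3 G e0 s = s"
proof -
  have "Ad_matrix G e0 i a = axis i 1 $ a" for i a
    by (simp add: Ad_matrix_def Ad_one axis_def)
  then have "Ad3 G e0 s i j k = contract3 s (\<lambda>a. axis i 1 $ a) (\<lambda>a. axis j 1 $ a) (\<lambda>a. axis k 1 $ a)" for i j k
    by (simp add: Ad3_def contract3_def mult_ac)
  then show ?thesis by (simp add: contract3_axis fun_eq_iff)
qed

text \<open>The Jacobi identity is tested on functions of \<open>g\<close> alone whose differentials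
  along \<rho> at \<open>y\<close> are the basis covectors; each triple of them isolates one
  component.\<close>

lemma poisson_imp_invariant:
  assumes poisson: "poisson_bracket_on (subtopology tP domain) aP (pbr)"
    and x: "x \<in> G'" and y: "y \<in> cG" and z: "z \<in> G'"
  shows "YB z = Ad3 G (minv y) (YB x)"
proof -
  obtain V f where V: "openin tG V" "y \<in> V" "\<And>a. smooth_function aG V (f a)"
    "\<And>X a. rho G X (f a) y = X $ a" by (rule frame[OF y]) blast
  define W where "W = G' \<times> V \<times> G'"
  define F where "F a p = f a (fst (snd p))" for a and p :: "'g \<times> 'g \<times> 'g"
  have VG: "V \<subseteq> cG" by (rule openin_subset_carrier[OF V(1)])
  have W: "openin tP W" "W \<subseteq> domain"
    using VG V(1) G'_open by (auto simp: W_def openin_prod_Times_iff)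
  have W': "openin (subtopology tP domain) W"
    using W by (auto simp: openin_open_subtopology[OF domain_open])
  have p: "(x, y, z) \<in> W" using x z V(2) by (simp add: W_def)
  have a2: "smooth_atlas (prod_topology tG tG) (prod_atlas aG aG)" by (intro smooth_atlas_prod atlas)
  have "smooth_map tP aP tG aG (\<lambda>p. fst (snd p))"
    by (rule smooth_map_compose[OF atlasP a2 atlas smooth_map_snd[OF atlas a2] smooth_map_fst[OF atlas atlas]])
  then have sF: "smooth_function aP W (F a)" for a
    unfolding F_def[abs_def]
    by (rule smooth_function_compose[OF atlasP atlas _ V(1) V(3) W(1)]) (auto simp: W_def)
  have \<rho>: "(\<lambda>a. DD RhoM (axis a 1) (F i) (x, y, z)) = (\<lambda>a. axis i 1 $ a)" for i
    by (simp add: fun_eq_iff DD_slices F_def V(4) axis_def)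
  have "YB z i j k - Ad3 G (minv y) (YB x) i j k = 0" for i j k
  proof -
    have "pbr (F i) (pbr (F j) (F k)) (x, y, z) + pbr (F j) (pbr (F k) (F i)) (x, y, z) +
        pbr (F k) (pbr (F i) (F j)) (x, y, z) = 0"
      using poisson[unfolded poisson_bracket_on_def, rule_format, OF W' sF sF, of i j] sF[of k] p by blast
    then show ?thesis
      unfolding exchange_bracket_jacobiator[OF W sF sF sF p] \<rho> contract3_axis .
  qed
  then show ?thesis by (simp add: fun_eq_iff)
qed

theorem poisson_iff:
  "poisson_bracket_on (subtopology tP domain) aP (pbr) \<longleftrightarrow>
    (\<exists>I. antisym3 I \<and> (\<forall>q\<in>cG. Ad3 G q I = I) \<and> (\<forall>\<Omega>\<in>G'. YB \<Omega> = I))"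
proof
  assume poisson: "poisson_bracket_on (subtopology tP domain) aP (pbr)"
  obtain x where x: "x \<in> G'" using G'_ne by blast
  \<comment> \<open>With the identity as group element, the tensors at any two points of
    \<open>G'\<close> are equal.\<close>
  have const: "YB z = YB x" if z: "z \<in> G'" for z
    using poisson_imp_invariant[OF poisson x one_closed z] by (simp add: Ad3_one)
  \<comment> \<open>With both variables in \<open>G'\<close> equal, the group element is free and
    yields invariance.\<close>
  have "Ad3 G q (YB x) = YB x" if q: "q \<in> cG" for q
    using poisson_imp_invariant[OF poisson x inv_closed[OF q] x] q by simp
  with antisym3_dynamical_YB[OF x] const
  show "\<exists>I. antisym3 I \<and> (\<forall>q\<in>cG. Ad3 G q I = I) \<and> (\<forall>\<Omega>\<in>G'. YB \<Omega> = I)"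
    by blast
next
  assume "\<exists>I. antisym3 I \<and> (\<forall>q\<in>cG. Ad3 G q I = I) \<and> (\<forall>\<Omega>\<in>G'. YB \<Omega> = I)"
  then obtain I where I: "\<And>q. q \<in> cG \<Longrightarrow> Ad3 G q I = I" "\<And>\<Omega>. \<Omega> \<in> G' \<Longrightarrow> YB \<Omega> = I"
    by blast
  show "poisson_bracket_on (subtopology tP domain) aP (pbr)"
    unfolding poisson_bracket_on_def
  proof (intro allI impI conjI ballI)
    fix W f h
    assume "openin (subtopology tP domain) W" and f: "smooth_function aP W f" and h: "smooth_function aP W h"
    then have W: "openin tP W" "W \<subseteq> domain"
      by (auto simp: openin_open_subtopology[OF domain_open])
    \<comment> \<open>Both contractions in the Jacobiator involve the same tensor: \<open>I\<close>
      at one end, and its invariant transform at the other.\<close>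
    have jacobi: "pbr f (pbr h k) p +
        pbr h (pbr k f) p +
        pbr k (pbr f h) p = 0"
      if k: "smooth_function aP W k" and p: "p \<in> W" for k p
    proof -
      obtain x y z where pe: "p = (x, y, z)" using prod_cases3 by blast
      have "x \<in> G'" "y \<in> cG" "z \<in> G'" using p W(2) by (auto simp: pe)
      then show ?thesis
        using exchange_bracket_jacobiator[OF W f h k p[unfolded pe]] by (simp add: pe I)
    qed
    show "smooth_function aP W (pbr f h)"
      by (rule exchange_bracket_smooth[OF W f h])
    show "pbr f' h p = pbr f h p"
      if "\<forall>p\<in>W. f' p = f p" "p \<in> W" for f' p
      by (rule exchange_bracket_local[OF W f that(2)]) (rule bspec[OF that(1)])
    show "pbr f h p = - pbr h f p" if "p \<in> W" for p
      by (rule exchange_bracket_antisym[OF W that])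
    fix k p assume k: "smooth_function aP W k" and p: "p \<in> W"
    show "pbr (\<lambda>x. f x + c * h x) k p =
            pbr f k p + c * pbr h k p" for c
      by (rule exchange_bracket_derivation(1)[OF W f h p])
    show "pbr (\<lambda>x. f x * h x) k p =
            f p * pbr h k p + h p * pbr f k p"
      by (rule exchange_bracket_derivation(2)[OF W f h p])
    show "pbr f (pbr h k) p +
           pbr h (pbr k f) p +
           pbr k (pbr f h) p = 0"
      by (rule jacobi[OF k p])
  qed
qed

end

theorem proposition1:
  fixes G :: "('g, 'k::{real_normed_field,euclidean_space}, 'n::finite) lie_group_data"
    and B :: "'k ^ 'n \<Rightarrow> 'k ^ 'n \<Rightarrow> 'k"
    and r :: "('k, 'n) tensor2"
    and G' :: "'g set"
    and R :: "'g \<Rightarrow> ('k, 'n) tensor2"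
  assumes "lie_group G" and "connected_space (topol G)"
    and "invariant_scalar_product (lie_br G) B"
    and "antisym2 r"
    and "cycl (comm_12_13 (lie_br G) r) = (\<lambda>i j k. - 1 / 4 * f_tensor (lie_br G) B i j k)"
    and "openin (topol G) G'" and "G' \<noteq> {}"
    and "\<And>q \<Omega>. q \<in> carrier G \<Longrightarrow> \<Omega> \<in> G' \<Longrightarrow> q \<otimes>\<^bsub>G\<^esub> \<Omega> \<otimes>\<^bsub>G\<^esub> inv\<^bsub>G\<^esub> q \<in> G'"
    and "\<And>a b. smooth_function (charts G) G' (\<lambda>\<Omega>. R \<Omega> a b)"
    and "\<And>\<Omega>. \<Omega> \<in> G' \<Longrightarrow> antisym2 (R \<Omega>)"
    and "\<And>q \<Omega>. q \<in> carrier G \<Longrightarrow> \<Omega> \<in> G' \<Longrightarrow>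
           R (q \<otimes>\<^bsub>G\<^esub> \<Omega> \<otimes>\<^bsub>G\<^esub> inv\<^bsub>G\<^esub> q) = Ad2 G q (R \<Omega>)"
  shows "poisson_bracket_on
           (subtopology (prod_topology (topol G) (prod_topology (topol G) (topol G)))
             (G' \<times> carrier G \<times> G'))
           (prod_atlas (charts G) (prod_atlas (charts G) (charts G)))
           (exchange_bracket G B r R)
         \<longleftrightarrow>
         (\<exists>I. antisym3 I \<and> (\<forall>q\<in>carrier G. Ad3 G q I = I) \<and>
              (\<forall>\<Omega>\<in>G'. dynamical_YB G B R \<Omega> = I))"
proof -
  interpret lie G by unfold_locales (rule assms(1))
  interpret equivariant_group G B r G' R
    by unfold_locales (rule lie_algebra assms; assumption?)+
  show ?thesis by (rule poisson_iff)
qed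

end
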